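(* Let $G$ be a finitely generated group. Then there exist finitely many context-free subgroups $G_1,\dots,G_n$ of $G$ whose cores intersect trivially, i.e. $\bigcap_{i=1}^n \operatorname{core}(G_i)=1$, if and only if $G$ embeds into $V$ (i.e. there is an injective group homomorphism $G\to V$).
   Context: The core of a subgroup $G_*\le G$ is $\operatorname{core}(G_* )=\bigcap_{g\in G} g^{-1}G_*g$. R. Thompson's group $V$: for a word $\alpha\in\{0,1\}^*$ the cone $\alpha\{0,1\}^\omega$ is the set of right-infinite binary words with prefix $\alpha$. A prefix partition is a finite set $\mathcal A\subset\{0,1\}^*$ such that the cones $\alpha\{0,1\}^\omega$, $\alpha\in\mathcal A$, partition $\{0,1\}^\omega$. A bijection $f:\mathcal A\to\mathcal B$ between prefix partitions induces the map $[f]:\{0,1\}^\omega\to\{0,1\}^\omega$, $\alpha\eta\mapsto f(\alpha)\eta$ ($\alpha\in\mathcal A$, $\eta\in\{0,1\}^\omega$). $V$ is the group of all such maps, acting on $\{0,1\}^\omega$ on the right. Context-free subgroups: a symmetric alphabet is a finite set $\Sigma$ with an involution $s\mapsto\overline s$, extended to the free monoid $\Sigma^*$ by $\overline{s_1\cdots s_n}=\overline{s_n}\cdots\overline{s_1}$. A monoid homomorphism $\rho:\Sigma^*\to G$ is symmetric if $\rho(\overline\sigma)=\rho(\sigma)^{-1}$ for all $\sigma\in\Sigma^*$. The membership problem of a subgroup $G_*$ in $G$ with respect to a symmetric surjective homomorphism $\rho:\Sigma^*\to G$ is the language $\rho^{-1}(G_* )\subset\Sigma^*$. The subgroup $G_*$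 is a context-free subgroup of the finitely generated group $G$ if this language is context-free (in the usual sense: accepted by a pushdown automaton, equivalently generated by a context-free grammar); this does not depend on the choice of $\Sigma$ and $\rho$. *)

theory Defs
  imports "HOL-Algebra.Algebra" "HOL-Library.Stream" "HOL-Library.Disjoint_Sets"
begin

definition finitely_generated_group :: "('a, 'b) monoid_scheme \<Rightarrow> bool" where
  "finitely_generated_group G \<longleftrightarrow>
     group G \<and> (\<exists>S. finite S \<and> S \<subseteq> carrier G \<and> generate G S = carrier G)"

definition subgroup_core :: "('a, 'b) monoid_scheme \<Rightarrow> 'a set \<Rightarrow> 'a set" where
  "subgroup_core G H = (\<Inter>g\<in>carrier G. (inv\<^bsub>G\<^esub> g <#\<^bsub>G\<^esub> H) #>\<^bsub>G\<^esub> g)"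

datatype ('n, 't) symbol = Nonterminal 'n | Terminal 't

inductive derives_in_one_step ::
    "('n \<times> ('n, 't) symbol list) set \<Rightarrow> ('n, 't) symbol list \<Rightarrow> ('n, 't) symbol list \<Rightarrow> bool"
  for P where
  "(N, w) \<in> P \<Longrightarrow> derives_in_one_step P (u @ [Nonterminal N] @ v) (u @ w @ v)"

definition grammar_language :: "('n \<times> ('n, 't) symbol list) set \<Rightarrow> 'n \<Rightarrow> 't list set" where
  "grammar_language P S =
     {w. (derives_in_one_step P)\<^sup>*\<^sup>* [Nonterminal S] (map Terminal w)}"

text \<open>
  A grammar with finitely many productions uses only finitely many nonterminals, so there is
  no loss in taking the nonterminals to be natural numbers.
\<close>

definition context_free_language :: "'t list set \<Rightarrow> bool" where
  "context_free_language L \<longleftrightarrow>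
     (\<exists>(P :: (nat \<times> (nat, 't) symbol list) set) S. finite P \<and> L = grammar_language P S)"

definition free_monoid :: "'s set \<Rightarrow> 's list monoid" where
  "free_monoid \<Sigma> = \<lparr>carrier = lists \<Sigma>, monoid.mult = (@), one = []\<rparr>"

definition symmetric_alphabet :: "'s set \<Rightarrow> ('s \<Rightarrow> 's) \<Rightarrow> bool" where
  "symmetric_alphabet \<Sigma> bar \<longleftrightarrow>
     finite \<Sigma> \<and> (\<forall>s\<in>\<Sigma>. bar s \<in> \<Sigma> \<and> bar (bar s) = s)"

definition bar_word :: "('s \<Rightarrow> 's) \<Rightarrow> 's list \<Rightarrow> 's list" where
  "bar_word bar \<sigma> = rev (map bar \<sigma>)"

definition symmetric_surjection ::
    "('a, 'b) monoid_scheme \<Rightarrow> 's set \<Rightarrow> ('s \<Rightarrow> 's) \<Rightarrow> ('s list \<Rightarrow> 'a) \<Rightarrow> bool" where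
  "symmetric_surjection G \<Sigma> bar \<rho> \<longleftrightarrow>
     \<rho> \<in> hom (free_monoid \<Sigma>) G \<and> \<rho> [] = \<one>\<^bsub>G\<^esub> \<and>
     (\<forall>\<sigma>\<in>lists \<Sigma>. \<rho> (bar_word bar \<sigma>) = inv\<^bsub>G\<^esub> (\<rho> \<sigma>)) \<and>
     \<rho> ` lists \<Sigma> = carrier G"

definition membership_problem :: "'s set \<Rightarrow> ('s list \<Rightarrow> 'a) \<Rightarrow> 'a set \<Rightarrow> 's list set" where
  "membership_problem \<Sigma> \<rho> H = {\<sigma> \<in> lists \<Sigma>. \<rho> \<sigma> \<in> H}"

text \<open>
  Whether the membership problem is context-free does not depend on the choice of alphabet and
  homomorphism, so an existential quantifier is used. An alphabet being finite, its letters can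
  be taken to be natural numbers.
\<close>

definition context_free_subgroup :: "('a, 'b) monoid_scheme \<Rightarrow> 'a set \<Rightarrow> bool" where
  "context_free_subgroup G H \<longleftrightarrow>
     subgroup H G \<and>
     (\<exists>(\<Sigma> :: nat set) bar \<rho>.
        symmetric_alphabet \<Sigma> bar \<and> symmetric_surjection G \<Sigma> bar \<rho> \<and>
        context_free_language (membership_problem \<Sigma> \<rho> H))"

definition word_cone :: "bool list \<Rightarrow> bool stream set" where
  "word_cone \<alpha> = range (\<lambda>\<eta>. \<alpha> @- \<eta>)"

text \<open>
  Cones are nonempty and distinct words have distinct cones, so disjointness of the family
  indexed by words is disjointness of the cones themselves.
\<close>

definition prefix_partition :: "bool list set \<Rightarrow> bool" where
  "prefix_partition A \<longleftrightarrow>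
     finite A \<and> disjoint_family_on word_cone A \<and> (\<Union>\<alpha>\<in>A. word_cone \<alpha>) = UNIV"

definition induces_map ::
    "bool list set \<Rightarrow> (bool list \<Rightarrow> bool list) \<Rightarrow> (bool stream \<Rightarrow> bool stream) \<Rightarrow> bool" where
  "induces_map A f \<phi> \<longleftrightarrow> (\<forall>\<alpha>\<in>A. \<forall>\<eta>. \<phi> (\<alpha> @- \<eta>) = f \<alpha> @- \<eta>)"

text \<open>On a prefix partition, the conditions for the induced map have exactly one solution.\<close>

lemma induced_map_exists_unique:
  assumes "prefix_partition A"
  shows "\<exists>!\<phi>. induces_map A f \<phi>"
proof -
  have ex: "\<exists>\<alpha>\<in>A. \<exists>\<eta>. \<xi> = \<alpha> @- \<eta>" for \<xi>
    using assms unfolding prefix_partition_def word_cone_def by fast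
  have uniq: "\<alpha> = \<beta> \<and> \<eta> = \<theta>"
    if "\<alpha> \<in> A" "\<beta> \<in> A" "\<alpha> @- \<eta> = \<beta> @- \<theta>" for \<alpha> \<beta> \<eta> \<theta>
  proof -
    have "\<alpha> = \<beta>"
      using assms that unfolding prefix_partition_def disjoint_family_on_def word_cone_def
      by blast
    then show ?thesis
      using that(3) by (metis shift_left_inj)
  qed
  define \<phi> where "\<phi> \<xi> = (THE \<zeta>. \<exists>\<alpha>\<in>A. \<exists>\<eta>. \<xi> = \<alpha> @- \<eta> \<and> \<zeta> = f \<alpha> @- \<eta>)" for \<xi>
  have "\<phi> (\<alpha> @- \<eta>) = f \<alpha> @- \<eta>" if "\<alpha> \<in> A" for \<alpha> \<eta>
    unfolding \<phi>_def by (rule the_equality) (use that uniq in blast)+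
  then have "induces_map A f \<phi>"
    by (simp add: induces_map_def)
  moreover have "\<psi> = \<phi>'" if "induces_map A f \<psi>" "induces_map A f \<phi>'" for \<psi> \<phi>'
  proof
    fix \<xi>
    obtain \<alpha> \<eta> where "\<alpha> \<in> A" "\<xi> = \<alpha> @- \<eta>"
      using ex by blast
    then show "\<psi> \<xi> = \<phi>' \<xi>"
      using that by (simp add: induces_map_def)
  qed
  ultimately show ?thesis
    by blast
qed

text \<open>The action is on the right, so the product \<open>f g\<close> applies \<open>f\<close> first.\<close>

definition thompson_V :: "(bool stream \<Rightarrow> bool stream) monoid" where
  "thompson_V =
     \<lparr>carrier = {\<phi>. \<exists>A B f. prefix_partition A \<and> prefix_partition B \<and>
                       bij_betw f A B \<and> induces_map A f \<phi>},
      monoid.mult = (\<lambda>f g. g \<circ> f),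
      one = id\<rparr>"

end

theory Submission
  imports Defs
begin

text \<open>
  From the group to the subgroups. Let \<open>G\<close> act on streams through an embedding into \<open>V\<close>. The
  stabiliser of an eventually constant stream is context-free: the part of the stream before the
  constant tail behaves like the stack of a pushdown automaton, and generators only rewrite the
  top of this stack (\<open>context_free_eventually_constant_stabiliser\<close>). Finitely many such streams
  suffice. If the generators replace prefixes of length \<open>n\<close>, then every finite prefix that some
  group element can shorten to length at most \<open>n\<close> is dealt with by a stream starting with one of
  the finitely many short words; a prefix that can never be shortened that far is moved as a block
  by the whole group, and its shortest initial piece of this kind is one letter longer than a
  prefix that can (\<open>finitely_many_orbits_detect_identity\<close>). An element fixing the orbits of all
  \<open>\<alpha>ccc\<dots>\<close> with \<open>\<alpha>\<close> of length at most \<open>n + 1\<close> is therefore trivial.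
  
  From the subgroups to the group. Let \<open>K\<close> be a context-free subgroup and consider the Schreier
  graph on its right cosets. A closed path at the base point is parsed by the grammar, and the
  parse tree triangulates it with edges of bounded length, as in the theorem of Muller and Schupp.
  So a path that stays at or above the level of its starting point \<open>x\<close> (distance from the base
  point) and returns to that level can be cut into grammar pieces whose ends all lie within a fixed
  distance of \<open>x\<close> (\<open>loop_chain\<close>). Consequently a finite amount of data around \<open>x\<close> determines the
  whole cone above \<open>x\<close>, and there are finitely many types of cones (\<open>finitely_many_cone_types\<close>).
  The nested cones containing a vertex form a stack over a finite alphabet, and a generator changes
  only the top two letters of it (\<open>act_replaces_prefix\<close>). After these stacks have been written in
  binary and all bits that carry no information have been dropped, the codes are dense in the
  Cantor set, so the prefix replacements extend to elements of \<open>V\<close>, relations are inherited by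
  continuity (\<open>represents_unique\<close>), and the resulting homomorphism \<open>G \<rightarrow> V\<close> has its kernel in the core
  of \<open>K\<close> (\<open>context_free_subgroup_hom\<close>). Finitely many homomorphisms are merged into one by letting
  them act on disjoint cones (\<open>glue\<close>).
  
  Both directions use context-freeness only through splitting families: finite families of
  languages in which every word of length at least two factors through a product of two members
  that is contained in the language of the word.
\<close>

section \<open>Context-free languages through splitting families\<close>

text \<open>
  A grammar-free form of context-freeness. A member of a splitting family corresponds to a
  nonterminal of a grammar in Chomsky normal form, with a binary production for every product of two
  members contained in a third.
\<close>

definition concat_languages :: "'t list set \<Rightarrow> 't list set \<Rightarrow> 't list set" where
  "concat_languages M N = {u @ v |u v. u \<in> M \<and> v \<in> N}"

definition splits_in :: "'t list set set \<Rightarrow> 't list set \<Rightarrow> 't list \<Rightarrow> bool" where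
  "splits_in F M w \<longleftrightarrow> (\<exists>M1\<in>F. \<exists>M2\<in>F. \<exists>u\<in>M1. \<exists>v\<in>M2. w = u @ v \<and> u \<noteq> [] \<and> v \<noteq> [] \<and>
     concat_languages M1 M2 \<subseteq> M)"

definition splitting_family :: "'t list set set \<Rightarrow> bool" where
  "splitting_family F \<longleftrightarrow> finite F \<and> (\<forall>M\<in>F. \<forall>w\<in>M. 2 \<le> length w \<longrightarrow> splits_in F M w)"

lemma splits_inI:
  assumes "M1 \<in> F" "M2 \<in> F" "u \<in> M1" "v \<in> M2" "u \<noteq> []" "v \<noteq> []"
    and "\<And>u' v'. u' \<in> M1 \<Longrightarrow> v' \<in> M2 \<Longrightarrow> u' @ v' \<in> M"
  shows "splits_in F M (u @ v)"
proof -
  have "concat_languages M1 M2 \<subseteq> M" using assms(7) unfolding concat_languages_def by blast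
  then show ?thesis unfolding splits_in_def using assms(1-6) by blast
qed

lemma splits_in_mono: "splits_in F M w \<Longrightarrow> F \<subseteq> F' \<Longrightarrow> M \<subseteq> M' \<Longrightarrow> splits_in F' M' w"
  unfolding splits_in_def by (meson subsetD order.trans)

lemma splitting_familyE:
  assumes "splitting_family F" "M \<in> F" "w \<in> M" "2 \<le> length w"
  obtains M1 M2 u v where "M1 \<in> F" "M2 \<in> F" "u \<in> M1" "v \<in> M2" "w = u @ v" "u \<noteq> []" "v \<noteq> []"
    "\<And>u' v'. u' \<in> M1 \<Longrightarrow> v' \<in> M2 \<Longrightarrow> u' @ v' \<in> M"
proof -
  from assms obtain M1 M2 u v where *: "M1 \<in> F" "M2 \<in> F" "u \<in> M1" "v \<in> M2" "w = u @ v" "u \<noteq> []" "v \<noteq> []"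
    "concat_languages M1 M2 \<subseteq> M"
    unfolding splitting_family_def splits_in_def by blast
  show thesis
  proof (rule that[OF *(1-7)])
    fix u' v' assume "u' \<in> M1" "v' \<in> M2"
    then show "u' @ v' \<in> M"
      using *(8) unfolding concat_languages_def by blast
  qed
qed

lemma derives_in_context:
  assumes "(derives_in_one_step P)\<^sup>*\<^sup>* x y"
  shows "(derives_in_one_step P)\<^sup>*\<^sup>* (a @ x @ b) (a @ y @ b)"
  using assms
proof induction
  case base
  show ?case by simp
next
  case (step y z)
  from step(2) obtain N w u v where "(N, w) \<in> P" "y = u @ [Nonterminal N] @ v" "z = u @ w @ v"
    by (auto elim: derives_in_one_step.cases)
  then have "derives_in_one_step P (a @ y @ b) (a @ z @ b)"
    using derives_in_one_step.intros[of N w P "a @ u" "v @ b"] by simp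
  with step(3) show ?case by (rule rtranclp.rtrancl_into_rtrancl)
qed

lemma derives_append:
  assumes "(derives_in_one_step P)\<^sup>*\<^sup>* x x'" "(derives_in_one_step P)\<^sup>*\<^sup>* y y'"
  shows "(derives_in_one_step P)\<^sup>*\<^sup>* (x @ y) (x' @ y')"
  using derives_in_context[OF assms(1), of "[]" y] derives_in_context[OF assms(2), of x' "[]"]
  by simp

text \<open>
  Leftmost parse trees, built along the sentential form. They give an induction in which the
  word decomposes together with the form, which rewriting sequences do not.
\<close>

inductive yields :: "('n \<times> ('n, 't) symbol list) set \<Rightarrow> ('n, 't) symbol list \<Rightarrow> 't list \<Rightarrow> bool"
  for P where
  yields_Nil: "yields P [] []"
| yields_Terminal: "yields P \<beta> w \<Longrightarrow> yields P (Terminal s # \<beta>) (s # w)"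
| yields_Nonterminal:
    "(N, \<gamma>) \<in> P \<Longrightarrow> yields P \<gamma> v \<Longrightarrow> yields P \<beta> w \<Longrightarrow> yields P (Nonterminal N # \<beta>) (v @ w)"

lemma yields_append_iff:
  "yields P (\<alpha> @ \<beta>) w \<longleftrightarrow> (\<exists>u v. w = u @ v \<and> yields P \<alpha> u \<and> yields P \<beta> v)"
proof (induction \<alpha> arbitrary: w)
  case Nil
  then show ?case by (auto intro: yields_Nil elim: yields.cases)
next
  case (Cons x \<alpha>)
  show ?case
  proof
    assume "yields P ((x # \<alpha>) @ \<beta>) w"
    then have "yields P (x # (\<alpha> @ \<beta>)) w" by simp
    then show "\<exists>u v. w = u @ v \<and> yields P (x # \<alpha>) u \<and> yields P \<beta> v"
    proof cases
      case (yields_Terminal w' s)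
      then obtain u v where "w' = u @ v" "yields P \<alpha> u" "yields P \<beta> v"
        using Cons.IH by blast
      then show ?thesis
        using yields_Terminal yields.yields_Terminal[of P \<alpha> u s] by (metis append_Cons)
    next
      case (yields_Nonterminal N \<gamma> v1 w')
      then obtain u v where "w' = u @ v" "yields P \<alpha> u" "yields P \<beta> v"
        using Cons.IH by blast
      then show ?thesis
        using yields_Nonterminal yields.yields_Nonterminal[of N \<gamma> P v1 \<alpha> u]
        by (metis append.assoc)
    qed
  next
    assume "\<exists>u v. w = u @ v \<and> yields P (x # \<alpha>) u \<and> yields P \<beta> v"
    then obtain u v where w: "w = u @ v" and u: "yields P (x # \<alpha>) u" and v: "yields P \<beta> v"
      by blast
    from u have "yields P (x # (\<alpha> @ \<beta>)) w"
    proof cases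
      case (yields_Terminal w' s)
      then show ?thesis
        using Cons.IH v w yields.yields_Terminal[of P "\<alpha> @ \<beta>" "w' @ v" s] by auto
    next
      case (yields_Nonterminal N \<gamma> v1 w')
      then show ?thesis
        using Cons.IH v w yields.yields_Nonterminal[of N \<gamma> P v1 "\<alpha> @ \<beta>" "w' @ v"] by auto
    qed
    then show "yields P ((x # \<alpha>) @ \<beta>) w" by simp
  qed
qed

lemma yields_map_Terminal: "yields P (map Terminal w) w"
  by (induction w) (auto intro: yields.intros)

lemma derives_iff_yields:
  "(derives_in_one_step P)\<^sup>*\<^sup>* \<beta> (map Terminal w) \<longleftrightarrow> yields P \<beta> w"
proof
  assume "(derives_in_one_step P)\<^sup>*\<^sup>* \<beta> (map Terminal w)"
  then show "yields P \<beta> w"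
  proof (induction rule: converse_rtranclp_induct)
    case base
    show ?case by (rule yields_map_Terminal)
  next
    case (step y z)
    from step(1) obtain N \<gamma> u v where p: "(N, \<gamma>) \<in> P" "y = u @ [Nonterminal N] @ v" "z = u @ \<gamma> @ v"
      by (auto elim: derives_in_one_step.cases)
    from step(3) p obtain w1 w2 w3 where "w = w1 @ w2 @ w3" "yields P u w1" "yields P \<gamma> w2" "yields P v w3"
      by (auto simp: yields_append_iff)
    moreover from this p(1) have "yields P [Nonterminal N] w2"
      using yields_Nonterminal[OF p(1) _ yields_Nil] by fastforce
    ultimately show ?case
      unfolding p(2) yields_append_iff by blast
  qed
next
  assume "yields P \<beta> w"
  then show "(derives_in_one_step P)\<^sup>*\<^sup>* \<beta> (map Terminal w)"
  proof induction
    case yields_Nil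
    show ?case by simp
  next
    case (yields_Terminal \<beta> w s)
    then show ?case
      using derives_in_context[of P \<beta> "map Terminal w" "[Terminal s]" "[]"] by simp
  next
    case (yields_Nonterminal N \<gamma> v \<beta> w)
    have "derives_in_one_step P [Nonterminal N] \<gamma>"
      using derives_in_one_step.intros[OF yields_Nonterminal(1), of "[]" "[]"] by simp
    then have "(derives_in_one_step P)\<^sup>*\<^sup>* [Nonterminal N] (map Terminal v)"
      using yields_Nonterminal(4) by (rule converse_rtranclp_into_rtranclp)
    from derives_append[OF this yields_Nonterminal(5)] show ?case by simp
  qed
qed

text \<open>
  The family consists of the languages derived from the contiguous factors of right-hand sides:
  cutting such a factor in two gives such factors again, which makes all productions binary.
  Where one part of a cut derives the empty word, the splitting of the other part is also a splitting
  of the whole.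
\<close>

lemma context_free_language_splitting_family:
  assumes "context_free_language L"
  obtains F where "splitting_family F" "L \<in> F"
proof -
  from assms obtain P :: "(nat \<times> (nat, 'a) symbol list) set" and S
    where fin: "finite P" and L: "L = grammar_language P S"
    unfolding context_free_language_def by blast
  define Q where "Q = insert [Nonterminal S] (\<Union>(N, \<gamma>)\<in>P. {\<beta>. \<exists>a c. \<gamma> = a @ \<beta> @ c})"
  define lang where "lang \<beta> = {w. yields P \<beta> w}" for \<beta>
  have "finite {\<beta>. \<exists>a c. \<gamma> = a @ \<beta> @ c}" for \<gamma> :: "(nat, 'a) symbol list"
  proof (rule finite_subset)
    show "{\<beta>. \<exists>a c. \<gamma> = a @ \<beta> @ c} \<subseteq> (\<lambda>(i, j). take i (drop j \<gamma>)) ` ({..length \<gamma>} \<times> {..length \<gamma>})"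
    proof clarify
      fix \<beta> a c assume *: "\<gamma> = a @ \<beta> @ c"
      show "\<beta> \<in> (\<lambda>(i, j). take i (drop j (a @ \<beta> @ c))) `
          ({..length (a @ \<beta> @ c)} \<times> {..length (a @ \<beta> @ c)})"
        by (rule image_eqI[where x = "(length \<beta>, length a)"]) auto
    qed
  qed auto
  then have finQ: "finite Q"
    using fin unfolding Q_def by auto
  have sub: "\<beta> \<in> Q" if "a @ \<beta> @ c \<in> Q" "\<beta> \<noteq> [] \<or> a @ \<beta> @ c \<noteq> [Nonterminal S]" for a \<beta> c
  proof (cases "a @ \<beta> @ c = [Nonterminal S]")
    case True
    with that(2) have "\<beta> = [Nonterminal S]"
      by (auto simp: append_eq_Cons_conv)
    then show ?thesis by (simp add: Q_def)
  next
    case False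
    with that(1) obtain N \<gamma> a' c' where "(N, \<gamma>) \<in> P" "\<gamma> = a' @ (a @ \<beta> @ c) @ c'"
      unfolding Q_def by blast
    then have "(N, \<gamma>) \<in> P \<and> \<gamma> = (a' @ a) @ \<beta> @ (c @ c')" by simp
    then show ?thesis unfolding Q_def by blast
  qed
  have rhs: "\<gamma> \<in> Q" if "(N, \<gamma>) \<in> P" for N \<gamma>
  proof -
    have "\<gamma> = [] @ \<gamma> @ []" by simp
    then show ?thesis using that unfolding Q_def by blast
  qed
  have splitI: "splits_in (lang ` Q) (lang \<beta>) (u @ v)"
    if "\<alpha> \<in> Q" "\<alpha>' \<in> Q" "yields P \<alpha> u" "yields P \<alpha>' v" "u \<noteq> []" "v \<noteq> []" "\<beta> = \<alpha> @ \<alpha>'"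
    for \<alpha> \<alpha>' \<beta> u v
    using that by (intro splits_inI[of "lang \<alpha>" _ "lang \<alpha>'"]) (auto simp: lang_def yields_append_iff)
  have split: "splits_in (lang ` Q) (lang \<beta>) w"
    if "yields P \<beta> w" "\<beta> \<in> Q" "2 \<le> length w" for \<beta> w
    using that
  proof (induction rule: yields.induct)
    case yields_Nil
    then show ?case by simp
  next
    case (yields_Terminal \<beta> w s)
    then have "w \<noteq> []" "\<beta> \<noteq> []" by (auto elim: yields.cases)
    then have "[Terminal s] \<in> Q" "\<beta> \<in> Q"
      using sub[of "[]" "[Terminal s]" \<beta>] sub[of "[Terminal s]" \<beta> "[]"] yields_Terminal.prems by simp_all
    moreover have "yields P [Terminal s] [s]" by (intro yields.intros)
    ultimately show ?case
      using splitI[of "[Terminal s]" \<beta> "[s]" w] yields_Terminal.hyps \<open>w \<noteq> []\<close> by simp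
  next
    case (yields_Nonterminal N \<gamma> v \<beta> w)
    have N: "yields P [Nonterminal N] u" if "yields P \<gamma> u" for u
      using yields.yields_Nonterminal[OF yields_Nonterminal(1) that yields.yields_Nil] by simp
    have NQ: "[Nonterminal N] \<in> Q"
      using sub[of "[]" "[Nonterminal N]" \<beta>] yields_Nonterminal.prems by simp
    have \<beta>Q: "\<beta> \<in> Q" if "w \<noteq> []"
    proof -
      have "\<beta> \<noteq> []" using yields_Nonterminal(3) that by (auto elim: yields.cases)
      then show ?thesis using sub[of "[Nonterminal N]" \<beta> "[]"] yields_Nonterminal.prems by simp
    qed
    consider "v = []" | "w = []" | "v \<noteq> []" "w \<noteq> []" by blast
    then show ?case
    proof cases
      case 1
      have "lang \<beta> \<subseteq> lang (Nonterminal N # \<beta>)"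
        using yields.yields_Nonterminal[OF yields_Nonterminal(1,2)] 1 by (auto simp: lang_def)
      moreover have "splits_in (lang ` Q) (lang \<beta>) w"
        using yields_Nonterminal.IH(2) \<beta>Q yields_Nonterminal.prems 1 by fastforce
      ultimately show ?thesis using 1 by (auto elim: splits_in_mono)
    next
      case 2
      have "lang \<gamma> \<subseteq> lang (Nonterminal N # \<beta>)"
        using yields.yields_Nonterminal[OF yields_Nonterminal(1) _ yields_Nonterminal(3)] 2
        by (auto simp: lang_def)
      moreover have "splits_in (lang ` Q) (lang \<gamma>) v"
        using yields_Nonterminal.IH(1) rhs[OF yields_Nonterminal(1)] yields_Nonterminal.prems 2 by auto
      ultimately show ?thesis using 2 by (auto elim: splits_in_mono)
    next
      case 3
      then show ?thesis
        using splitI[OF NQ \<beta>Q N[OF yields_Nonterminal(2)] yields_Nonterminal(3)] by simp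
    qed
  qed
  have "splitting_family (lang ` Q)"
    unfolding splitting_family_def using finQ split by (auto simp: lang_def)
  moreover have "L \<in> lang ` Q"
    by (rule image_eqI[where x = "[Nonterminal S]"])
      (simp_all add: L grammar_language_def lang_def derives_iff_yields Q_def)
  ultimately show thesis by (rule that)
qed

text \<open>
  The members of the family become nonterminals. Words of length at most one, of which there are
  finitely many over a finite alphabet, are produced directly.
\<close>

lemma splitting_family_context_free_language:
  fixes F :: "'t list set set"
  assumes F: "splitting_family F" "L \<in> F" and \<Sigma>: "finite \<Sigma>" "\<And>M. M \<in> F \<Longrightarrow> M \<subseteq> lists \<Sigma>"
  shows "context_free_language L"
proof -
  have "finite F" using F(1) unfolding splitting_family_def by blast
  then obtain nt :: "'t list set \<Rightarrow> nat" where inj: "inj_on nt F"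
    using finite_imp_inj_to_nat_seg by metis
  define P1 where "P1 = {(nt M, [Nonterminal (nt M1), Nonterminal (nt M2) :: (nat, 't) symbol]) |M M1 M2.
      M \<in> F \<and> M1 \<in> F \<and> M2 \<in> F \<and> concat_languages M1 M2 \<subseteq> M}"
  define P2 where "P2 = {(nt M, map (Terminal :: 't \<Rightarrow> (nat, 't) symbol) w) |M w. M \<in> F \<and> w \<in> M \<and> length w \<le> 1}"
  define P where "P = P1 \<union> P2"
  have "P1 \<subseteq> (\<lambda>(M, M1, M2). (nt M, [Nonterminal (nt M1), Nonterminal (nt M2)])) ` (F \<times> F \<times> F)"
    unfolding P1_def by (auto simp: image_iff)
  then have "finite P1"
    by (rule finite_subset) (simp add: \<open>finite F\<close>)
  have "P2 \<subseteq> (\<lambda>(M, w). (nt M, map Terminal w)) ` (F \<times> {w. set w \<subseteq> \<Sigma> \<and> length w \<le> 1})"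
    using \<Sigma>(2) unfolding P2_def by (fastforce simp: image_iff)
  moreover have "finite {w. set w \<subseteq> \<Sigma> \<and> length w \<le> 1}"
    by (rule finite_lists_length_le[OF \<Sigma>(1)])
  ultimately have "finite P2"
    by (meson \<open>finite F\<close> finite_SigmaI finite_imageI finite_subset)
  have sound: "w \<in> M" if "M \<in> F" "yields P [Nonterminal (nt M)] w" for M w
  proof -
    \<comment> \<open>Only three shapes of sentential forms occur below a nonterminal, so soundness is needed for these.\<close>
  define good where "good \<beta> w \<longleftrightarrow> (\<forall>M1\<in>F. \<forall>M2\<in>F.
       (\<beta> = [Nonterminal (nt M1)] \<longrightarrow> w \<in> M1) \<and>
       (\<beta> = [Nonterminal (nt M1), Nonterminal (nt M2)] \<longrightarrow> w \<in> concat_languages M1 M2) \<and>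
       (\<forall>v. \<beta> = map Terminal v \<longrightarrow> w = v))" for \<beta> :: "(nat, 't) symbol list" and w
    have "good \<beta> w" if "yields P \<beta> w" for \<beta> w
      using that
    proof induction
      case yields_Nil
      then show ?case by (simp add: good_def)
    next
      case (yields_Terminal \<beta> w s)
      then show ?case by (auto simp: good_def)
    next
      case (yields_Nonterminal N \<gamma> v \<beta> w)
      have v: "v \<in> M" if "M \<in> F" "N = nt M" for M
      proof -
        from \<open>(N, \<gamma>) \<in> P\<close> consider
            (a) M' M1 M2 where "N = nt M'" "\<gamma> = [Nonterminal (nt M1), Nonterminal (nt M2)]"
              "M' \<in> F" "M1 \<in> F" "M2 \<in> F" "concat_languages M1 M2 \<subseteq> M'"
          | (b) M' x where "N = nt M'" "\<gamma> = map Terminal x" "M' \<in> F" "x \<in> M'"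
          unfolding P_def P1_def P2_def by blast
        then show ?thesis
        proof cases
          case a
          then have "M' = M" using inj that by (simp add: inj_on_eq_iff)
          moreover have "v \<in> concat_languages M1 M2"
            using a yields_Nonterminal.IH(1) unfolding good_def by blast
          ultimately show ?thesis using a by blast
        next
          case b
          then have "M' = M" using inj that by (simp add: inj_on_eq_iff)
          moreover have "v = x"
            using b yields_Nonterminal.IH(1) unfolding good_def by blast
          ultimately show ?thesis using b by blast
        qed
      qed
      show ?case
        unfolding good_def
      proof (intro ballI conjI impI allI)
        fix M1 M2 assume M: "M1 \<in> F" "M2 \<in> F" and "Nonterminal N # \<beta> = [Nonterminal (nt M1)]"
        then have "N = nt M1" "\<beta> = []" by auto
        then show "v @ w \<in> M1"
          using v[OF M(1)] yields_Nonterminal(3) by (auto elim: yields.cases)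
      next
        fix M1 M2 assume M: "M1 \<in> F" "M2 \<in> F"
          and "Nonterminal N # \<beta> = [Nonterminal (nt M1), Nonterminal (nt M2)]"
        then have "N = nt M1" "\<beta> = [Nonterminal (nt M2)]" by auto
        then show "v @ w \<in> concat_languages M1 M2"
          using v[OF M(1)] yields_Nonterminal.IH(2) M unfolding good_def concat_languages_def by blast
      qed auto
    qed
    with that show ?thesis unfolding good_def by blast
  qed
  have complete: "yields P [Nonterminal (nt M)] w" if "M \<in> F" "w \<in> M" for M w
    using that
  proof (induction "length w" arbitrary: M w rule: less_induct)
    case less
    show ?case
    proof (cases "2 \<le> length w")
      case True
      from splitting_familyE[OF F(1) less.prems True] obtain M1 M2 u v
        where s: "M1 \<in> F" "M2 \<in> F" "u \<in> M1" "v \<in> M2" "w = u @ v" "u \<noteq> []" "v \<noteq> []"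
          "\<And>u' v'. u' \<in> M1 \<Longrightarrow> v' \<in> M2 \<Longrightarrow> u' @ v' \<in> M"
        by metis
      have "(nt M, [Nonterminal (nt M1), Nonterminal (nt M2)]) \<in> P"
        using s less.prems unfolding P_def P1_def concat_languages_def by blast
      moreover have "yields P [Nonterminal (nt M1)] u" "yields P [Nonterminal (nt M2)] v"
        using s less.hyps by auto
      then have "yields P [Nonterminal (nt M1), Nonterminal (nt M2)] w"
        using yields_append_iff[of P "[Nonterminal (nt M1)]" "[Nonterminal (nt M2)]" w] s(5) by auto
      ultimately show ?thesis
        using yields_Nonterminal[OF _ _ yields_Nil] by fastforce
    next
      case False
      then have "(nt M, map Terminal w) \<in> P"
        using less.prems unfolding P_def P2_def by fastforce
      then show ?thesis
        using yields_Nonterminal[OF _ yields_map_Terminal yields_Nil] by fastforce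
    qed
  qed
  have "grammar_language P (nt L) = L"
    unfolding grammar_language_def derives_iff_yields
    using sound complete F(2) by blast
  moreover have "finite P"
    using \<open>finite P1\<close> \<open>finite P2\<close> by (simp add: P_def)
  ultimately show ?thesis
    unfolding context_free_language_def by blast
qed

section \<open>Local prefix replacement and Thompson's group\<close>

lemma shift_eq_shiftD:
  assumes "\<alpha> @- \<eta> = \<beta> @- \<theta>" "length \<alpha> \<le> length \<beta>"
  shows "\<exists>r. \<beta> = \<alpha> @ r \<and> \<eta> = r @- \<theta>"
  using assms
proof (induction \<alpha> arbitrary: \<beta>)
  case Nil
  then show ?case by simp
next
  case (Cons a \<alpha>)
  then obtain b \<beta>' where "\<beta> = b # \<beta>'" by (cases \<beta>) auto
  with Cons show ?case by auto
qed

text \<open>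
  Both constants are needed: a single stream such as \<open>ccc\<dots>\<close> is fixed by adding or removing
  letters \<open>c\<close>.
\<close>

lemma shift_sconst_eqD:
  assumes "\<And>c. \<alpha> @- sconst c = \<beta> @- sconst (c :: bool)"
  shows "\<alpha> = \<beta>"
proof -
  have *: "\<alpha> = \<beta>" if le: "length \<alpha> \<le> length \<beta>" and eq: "\<And>c. \<alpha> @- sconst c = \<beta> @- sconst (c :: bool)"
    for \<alpha> \<beta>
  proof -
    obtain r where r: "\<beta> = \<alpha> @ r"
      using shift_eq_shiftD[OF eq le] by blast
    have "r = []"
    proof (cases r)
      case (Cons x r')
      have "sconst (\<not> x) = r @- sconst (\<not> x)"
        using eq[of "\<not> x"] r by simp
      then have "shd (sconst (\<not> x)) = shd (r @- sconst (\<not> x))" by simp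
      then show ?thesis using Cons by simp
    qed
    with r show ?thesis by simp
  qed
  show ?thesis
    using *[of \<alpha> \<beta>] *[of \<beta> \<alpha>] assms by (metis nat_le_linear)
qed

definition replaces_prefixes :: "nat \<Rightarrow> (bool stream \<Rightarrow> bool stream) \<Rightarrow> bool" where
  "replaces_prefixes n \<psi> \<longleftrightarrow> (\<forall>\<alpha>. length \<alpha> = n \<longrightarrow> (\<exists>\<beta>. \<forall>\<eta>. \<psi> (\<alpha> @- \<eta>) = \<beta> @- \<eta>))"

lemma replaces_prefixesE:
  assumes "replaces_prefixes n \<psi>" "n \<le> length \<alpha>"
  obtains \<beta> where "\<And>\<eta>. \<psi> (\<alpha> @- \<eta>) = \<beta> @- \<eta>"
proof -
  have "length (take n \<alpha>) = n" using assms by simp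
  then obtain \<beta> where "\<And>\<eta>. \<psi> (take n \<alpha> @- \<eta>) = \<beta> @- \<eta>"
    using assms(1) unfolding replaces_prefixes_def by blast
  then have "\<psi> (\<alpha> @- \<eta>) = (\<beta> @ drop n \<alpha>) @- \<eta>" for \<eta>
    by (metis append_take_drop_id shift_append)
  then show thesis by (rule that)
qed

lemma replaces_prefixes_mono: "replaces_prefixes n \<psi> \<Longrightarrow> n \<le> m \<Longrightarrow> replaces_prefixes m \<psi>"
  unfolding replaces_prefixes_def[of m] by (metis replaces_prefixesE)

lemma finite_bool_words: "finite {\<alpha> :: bool list. length \<alpha> = n}" "finite {\<alpha> :: bool list. length \<alpha> \<le> n}"
  using finite_lists_length_eq[of "UNIV :: bool set" n] finite_lists_length_le[of "UNIV :: bool set" n]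
  by simp_all

lemma replaces_prefixes_comp:
  assumes "replaces_prefixes n \<psi>" "replaces_prefixes m \<theta>"
  shows "replaces_prefixes (n + m) (\<theta> \<circ> \<psi>)"
  unfolding replaces_prefixes_def
proof (intro allI impI)
  fix \<alpha> :: "bool list" assume len: "length \<alpha> = n + m"
  then have "n \<le> length (take n \<alpha>)" by simp
  then obtain \<beta> where \<beta>: "\<And>\<eta>. \<psi> (take n \<alpha> @- \<eta>) = \<beta> @- \<eta>"
    using replaces_prefixesE[OF assms(1)] by metis
  have "m \<le> length (\<beta> @ drop n \<alpha>)" using len by simp
  then obtain \<gamma> where "\<And>\<eta>. \<theta> ((\<beta> @ drop n \<alpha>) @- \<eta>) = \<gamma> @- \<eta>"
    using replaces_prefixesE[OF assms(2)] by metis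
  moreover have "\<psi> (\<alpha> @- \<eta>) = (\<beta> @ drop n \<alpha>) @- \<eta>" for \<eta>
    using \<beta> by (metis append_take_drop_id shift_append)
  ultimately show "\<exists>\<gamma>. \<forall>\<eta>. (\<theta> \<circ> \<psi>) (\<alpha> @- \<eta>) = \<gamma> @- \<eta>" by auto
qed

lemma prefix_partition_coverE:
  assumes "prefix_partition A"
  obtains \<alpha> \<eta> where "\<alpha> \<in> A" "\<xi> = \<alpha> @- \<eta>"
proof -
  have "\<xi> \<in> (\<Union>\<alpha>\<in>A. word_cone \<alpha>)" using assms unfolding prefix_partition_def by simp
  then show thesis unfolding word_cone_def using that by blast
qed

lemma prefix_partition_uniqueD:
  assumes "prefix_partition A" "\<alpha> \<in> A" "\<beta> \<in> A" "\<alpha> @- \<eta> = \<beta> @- \<theta>"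
  shows "\<alpha> = \<beta> \<and> \<eta> = \<theta>"
proof -
  have "\<alpha> = \<beta>"
    using assms unfolding prefix_partition_def disjoint_family_on_def word_cone_def by blast
  then show ?thesis using assms(4) by (metis shift_left_inj)
qed

lemma prefix_partitionI:
  assumes "finite A"
    and "\<And>\<alpha> \<beta> \<eta> \<theta>. \<alpha> \<in> A \<Longrightarrow> \<beta> \<in> A \<Longrightarrow> \<alpha> @- \<eta> = \<beta> @- \<theta> \<Longrightarrow> \<alpha> = \<beta>"
    and "\<And>\<xi>. \<exists>\<alpha>\<in>A. \<exists>\<eta>. \<xi> = \<alpha> @- \<eta>"
  shows "prefix_partition A"
proof -
  have "word_cone \<alpha> \<inter> word_cone \<beta> = {}" if "\<alpha> \<in> A" "\<beta> \<in> A" "\<alpha> \<noteq> \<beta>" for \<alpha> \<beta>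
    using assms(2)[OF that(1,2)] that(3) unfolding word_cone_def by blast
  moreover have "\<xi> \<in> (\<Union>\<alpha>\<in>A. word_cone \<alpha>)" for \<xi>
    using assms(3)[of \<xi>] unfolding word_cone_def by blast
  ultimately show ?thesis
    using assms(1) unfolding prefix_partition_def disjoint_family_on_def by blast
qed

text \<open>
  The elements of \<open>V\<close> are the bijections that replace prefixes at some uniform depth. This form
  makes products, glueing and extension by continuity easy, since the partition into words of length
  \<open>n\<close> can be refined at will and the range partition is recovered from bijectivity.
\<close>

lemma carrier_thompson_V_iff:
  "\<psi> \<in> carrier thompson_V \<longleftrightarrow> bij \<psi> \<and> (\<exists>n. replaces_prefixes n \<psi>)"
proof
  assume "\<psi> \<in> carrier thompson_V"
  then obtain A B f where A: "prefix_partition A" and B: "prefix_partition B"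
    and f: "bij_betw f A B" and \<psi>: "\<And>\<alpha> \<eta>. \<alpha> \<in> A \<Longrightarrow> \<psi> (\<alpha> @- \<eta>) = f \<alpha> @- \<eta>"
    unfolding thompson_V_def induces_map_def by auto
  have "inj \<psi>"
  proof (rule injI)
    fix \<xi> \<xi>' assume eq: "\<psi> \<xi> = \<psi> \<xi>'"
    obtain \<alpha> \<eta> where a: "\<alpha> \<in> A" "\<xi> = \<alpha> @- \<eta>" by (rule prefix_partition_coverE[OF A])
    obtain \<alpha>' \<eta>' where a': "\<alpha>' \<in> A" "\<xi>' = \<alpha>' @- \<eta>'" by (rule prefix_partition_coverE[OF A])
    have "f \<alpha> @- \<eta> = f \<alpha>' @- \<eta>'" "f \<alpha> \<in> B" "f \<alpha>' \<in> B"
      using eq a a' \<psi> f by (auto simp: bij_betw_def)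
    then have "f \<alpha> = f \<alpha>' \<and> \<eta> = \<eta>'"
      using prefix_partition_uniqueD[OF B] by blast
    then show "\<xi> = \<xi>'"
      using a a' f by (auto simp: bij_betw_def inj_on_def)
  qed
  moreover have "surj \<psi>"
    unfolding surj_def
  proof
    fix \<xi>
    obtain \<beta> \<eta> where b: "\<beta> \<in> B" "\<xi> = \<beta> @- \<eta>" by (rule prefix_partition_coverE[OF B])
    then obtain \<alpha> where "\<alpha> \<in> A" "\<beta> = f \<alpha>" using f by (auto simp: bij_betw_def)
    then show "\<exists>x. \<xi> = \<psi> x" using b \<psi> by metis
  qed
  moreover have "replaces_prefixes (Max (length ` A)) \<psi>"
    unfolding replaces_prefixes_def
  proof (intro allI impI)
    fix \<alpha> :: "bool list" assume len: "length \<alpha> = Max (length ` A)"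
    obtain a \<eta> where a: "a \<in> A" "\<alpha> @- sconst True = a @- \<eta>" by (rule prefix_partition_coverE[OF A])
    have "finite A" using A unfolding prefix_partition_def by blast
    then have "length a \<le> length \<alpha>" using a len by simp
    then obtain r where "\<alpha> = a @ r" using shift_eq_shiftD[OF a(2)[symmetric]] by blast
    then have "\<psi> (\<alpha> @- \<eta>) = (f a @ r) @- \<eta>" for \<eta>
      using \<psi>[OF a(1)] by simp
    then show "\<exists>\<beta>. \<forall>\<eta>. \<psi> (\<alpha> @- \<eta>) = \<beta> @- \<eta>" by blast
  qed
  ultimately show "bij \<psi> \<and> (\<exists>n. replaces_prefixes n \<psi>)" by (auto simp: bij_def)
next
  assume "bij \<psi> \<and> (\<exists>n. replaces_prefixes n \<psi>)"
  then obtain n where bij: "bij \<psi>" and n: "replaces_prefixes n \<psi>" by blast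
  define A where "A = {\<alpha> :: bool list. length \<alpha> = n}"
  from n obtain f where f: "\<And>\<alpha> \<eta>. \<alpha> \<in> A \<Longrightarrow> \<psi> (\<alpha> @- \<eta>) = f \<alpha> @- \<eta>"
    unfolding replaces_prefixes_def A_def mem_Collect_eq by metis
  have A: "prefix_partition A"
  proof (rule prefix_partitionI)
    show "finite A" unfolding A_def by (rule finite_bool_words)
  next
    fix \<alpha> \<beta> :: "bool list" and \<eta> \<theta> assume "\<alpha> \<in> A" "\<beta> \<in> A" "\<alpha> @- \<eta> = \<beta> @- \<theta>"
    then show "\<alpha> = \<beta>" using shift_eq_shiftD[of \<alpha> \<eta> \<beta> \<theta>] by (auto simp: A_def)
  next
    fix \<xi> :: "bool stream"
    have "stake n \<xi> \<in> A" "\<xi> = stake n \<xi> @- sdrop n \<xi>" by (simp_all add: A_def stake_sdrop)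
    then show "\<exists>\<alpha>\<in>A. \<exists>\<eta>. \<xi> = \<alpha> @- \<eta>" by blast
  qed
  have sep: "\<alpha> = \<beta>" if "\<alpha> \<in> A" "\<beta> \<in> A" "f \<alpha> @- \<eta> = f \<beta> @- \<theta>" for \<alpha> \<beta> \<eta> \<theta>
  proof -
    have "\<psi> (\<alpha> @- \<eta>) = \<psi> (\<beta> @- \<theta>)" using that f by simp
    then have "\<alpha> @- \<eta> = \<beta> @- \<theta>" using bij by (simp add: bij_def inj_eq)
    then show ?thesis using prefix_partition_uniqueD[OF A that(1,2)] by blast
  qed
  have "prefix_partition (f ` A)"
  proof (rule prefix_partitionI)
    show "finite (f ` A)" unfolding A_def using finite_bool_words by blast
  next
    fix a b :: "bool list" and \<eta> \<theta> assume "a \<in> f ` A" "b \<in> f ` A" "a @- \<eta> = b @- \<theta>"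
    then show "a = b" using sep by blast
  next
    fix \<xi> :: "bool stream"
    obtain \<zeta> where "\<xi> = \<psi> \<zeta>" using bij by (metis bij_pointE)
    moreover obtain \<alpha> \<eta> where "\<alpha> \<in> A" "\<zeta> = \<alpha> @- \<eta>" by (rule prefix_partition_coverE[OF A])
    ultimately show "\<exists>\<alpha>\<in>f ` A. \<exists>\<eta>. \<xi> = \<alpha> @- \<eta>" using f by auto
  qed
  moreover have "bij_betw f A (f ` A)"
    unfolding bij_betw_def inj_on_def using sep by metis
  ultimately show "\<psi> \<in> carrier thompson_V"
    using A f unfolding thompson_V_def induces_map_def partial_object.simps mem_Collect_eq by blast
qed

lemma thompson_V_simps [simp]:
  "\<phi> \<otimes>\<^bsub>thompson_V\<^esub> \<psi> = \<psi> \<circ> \<phi>" "\<one>\<^bsub>thompson_V\<^esub> = id"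
  by (simp_all add: thompson_V_def)

lemma id_in_thompson_V: "id \<in> carrier thompson_V"
  unfolding carrier_thompson_V_iff replaces_prefixes_def by auto

lemma hom_thompson_V_one:
  assumes "group G" "\<phi> \<in> hom G thompson_V"
  shows "\<phi> \<one>\<^bsub>G\<^esub> = id"
proof -
  interpret group G by fact
  have "\<phi> \<one>\<^bsub>G\<^esub> \<circ> \<phi> \<one>\<^bsub>G\<^esub> = \<phi> \<one>\<^bsub>G\<^esub>"
    using hom_mult[OF assms(2) one_closed one_closed] by simp
  moreover have "inj (\<phi> \<one>\<^bsub>G\<^esub>)"
    using hom_in_carrier[OF assms(2) one_closed] by (simp add: carrier_thompson_V_iff bij_def)
  ultimately show ?thesis
    by (metis comp_apply eq_id_iff inj_eq)
qed

text \<open>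
  A copy of \<open>V \<times> V\<close> inside \<open>V\<close>: the two factors act on the two halves of the Cantor set.
\<close>

definition glue :: "(bool stream \<Rightarrow> bool stream) \<Rightarrow> (bool stream \<Rightarrow> bool stream) \<Rightarrow> bool stream \<Rightarrow> bool stream" where
  "glue \<phi> \<psi> \<xi> = (if shd \<xi> then True ## \<psi> (stl \<xi>) else False ## \<phi> (stl \<xi>))"

lemma glue_comp: "glue \<phi>' \<psi>' \<circ> glue \<phi> \<psi> = glue (\<phi>' \<circ> \<phi>) (\<psi>' \<circ> \<psi>)"
  by (auto simp: glue_def fun_eq_iff)

lemma glue_eq_idD:
  assumes "glue \<phi> \<psi> = id"
  shows "\<phi> = id" "\<psi> = id"
proof -
  have "glue \<phi> \<psi> (False ## \<xi>) = False ## \<xi>" "glue \<phi> \<psi> (True ## \<xi>) = True ## \<xi>" for \<xi>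
    by (simp_all add: assms)
  then show "\<phi> = id" "\<psi> = id" by (auto simp: glue_def fun_eq_iff)
qed

lemma glue_in_thompson_V:
  assumes "\<phi> \<in> carrier thompson_V" "\<psi> \<in> carrier thompson_V"
  shows "glue \<phi> \<psi> \<in> carrier thompson_V"
proof -
  from assms obtain n m where bij: "bij \<phi>" "bij \<psi>" and nm: "replaces_prefixes n \<phi>" "replaces_prefixes m \<psi>"
    unfolding carrier_thompson_V_iff by blast
  have id: "glue id id = id"
  proof
    show "glue id id \<xi> = id \<xi>" for \<xi> by (cases \<xi>) (simp add: glue_def)
  qed
  have "glue \<phi> \<psi> \<circ> glue (inv_into UNIV \<phi>) (inv_into UNIV \<psi>) = id" "glue (inv_into UNIV \<phi>) (inv_into UNIV \<psi>) \<circ> glue \<phi> \<psi> = id"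
    using bij by (simp_all add: glue_comp bij_def surj_iff[THEN iffD1] inj_iff[THEN iffD1] id)
  then have "bij (glue \<phi> \<psi>)" by (metis o_bij)
  moreover have "replaces_prefixes (Suc (max n m)) (glue \<phi> \<psi>)"
    unfolding replaces_prefixes_def
  proof (intro allI impI)
    fix \<alpha> :: "bool list" assume "length \<alpha> = Suc (max n m)"
    then obtain x \<alpha>' where \<alpha>: "\<alpha> = x # \<alpha>'" "length \<alpha>' = max n m" by (cases \<alpha>) auto
    then obtain \<beta> \<gamma> where "\<And>\<eta>. \<phi> (\<alpha>' @- \<eta>) = \<beta> @- \<eta>" "\<And>\<eta>. \<psi> (\<alpha>' @- \<eta>) = \<gamma> @- \<eta>"
      using replaces_prefixesE[OF nm(1), of \<alpha>'] replaces_prefixesE[OF nm(2), of \<alpha>']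
      by (metis max.cobounded1 max.cobounded2)
    then have "glue \<phi> \<psi> (\<alpha> @- \<eta>) = (if x then True # \<gamma> else False # \<beta>) @- \<eta>" for \<eta>
      by (simp add: glue_def \<alpha>)
    then show "\<exists>\<beta>. \<forall>\<eta>. glue \<phi> \<psi> (\<alpha> @- \<eta>) = \<beta> @- \<eta>" by blast
  qed
  ultimately show ?thesis unfolding carrier_thompson_V_iff by blast
qed

section \<open>Stabilisers of eventually constant streams\<close>

text \<open>
  Words act from the left to the right, in accordance with right actions.
\<close>

abbreviation run :: "('s \<Rightarrow> 'x \<Rightarrow> 'x) \<Rightarrow> 'x \<Rightarrow> 's list \<Rightarrow> 'x" where
  "run f \<equiv> foldl (\<lambda>x s. f s x)"

text \<open>
  A pushdown system: every letter rewrites the top \<open>m\<close> letters of the stack, and \<open>n\<close> bounds both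
  the words read and the words written. Below the top, the stack is a word or, in the
  end, a constant stream.
\<close>

locale prefix_rewriting =
  fixes \<Sigma> :: "'s set" and f :: "'s \<Rightarrow> bool stream \<Rightarrow> bool stream"
    and m n :: nat and rep :: "'s \<Rightarrow> bool list \<Rightarrow> bool list"
  assumes f_rep: "\<And>s \<alpha> \<eta>. s \<in> \<Sigma> \<Longrightarrow> length \<alpha> = m \<Longrightarrow> f s (\<alpha> @- \<eta>) = rep s \<alpha> @- \<eta>"
    and rep_le: "\<And>s \<alpha>. s \<in> \<Sigma> \<Longrightarrow> length \<alpha> = m \<Longrightarrow> length (rep s \<alpha>) \<le> n"
    and m_le: "m \<le> n"
begin

fun path :: "bool list \<Rightarrow> 's list \<Rightarrow> bool list \<Rightarrow> bool" where
  "path \<alpha> [] \<beta> \<longleftrightarrow> \<alpha> = \<beta>"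
| "path \<alpha> (s # w) \<beta> \<longleftrightarrow> m \<le> length \<alpha> \<and> path (rep s (take m \<alpha>) @ drop m \<alpha>) w \<beta>"

lemma path_append: "path \<alpha> (u @ v) \<beta> \<longleftrightarrow> (\<exists>\<gamma>. path \<alpha> u \<gamma> \<and> path \<gamma> v \<beta>)"
  by (induction u arbitrary: \<alpha>) auto

lemma path_lift: "path \<alpha> w \<beta> \<Longrightarrow> path (\<alpha> @ t) w (\<beta> @ t)"
  by (induction w arbitrary: \<alpha>) (auto simp flip: append_assoc)

lemma path_exists: "m * length w \<le> length \<alpha> \<Longrightarrow> \<exists>\<beta>. path \<alpha> w \<beta>"
proof (induction w arbitrary: \<alpha>)
  case (Cons s w)
  then show ?case using Cons.IH[of "rep s (take m \<alpha>) @ drop m \<alpha>"] by simp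
qed auto

lemma path_run:
  assumes "set w \<subseteq> \<Sigma>" "path \<alpha> w \<beta>"
  shows "run f (\<alpha> @- \<eta>) w = \<beta> @- \<eta>"
  using assms
proof (induction w arbitrary: \<alpha>)
  case Nil
  then show ?case by simp
next
  case (Cons s w)
  have "f s (\<alpha> @- \<eta>) = f s (take m \<alpha> @- (drop m \<alpha> @- \<eta>))"
    by (simp add: shift_append[symmetric])
  also have "\<dots> = (rep s (take m \<alpha>) @ drop m \<alpha>) @- \<eta>"
    using Cons.prems by (subst f_rep) auto
  finally show ?case
    using Cons.IH[of "rep s (take m \<alpha>) @ drop m \<alpha>"] Cons.prems by simp
qed

text \<open>
  If the stack stays higher than \<open>m\<close> until the last step, its bottom letter is never read.
\<close>

lemma path_drop_last:
  assumes "path (\<alpha> @ [x]) w \<beta>"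
    and "\<And>u v \<gamma>. w = u @ v \<Longrightarrow> v \<noteq> [] \<Longrightarrow> path (\<alpha> @ [x]) u \<gamma> \<Longrightarrow> m < length \<gamma>"
  shows "\<exists>\<beta>'. \<beta> = \<beta>' @ [x] \<and> path \<alpha> w \<beta>'"
  using assms
proof (induction w arbitrary: \<alpha>)
  case Nil
  then show ?case by simp
next
  case (Cons s w)
  have "m < length (\<alpha> @ [x])" by (rule Cons.prems(2)[of "[]" "s # w"]) auto
  then have len: "m \<le> length \<alpha>" by simp
  let ?\<alpha> = "rep s (take m \<alpha>) @ drop m \<alpha>"
  have "\<exists>\<beta>'. \<beta> = \<beta>' @ [x] \<and> path ?\<alpha> w \<beta>'"
  proof (rule Cons.IH)
    show "path (?\<alpha> @ [x]) w \<beta>" using Cons.prems(1) len by simp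
  next
    fix u v \<gamma> assume "w = u @ v" "v \<noteq> []" "path (?\<alpha> @ [x]) u \<gamma>"
    then show "m < length \<gamma>"
      using Cons.prems(2)[of "s # u" v \<gamma>] len by simp
  qed
  then show ?case using len by auto
qed

text \<open>
  A path all of whose intermediate stacks are higher than \<open>n\<close> never touches the bottom letter: what
  remains of the first stack is nonempty, because the word written by the first step has length at
  most \<open>n\<close>.
\<close>

lemma path_drop_common_last:
  assumes "path \<alpha> w \<beta>" "2 \<le> length w" "set w \<subseteq> \<Sigma>"
    and high: "\<forall>u v \<gamma>. w = u @ v \<longrightarrow> u \<noteq> [] \<longrightarrow> v \<noteq> [] \<longrightarrow> path \<alpha> u \<gamma> \<longrightarrow> n < length \<gamma>"
  obtains \<alpha>' \<beta>' x where "\<alpha> = \<alpha>' @ [x]" "\<beta> = \<beta>' @ [x]" "path \<alpha>' w \<beta>'"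
proof -
  obtain s w' where w: "w = s # w'" "w' \<noteq> []" using assms(2) by (cases w; cases "tl w") auto
  then have m: "m \<le> length \<alpha>" using assms(1) by simp
  then have "n < length (rep s (take m \<alpha>) @ drop m \<alpha>)"
    using high[rule_format, of "[s]" w'] w by simp
  moreover have "length (rep s (take m \<alpha>)) \<le> n"
    using rep_le m w assms(3) by simp
  ultimately have "m < length \<alpha>" by auto
  then obtain \<alpha>' x where \<alpha>: "\<alpha> = \<alpha>' @ [x]" by (cases \<alpha> rule: rev_cases) auto
  have "\<exists>\<beta>'. \<beta> = \<beta>' @ [x] \<and> path \<alpha>' w \<beta>'"
  proof (rule path_drop_last)
    show "path (\<alpha>' @ [x]) w \<beta>" using assms(1) \<alpha> by simp
  next
    fix u v \<gamma> assume *: "w = u @ v" "v \<noteq> []" "path (\<alpha>' @ [x]) u \<gamma>"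
    show "m < length \<gamma>"
    proof (cases "u = []")
      case True
      then show ?thesis using * \<open>m < length \<alpha>\<close> \<alpha> by simp
    next
      case False
      then show ?thesis using * high[rule_format, of u v \<gamma>] \<alpha> m_le by simp
    qed
  qed
  then show thesis using that \<alpha> by blast
qed

definition path_language :: "bool list \<Rightarrow> bool list \<Rightarrow> 's list set" where
  "path_language \<alpha> \<beta> = {w \<in> lists \<Sigma>. path \<alpha> w \<beta>}"

definition path_family :: "'s list set set" where
  "path_family = case_prod path_language ` ({\<alpha>. length \<alpha> \<le> n} \<times> {\<alpha>. length \<alpha> \<le> n})"

lemma path_familyI: "length \<alpha> \<le> n \<Longrightarrow> length \<beta> \<le> n \<Longrightarrow> path_language \<alpha> \<beta> \<in> path_family"
  unfolding path_family_def by auto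

text \<open>
  Either some intermediate stack is low, and the path is cut there, or the common bottom letter is
  removed and the induction continues with shorter stacks.
\<close>

lemma path_language_splits:
  assumes "w \<in> path_language \<alpha> \<beta>" "2 \<le> length w" "length \<alpha> \<le> n" "length \<beta> \<le> n"
  shows "splits_in path_family (path_language \<alpha> \<beta>) w"
  using assms
proof (induction "length \<alpha>" arbitrary: \<alpha> \<beta> rule: less_induct)
  case less
  have w: "path \<alpha> w \<beta>" "set w \<subseteq> \<Sigma>" using less.prems(1) unfolding path_language_def by auto
  show ?case
  proof (cases "\<exists>u v \<gamma>. w = u @ v \<and> u \<noteq> [] \<and> v \<noteq> [] \<and> path \<alpha> u \<gamma> \<and> length \<gamma> \<le> n")
    case True
    then obtain u v \<gamma> where uv: "w = u @ v" "u \<noteq> []" "v \<noteq> []" "path \<alpha> u \<gamma>" "length \<gamma> \<le> n"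
      by blast
    have fn: "path \<alpha> x \<gamma> \<Longrightarrow> path \<alpha> x \<gamma>' \<Longrightarrow> \<gamma> = \<gamma>'" for x \<alpha> \<gamma> \<gamma>'
      by (induction x arbitrary: \<alpha>) auto
    from w(1) uv(1) obtain \<gamma>' where "path \<alpha> u \<gamma>'" "path \<gamma>' v \<beta>" by (auto simp: path_append)
    with fn[OF uv(4)] have "path \<gamma> v \<beta>" by blast
    with uv w(2) have "u \<in> path_language \<alpha> \<gamma>" "v \<in> path_language \<gamma> \<beta>"
      unfolding path_language_def by auto
    then show ?thesis
      unfolding uv(1)
      using uv(2,3) path_familyI[OF less.prems(3) uv(5)] path_familyI[OF uv(5) less.prems(4)]
      by (intro splits_inI[of "path_language \<alpha> \<gamma>" _ "path_language \<gamma> \<beta>"])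
        (auto simp: path_language_def path_append)
  next
    case False
    then obtain \<alpha>' \<beta>' x where *: "\<alpha> = \<alpha>' @ [x]" "\<beta> = \<beta>' @ [x]" "path \<alpha>' w \<beta>'"
      using path_drop_common_last[of \<alpha> w \<beta>] less.prems(2) w by (metis not_le)
    have "path_language \<alpha>' \<beta>' \<subseteq> path_language \<alpha> \<beta>"
      unfolding path_language_def *(1,2) using path_lift by blast
    moreover have "splits_in path_family (path_language \<alpha>' \<beta>') w"
      using less.hyps[of \<alpha>' \<beta>'] * less.prems unfolding path_language_def by simp
    ultimately show ?thesis by (auto elim: splits_in_mono)
  qed
qed

definition point_language :: "bool \<Rightarrow> bool list \<Rightarrow> bool list \<Rightarrow> 's list set" where
  "point_language c \<alpha> \<beta> = {w \<in> lists \<Sigma>. run f (\<alpha> @- sconst c) w = \<beta> @- sconst c}"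

lemma shift_snoc_sconst: "(\<alpha> @ [c]) @- sconst c = \<alpha> @- sconst c"
  using shift_replicate_sconst[of 1 c] by simp

text \<open>
  A letter in excess of a shorter representative of the same stream belongs to the constant tail.
\<close>

lemma last_of_long_representative:
  assumes "(\<gamma> @ [x]) @- sconst c = \<beta> @- sconst c" "length \<beta> < length (\<gamma> @ [x])"
  shows "x = c"
proof -
  obtain r where r: "\<gamma> @ [x] = \<beta> @ r" "sconst c = r @- sconst c"
    using shift_eq_shiftD[OF assms(1)[symmetric]] assms(2) by auto
  then have "r \<noteq> []" using assms(2) by auto
  then have "x \<in> set r" using r(1) by (metis last_appendR last_in_set last_snoc)
  moreover have "set r \<subseteq> {c}" using arg_cong[OF r(2), of sset] by auto
  ultimately show ?thesis by auto
qed

text \<open>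
  Stacks padded with tail letters are cut back: as long as one end is too long, the removed common
  bottom letter is \<open>c\<close>, so the streams at the ends do not change.
\<close>

lemma path_between_short_representatives:
  assumes "path \<alpha> w \<beta>" "2 \<le> length w" "set w \<subseteq> \<Sigma>"
    and "\<alpha> @- sconst c = \<alpha>0 @- sconst c" "length \<alpha>0 \<le> n"
    and "\<beta> @- sconst c = \<beta>0 @- sconst c" "length \<beta>0 \<le> n"
    and high: "\<And>u v \<gamma>. w = u @ v \<Longrightarrow> u \<noteq> [] \<Longrightarrow> v \<noteq> [] \<Longrightarrow>
        run f (\<alpha>0 @- sconst c) u = \<gamma> @- sconst c \<Longrightarrow> n < length \<gamma>"
  shows "\<exists>\<alpha>' \<beta>'. path \<alpha>' w \<beta>' \<and> length \<alpha>' \<le> n \<and> length \<beta>' \<le> n \<and>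
      \<alpha>' @- sconst c = \<alpha>0 @- sconst c \<and> \<beta>' @- sconst c = \<beta>0 @- sconst c"
  using assms(1,4,6)
proof (induction "length \<alpha>" arbitrary: \<alpha> \<beta> rule: less_induct)
  case less
  show ?case
  proof (cases "length \<alpha> \<le> n \<and> length \<beta> \<le> n")
    case True
    with less.prems show ?thesis by blast
  next
    case False
    have h: "\<forall>u v \<gamma>. w = u @ v \<longrightarrow> u \<noteq> [] \<longrightarrow> v \<noteq> [] \<longrightarrow> path \<alpha> u \<gamma> \<longrightarrow> n < length \<gamma>"
    proof (intro allI impI)
      fix u v \<gamma> assume that: "w = u @ v" "u \<noteq> []" "v \<noteq> []" "path \<alpha> u \<gamma>"
      show "n < length \<gamma>"
        using high[OF that(1-3), of \<gamma>] path_run[OF _ that(4), of "sconst c"] that(1) assms(3)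
          less.prems(2) by simp
    qed
    obtain \<alpha>' \<beta>' x where *: "\<alpha> = \<alpha>' @ [x]" "\<beta> = \<beta>' @ [x]" "path \<alpha>' w \<beta>'"
      using path_drop_common_last[OF less.prems(1) assms(2,3) h] by blast
    have "x = c"
    proof (cases "length \<alpha> \<le> n")
      case True
      with False have "length \<beta>0 < length (\<beta>' @ [x])" using * assms(7) by simp
      then show ?thesis
        using last_of_long_representative[of \<beta>' x c \<beta>0] less.prems(3) * by simp
    next
      case False
      then have "length \<alpha>0 < length (\<alpha>' @ [x])" using * assms(5) by simp
      then show ?thesis
        using last_of_long_representative[of \<alpha>' x c \<alpha>0] less.prems(2) * by simp
    qed
    then have "\<alpha>' @- sconst c = \<alpha>0 @- sconst c" "\<beta>' @- sconst c = \<beta>0 @- sconst c"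
      using less.prems(2,3) * by (simp_all only: shift_snoc_sconst)
    then show ?thesis using less.hyps[of \<alpha>' \<beta>'] * by simp
  qed
qed

definition point_family :: "bool \<Rightarrow> 's list set set" where
  "point_family c = case_prod (point_language c) ` ({\<alpha>. length \<alpha> \<le> n} \<times> {\<alpha>. length \<alpha> \<le> n})"

lemma point_familyI: "length \<alpha> \<le> n \<Longrightarrow> length \<beta> \<le> n \<Longrightarrow> point_language c \<alpha> \<beta> \<in> point_family c"
  unfolding point_family_def by auto

text \<open>
  As for words, except that without a low intermediate stream the tail is never used, and the
  path is one between stacks of bounded length.
\<close>

lemma point_language_splits:
  assumes "w \<in> point_language c \<alpha> \<beta>" "2 \<le> length w" "length \<alpha> \<le> n" "length \<beta> \<le> n"
  shows "splits_in (path_family \<union> point_family c) (point_language c \<alpha> \<beta>) w"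
proof -
  have w: "set w \<subseteq> \<Sigma>" "run f (\<alpha> @- sconst c) w = \<beta> @- sconst c"
    using assms(1) unfolding point_language_def by auto
  show ?thesis
  proof (cases "\<exists>u v \<gamma>. w = u @ v \<and> u \<noteq> [] \<and> v \<noteq> [] \<and> run f (\<alpha> @- sconst c) u = \<gamma> @- sconst c \<and>
      length \<gamma> \<le> n")
    case True
    then obtain u v \<gamma> where uv: "w = u @ v" "u \<noteq> []" "v \<noteq> []"
      "run f (\<alpha> @- sconst c) u = \<gamma> @- sconst c" "length \<gamma> \<le> n" by blast
    then have "u \<in> point_language c \<alpha> \<gamma>" "v \<in> point_language c \<gamma> \<beta>"
      using w unfolding point_language_def by auto
    moreover have "point_language c \<alpha> \<gamma> \<in> path_family \<union> point_family c"
      "point_language c \<gamma> \<beta> \<in> path_family \<union> point_family c"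
      using point_familyI uv(5) assms(3,4) by auto
    ultimately show ?thesis
      unfolding uv(1) using uv(2,3)
      by (intro splits_inI[of "point_language c \<alpha> \<gamma>" _ "point_language c \<gamma> \<beta>"])
        (auto simp: point_language_def)
  next
    case False
    \<comment> \<open>Enough tail letters are made explicit for the whole word to be read from a finite stack.\<close>
    let ?\<alpha> = "\<alpha> @ replicate (m * length w) c"
    obtain \<beta>' where \<beta>': "path ?\<alpha> w \<beta>'" using path_exists[of w ?\<alpha>] by auto
    have *: "?\<alpha> @- sconst c = \<alpha> @- sconst c"
      by (simp only: shift_append shift_replicate_sconst)
    then have "\<beta>' @- sconst c = \<beta> @- sconst c"
      using path_run[OF w(1) \<beta>', of "sconst c"] w(2) by simp
    then obtain \<alpha>1 \<beta>1 where 1: "path \<alpha>1 w \<beta>1" "length \<alpha>1 \<le> n" "length \<beta>1 \<le> n"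
        "\<alpha>1 @- sconst c = \<alpha> @- sconst c" "\<beta>1 @- sconst c = \<beta> @- sconst c"
      using path_between_short_representatives[OF \<beta>' assms(2) w(1) * assms(3) _ assms(4)] False
      by (metis not_le)
    have "path_language \<alpha>1 \<beta>1 \<subseteq> point_language c \<alpha> \<beta>"
      unfolding path_language_def point_language_def using path_run[of _ \<alpha>1 \<beta>1 "sconst c"] 1(4,5)
      by auto
    moreover have "splits_in path_family (path_language \<alpha>1 \<beta>1) w"
      using path_language_splits[OF _ assms(2) 1(2,3)] 1(1) w(1) by (auto simp: path_language_def)
    ultimately show ?thesis by (auto elim: splits_in_mono)
  qed
qed

lemma context_free_point_language:
  assumes "finite \<Sigma>" "length \<alpha> \<le> n" "length \<beta> \<le> n"
  shows "context_free_language (point_language c \<alpha> \<beta>)"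
proof -
  let ?F = "path_family \<union> point_family c"
  have "splits_in ?F M w" if M: "M \<in> ?F" and w: "w \<in> M" "2 \<le> length w" for M w
  proof -
    from M consider \<alpha> \<beta> where "length \<alpha> \<le> n" "length \<beta> \<le> n" "M = path_language \<alpha> \<beta>"
      | \<alpha> \<beta> where "length \<alpha> \<le> n" "length \<beta> \<le> n" "M = point_language c \<alpha> \<beta>"
      unfolding path_family_def point_family_def by auto
    then show ?thesis
    proof cases
      case 1
      then have "splits_in path_family M w" using path_language_splits w by simp
      then show ?thesis by (rule splits_in_mono) auto
    next
      case 2
      then show ?thesis using point_language_splits[of w] w by simp
    qed
  qed
  moreover have "finite ?F"
    unfolding path_family_def point_family_def by (simp add: finite_bool_words)
  ultimately have "splitting_family ?F" unfolding splitting_family_def by blast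
  moreover have "M \<subseteq> lists \<Sigma>" if "M \<in> ?F" for M
    using that by (auto simp: path_family_def point_family_def path_language_def point_language_def)
  moreover have "point_language c \<alpha> \<beta> \<in> ?F" using point_familyI assms by simp
  ultimately show ?thesis
    using splitting_family_context_free_language[OF _ _ assms(1)] by metis
qed

end

lemma context_free_eventually_constant_stabiliser:
  assumes "finite \<Sigma>" "\<And>s. s \<in> \<Sigma> \<Longrightarrow> \<exists>m. replaces_prefixes m (f s)"
  shows "context_free_language {w \<in> lists \<Sigma>. run f (\<alpha> @- sconst c) w = \<alpha> @- sconst c}"
proof -
  from assms(2) obtain d where d: "\<And>s. s \<in> \<Sigma> \<Longrightarrow> replaces_prefixes (d s) (f s)" by metis
  define m where "m = Max (insert 0 (d ` \<Sigma>))"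
  have "replaces_prefixes m (f s)" if "s \<in> \<Sigma>" for s
    using replaces_prefixes_mono[OF d[OF that]] that assms(1) by (simp add: m_def)
  then obtain rep where rep: "\<And>s \<alpha> \<eta>. s \<in> \<Sigma> \<Longrightarrow> length \<alpha> = m \<Longrightarrow> f s (\<alpha> @- \<eta>) = rep s \<alpha> @- \<eta>"
    unfolding replaces_prefixes_def by metis
  define R where "R = (\<lambda>(s, \<alpha>). length (rep s \<alpha>)) ` (\<Sigma> \<times> {\<alpha>. length \<alpha> = m})"
  define n where "n = Max (insert m (insert (length \<alpha>) R))"
  have "finite R" unfolding R_def using assms(1) by (simp add: finite_bool_words)
  then have "k \<le> n" if "k \<in> insert m (insert (length \<alpha>) R)" for k
    unfolding n_def using that by (intro Max_ge) simp_all
  then have le: "m \<le> n" "length \<alpha> \<le> n" "\<And>k. k \<in> R \<Longrightarrow> k \<le> n" by simp_all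
  interpret prefix_rewriting \<Sigma> f m n rep
  proof
    fix s \<alpha> assume "s \<in> \<Sigma>" "length (\<alpha> :: bool list) = m"
    then show "length (rep s \<alpha>) \<le> n" by (intro le(3)) (auto simp: R_def)
  qed (use rep le in auto)
  show ?thesis
    using context_free_point_language[OF assms(1) le(2,2), of c] unfolding point_language_def .
qed

lemma mem_subgroup_core_iff:
  fixes G (structure)
  assumes "group G" "subgroup H G"
  shows "x \<in> subgroup_core G H \<longleftrightarrow> x \<in> carrier G \<and> (\<forall>g\<in>carrier G. g \<otimes>\<^bsub>G\<^esub> x \<otimes>\<^bsub>G\<^esub> inv\<^bsub>G\<^esub> g \<in> H)"
proof -
  interpret group G by fact
  have H: "H \<subseteq> carrier G" using assms(2) by (rule subgroup.subset)
  have *: "x \<in> (inv g <#\<^bsub>G\<^esub> H) #> g \<longleftrightarrow> x \<in> carrier G \<and> g \<otimes> x \<otimes> inv g \<in> H" if g: "g \<in> carrier G" for g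
  proof
    assume "x \<in> (inv g <#\<^bsub>G\<^esub> H) #> g"
    then obtain h where h: "h \<in> H" "x = inv g \<otimes> h \<otimes> g"
      unfolding l_coset_def r_coset_def by blast
    moreover have "h \<in> carrier G" using h H by blast
    ultimately show "x \<in> carrier G \<and> g \<otimes> x \<otimes> inv g \<in> H"
      using g by (simp add: m_assoc[symmetric]) (simp add: m_assoc)
  next
    assume x: "x \<in> carrier G \<and> g \<otimes> x \<otimes> inv g \<in> H"
    then have "x = inv g \<otimes> (g \<otimes> x \<otimes> inv g) \<otimes> g"
      using g by (simp add: m_assoc[symmetric]) (simp add: m_assoc)
    with x show "x \<in> (inv g <#\<^bsub>G\<^esub> H) #> g"
      unfolding l_coset_def r_coset_def by blast
  qed
  show ?thesis
    unfolding subgroup_core_def using * one_closed by blast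
qed

text \<open>
  The letters number the elements of a finite generating set closed under inverses.
\<close>

lemma symmetric_surjection_exists:
  fixes G (structure)
  assumes "finitely_generated_group G"
  obtains \<Sigma> :: "nat set" and bar \<rho>
  where "symmetric_alphabet \<Sigma> bar" "symmetric_surjection G \<Sigma> bar \<rho>"
proof -
  from assms obtain S where "group G" and S: "finite S" "S \<subseteq> carrier G" "generate G S = carrier G"
    unfolding finitely_generated_group_def by blast
  interpret group G by fact
  define T where "T = S \<union> (\<lambda>x. inv x) ` S"
  have T: "finite T" "T \<subseteq> carrier G" "\<And>x. x \<in> T \<Longrightarrow> inv x \<in> T"
    using S unfolding T_def by auto
  obtain e where e: "bij_betw e {0..<card T} T"
    using ex_bij_betw_nat_finite[OF T(1)] by blast
  define \<Sigma> where "\<Sigma> = {0..<card T}"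
  define bar where "bar i = inv_into \<Sigma> e (inv (e i))" for i
  define \<rho> where "\<rho> w = foldr (\<lambda>i g. e i \<otimes> g) w \<one>" for w
  have eT: "e i \<in> T" if "i \<in> \<Sigma>" for i using e that by (auto simp: \<Sigma>_def bij_betw_def)
  then have eG: "e i \<in> carrier G" if "i \<in> \<Sigma>" for i using T(2) that by blast
  have surj: "\<exists>i\<in>\<Sigma>. e i = x" if "x \<in> T" for x
  proof -
    have "x \<in> e ` \<Sigma>" using e that by (simp add: \<Sigma>_def bij_betw_def)
    then show ?thesis by blast
  qed
  have bar: "bar i \<in> \<Sigma> \<and> e (bar i) = inv (e i)" if "i \<in> \<Sigma>" for i
    using surj[OF T(3)[OF eT[OF that]]] unfolding bar_def
    by (metis (no_types, lifting) f_inv_into_f imageI inv_into_into)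
  have inj: "inj_on e \<Sigma>" using e by (simp add: \<Sigma>_def bij_betw_def)
  have "bar (bar i) = i" if "i \<in> \<Sigma>" for i
    using bar[OF that] bar[of "bar i"] that eG inj by (metis inj_onD inv_inv)
  then have "symmetric_alphabet \<Sigma> bar"
    using bar by (auto simp: symmetric_alphabet_def \<Sigma>_def)
  moreover have closed: "\<rho> w \<in> carrier G" if "w \<in> lists \<Sigma>" for w
    using that unfolding \<rho>_def by induction (auto simp: eG)
  have app: "\<rho> (u @ v) = \<rho> u \<otimes> \<rho> v" if "u \<in> lists \<Sigma>" "v \<in> lists \<Sigma>" for u v
    using that(1)
  proof induction
    case Nil
    then show ?case using closed[OF that(2)] by (simp add: \<rho>_def)
  next
    case (Cons i u)
    then show ?case using closed[of u] closed[OF that(2)] eG[of i] by (simp add: \<rho>_def m_assoc)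
  qed
  have sing: "\<rho> [i] = e i" if "i \<in> \<Sigma>" for i using eG[OF that] by (simp add: \<rho>_def)
  have bar_lists: "bar_word bar w \<in> lists \<Sigma>" if "w \<in> lists \<Sigma>" for w
    using that bar by (auto simp: bar_word_def)
  have inv: "\<rho> (bar_word bar w) = inv (\<rho> w)" if "w \<in> lists \<Sigma>" for w
    using that
  proof induction
    case Nil
    then show ?case by (simp add: \<rho>_def bar_word_def)
  next
    case (Cons i u)
    have "\<rho> (bar_word bar (i # u)) = \<rho> (bar_word bar u @ [bar i])"
      by (simp add: bar_word_def)
    also have "\<dots> = inv (\<rho> u) \<otimes> inv (e i)"
      using Cons bar[of i] by (simp add: app bar_lists sing)
    also have "\<dots> = inv (\<rho> ([i] @ u))"
      using Cons closed[of u] eG[of i] by (subst app) (simp_all add: inv_mult_group sing)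
    finally show ?case by simp
  qed
  have "x \<in> \<rho> ` lists \<Sigma>" if "x \<in> generate G S" for x
    using that
  proof induction
    case one
    have "\<rho> [] = \<one>" by (simp add: \<rho>_def)
    then show ?case by (metis image_eqI lists.Nil)
  next
    case (incl h)
    then obtain i where "i \<in> \<Sigma>" "e i = h" using surj unfolding T_def by blast
    then show ?case using sing by (intro image_eqI[of _ _ "[i]"]) auto
  next
    case (inv h)
    then obtain i where "i \<in> \<Sigma>" "e i = inv h" using surj unfolding T_def by blast
    then show ?case using sing by (intro image_eqI[of _ _ "[i]"]) auto
  next
    case (eng h1 h2)
    then obtain u v where "u \<in> lists \<Sigma>" "v \<in> lists \<Sigma>" "h1 = \<rho> u" "h2 = \<rho> v" by blast
    then show ?case using app by (intro image_eqI[of _ _ "u @ v"]) auto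
  qed
  then have "\<rho> ` lists \<Sigma> = carrier G" using closed S(3) by blast
  then have "symmetric_surjection G \<Sigma> bar \<rho>"
    unfolding symmetric_surjection_def
    using closed app inv by (auto simp: hom_def free_monoid_def \<rho>_def)
  ultimately show thesis by (rule that)
qed

lemma symmetric_surjection_append:
  assumes "symmetric_surjection G \<Sigma> bar \<rho>" "u \<in> lists \<Sigma>" "v \<in> lists \<Sigma>"
  shows "\<rho> (u @ v) = \<rho> u \<otimes>\<^bsub>G\<^esub> \<rho> v"
  using assms unfolding symmetric_surjection_def hom_def free_monoid_def by auto

lemma symmetric_surjection_closed:
  assumes "symmetric_surjection G \<Sigma> bar \<rho>" "w \<in> lists \<Sigma>"
  shows "\<rho> w \<in> carrier G"
  using assms unfolding symmetric_surjection_def by auto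

lemma symmetric_surjectionE:
  assumes "symmetric_surjection G \<Sigma> bar \<rho>" "g \<in> carrier G"
  obtains w where "w \<in> lists \<Sigma>" "\<rho> w = g"
proof -
  have "g \<in> \<rho> ` lists \<Sigma>" using assms unfolding symmetric_surjection_def by simp
  then show thesis using that by blast
qed

locale thompson_action =
  group G for G :: "('a, 'b) monoid_scheme" (structure) +
  fixes \<phi> :: "'a \<Rightarrow> bool stream \<Rightarrow> bool stream" and \<Sigma> :: "nat set" and bar \<rho>
  assumes hom: "\<phi> \<in> hom G thompson_V"
    and symmetric: "symmetric_alphabet \<Sigma> bar" "symmetric_surjection G \<Sigma> bar \<rho>"
begin

lemma action_mult: "g \<in> carrier G \<Longrightarrow> h \<in> carrier G \<Longrightarrow> \<phi> (g \<otimes> h) \<xi> = \<phi> h (\<phi> g \<xi>)"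
  using hom_mult[OF hom] by simp

lemma action_one: "\<phi> \<one> \<xi> = \<xi>"
  using hom_thompson_V_one[OF is_group hom] by simp

lemma action_inv: "g \<in> carrier G \<Longrightarrow> \<phi> g \<xi> = \<zeta> \<Longrightarrow> \<phi> (inv g) \<zeta> = \<xi>"
  using action_mult[of g "inv g" \<xi>] action_one by auto

lemma action_replaces_prefixes: "g \<in> carrier G \<Longrightarrow> \<exists>m. replaces_prefixes m (\<phi> g)"
  using hom_in_carrier[OF hom] by (simp add: carrier_thompson_V_iff)

lemma run_action: "w \<in> lists \<Sigma> \<Longrightarrow> run (\<lambda>s. \<phi> (\<rho> [s])) \<xi> w = \<phi> (\<rho> w) \<xi>"
proof (induction w arbitrary: \<xi> rule: list.induct)
  case Nil
  then show ?case using symmetric(2) action_one by (simp add: symmetric_surjection_def)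
next
  case (Cons s w)
  then have "\<rho> (s # w) = \<rho> [s] \<otimes> \<rho> w"
    using symmetric_surjection_append[OF symmetric(2), of "[s]" w] by simp
  then show ?case
    using Cons symmetric_surjection_closed[OF symmetric(2)] by (simp add: action_mult)
qed

definition stabiliser :: "bool stream \<Rightarrow> 'a set" where
  "stabiliser \<xi> = {g \<in> carrier G. \<phi> g \<xi> = \<xi>}"

lemma subgroup_stabiliser: "subgroup (stabiliser \<xi>) G"
  by (rule subgroupI) (auto simp: stabiliser_def action_mult action_one intro: action_inv)

lemma context_free_subgroup_stabiliser:
  "context_free_subgroup G (stabiliser (\<alpha> @- sconst c))"
proof -
  let ?f = "\<lambda>s. \<phi> (\<rho> [s])" and ?p = "\<alpha> @- sconst c"
  have "membership_problem \<Sigma> \<rho> (stabiliser ?p) = {w \<in> lists \<Sigma>. run ?f ?p w = ?p}"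
    unfolding membership_problem_def
  proof (rule Collect_cong)
    fix w
    show "w \<in> lists \<Sigma> \<and> \<rho> w \<in> stabiliser ?p \<longleftrightarrow> w \<in> lists \<Sigma> \<and> run ?f ?p w = ?p"
      using run_action[of w ?p] symmetric_surjection_closed[OF symmetric(2), of w]
      by (cases "w \<in> lists \<Sigma>") (simp_all add: stabiliser_def del: in_lists_conv_set)
  qed
  moreover have "context_free_language {w \<in> lists \<Sigma>. run ?f ?p w = ?p}"
  proof (rule context_free_eventually_constant_stabiliser)
    show "finite \<Sigma>" using symmetric(1) by (simp add: symmetric_alphabet_def)
    show "\<exists>m. replaces_prefixes m (?f s)" if "s \<in> \<Sigma>" for s
      using symmetric_surjection_closed[OF symmetric(2)] that by (simp add: action_replaces_prefixes)
  qed
  ultimately show ?thesis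
    unfolding context_free_subgroup_def using subgroup_stabiliser symmetric by metis
qed

text \<open>
  Call a word reachable if some group element carries the cone of a word of length at most \<open>n\<close>
  onto its cone by prefix replacement. Either arbitrarily long prefixes of a stream are reachable, or
  there is a longest one. In the second case the prefix with one more letter is never carried to a word
  of length at most \<open>n\<close>; as generators act on longer words as blocks, so does every group element
  on this prefix. In both cases the group element acts on a cone around the stream by a single prefix
  replacement and fixes two streams in it that belong to the chosen orbits.
\<close>

lemma finitely_many_orbits_detect_identity:
  "\<exists>N. \<forall>g\<in>carrier G.
     (\<forall>h\<in>carrier G. \<forall>\<alpha> c. length \<alpha> \<le> N \<longrightarrow>
        \<phi> g (\<phi> h (\<alpha> @- sconst c)) = \<phi> h (\<alpha> @- sconst c)) \<longrightarrow> \<phi> g = id"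
proof -
  have gen: "\<exists>m. replaces_prefixes m (\<phi> (\<rho> [s]))" if "s \<in> \<Sigma>" for s
    using symmetric_surjection_closed[OF symmetric(2)] that by (simp add: action_replaces_prefixes)
  then obtain d where d: "\<And>s. s \<in> \<Sigma> \<Longrightarrow> replaces_prefixes (d s) (\<phi> (\<rho> [s]))" by metis
  define n where "n = Max (insert 0 (d ` \<Sigma>))"
  have n: "replaces_prefixes n (\<phi> (\<rho> [s]))" if "s \<in> \<Sigma>" for s
    using replaces_prefixes_mono[OF d[OF that]] that symmetric(1)
    by (simp add: n_def symmetric_alphabet_def)
  define reachable where "reachable \<beta> \<longleftrightarrow>
    (\<exists>h\<in>carrier G. \<exists>\<alpha>. length \<alpha> \<le> n \<and> (\<forall>\<eta>. \<phi> h (\<alpha> @- \<eta>) = \<beta> @- \<eta>))" for \<beta>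
  show ?thesis
  proof (intro exI[of _ "Suc n"] ballI impI)
    fix g assume g: "g \<in> carrier G"
      and "\<forall>h\<in>carrier G. \<forall>\<alpha> c. length \<alpha> \<le> Suc n \<longrightarrow>
       \<phi> g (\<phi> h (\<alpha> @- sconst c)) = \<phi> h (\<alpha> @- sconst c)"
    then have fix_const: "\<phi> g (\<beta> @- sconst c) = \<beta> @- sconst c"
      if "h \<in> carrier G" "length \<alpha> \<le> Suc n" "\<And>\<eta>. \<phi> h (\<alpha> @- \<eta>) = \<beta> @- \<eta>" for h \<alpha> \<beta> c
      using that by metis
    from action_replaces_prefixes[OF g] obtain m where m: "replaces_prefixes m (\<phi> g)" by blast
    show "\<phi> g = id"
    proof
      fix \<xi>
      have "\<exists>h\<in>carrier G. \<exists>\<alpha> k \<gamma>. length \<alpha> \<le> Suc n \<and> (\<forall>\<eta>. \<phi> h (\<alpha> @- \<eta>) = stake k \<xi> @- \<eta>) \<and>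
          (\<forall>\<eta>. \<phi> g (stake k \<xi> @- \<eta>) = \<gamma> @- \<eta>)"
      proof (cases "\<exists>k\<ge>m. reachable (stake k \<xi>)")
        case True
        then obtain k where k: "m \<le> k" "reachable (stake k \<xi>)" by blast
        then obtain \<gamma> where "\<And>\<eta>. \<phi> g (stake k \<xi> @- \<eta>) = \<gamma> @- \<eta>"
          using replaces_prefixesE[OF m, of "stake k \<xi>"] by auto
        with k(2) show ?thesis unfolding reachable_def by (metis le_SucI)
      next
        case False
        define K where "K = {k. reachable (stake k \<xi>)}"
        have "finite K" using False nat_le_linear by (intro finite_subset[of K "{..m}"]) (auto simp: K_def)
        moreover have "0 \<in> K"
          unfolding K_def reachable_def by (auto intro!: bexI[of _ \<one>] exI[of _ "[]"] simp: action_one)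
        ultimately have "Max K \<in> K" by (intro Max_in) auto
        moreover have "Suc (Max K) \<notin> K" using Max_ge[OF \<open>finite K\<close>, of "Suc (Max K)"] by auto
        ultimately obtain h \<alpha> where h: "h \<in> carrier G" "length \<alpha> \<le> n"
            "\<And>\<eta>. \<phi> h (\<alpha> @- \<eta>) = stake (Max K) \<xi> @- \<eta>"
          and unreachable: "\<not> reachable (stake (Suc (Max K)) \<xi>)"
          unfolding K_def reachable_def by blast
        define x \<beta> where "x = \<xi> !! Max K" and "\<beta> = stake (Suc (Max K)) \<xi>"
        have \<beta>: "\<beta> = stake (Max K) \<xi> @ [x]" unfolding \<beta>_def x_def by (rule stake_Suc)
        have h': "\<phi> h ((\<alpha> @ [x]) @- \<eta>) = \<beta> @- \<eta>" for \<eta>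
          using h(3)[of "x ## \<eta>"] by (simp add: \<beta>)
        \<comment> \<open>A short image would make the longer prefix reachable through the inverse.\<close>
        have long: "n < length \<delta>"
          if "k \<in> carrier G" "\<And>\<eta>. \<phi> k (\<beta> @- \<eta>) = \<delta> @- \<eta>" for k \<delta>
        proof (rule ccontr)
          assume "\<not> n < length \<delta>"
          moreover have "\<phi> (inv k) (\<delta> @- \<eta>) = \<beta> @- \<eta>" for \<eta>
            using action_inv[OF that(1) that(2)] .
          ultimately have "reachable \<beta>"
            unfolding reachable_def using that(1) by (meson inv_closed not_le)
          then show False using unreachable by (simp add: \<beta>_def)
        qed
        have whole: "\<exists>\<delta>. \<forall>\<eta>. \<phi> (\<rho> w) (\<beta> @- \<eta>) = \<delta> @- \<eta>" if "w \<in> lists \<Sigma>" for w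
          using that
        proof (induction w rule: rev_induct)
          case Nil
          have "\<rho> [] = \<one>" using symmetric(2) by (simp add: symmetric_surjection_def)
          then show ?case by (auto simp: action_one)
        next
          case (snoc s w)
          then obtain \<delta> where \<delta>: "\<And>\<eta>. \<phi> (\<rho> w) (\<beta> @- \<eta>) = \<delta> @- \<eta>" by auto
          have c: "\<rho> w \<in> carrier G" "\<rho> [s] \<in> carrier G"
            using snoc symmetric_surjection_closed[OF symmetric(2)] by simp_all
          then have "n \<le> length \<delta>" using long[OF _ \<delta>] by simp
          then obtain \<delta>' where "\<And>\<eta>. \<phi> (\<rho> [s]) (\<delta> @- \<eta>) = \<delta>' @- \<eta>"
            using replaces_prefixesE[OF n] snoc.prems by (metis append_in_lists_conv Cons_in_lists_iff)
          moreover have "\<rho> (w @ [s]) = \<rho> w \<otimes> \<rho> [s]"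
            using symmetric_surjection_append[OF symmetric(2), of w "[s]"] snoc.prems by simp
          ultimately show ?case using \<delta> c by (auto simp: action_mult)
        qed
        obtain w where "w \<in> lists \<Sigma>" "\<rho> w = g" by (rule symmetric_surjectionE[OF symmetric(2) g])
        with whole[of w] obtain \<delta> where "\<And>\<eta>. \<phi> g (\<beta> @- \<eta>) = \<delta> @- \<eta>" by auto
        moreover have "length (\<alpha> @ [x]) \<le> Suc n" using h by simp
        ultimately show ?thesis using h(1) h' unfolding \<beta>_def by blast
      qed
      then obtain h \<alpha> k \<gamma> where *: "h \<in> carrier G" "length \<alpha> \<le> Suc n"
          "\<And>\<eta>. \<phi> h (\<alpha> @- \<eta>) = stake k \<xi> @- \<eta>" "\<And>\<eta>. \<phi> g (stake k \<xi> @- \<eta>) = \<gamma> @- \<eta>" by blast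
      then have "\<gamma> @- sconst c = stake k \<xi> @- sconst c" for c
        using fix_const[OF *(1-3)] by metis
      then have "\<gamma> = stake k \<xi>" by (rule shift_sconst_eqD)
      then show "\<phi> g \<xi> = id \<xi>" using *(4)[of "sdrop k \<xi>"] by (simp add: stake_sdrop)
    qed
  qed
qed

end

text \<open>
  A point stabiliser contains \<open>g\<close> in its core exactly if \<open>g\<close> fixes the orbit of the point.
\<close>

theorem embedding_gives_context_free_subgroups:
  fixes G :: "('a, 'b) monoid_scheme" (structure)
  assumes fg: "finitely_generated_group G" and hom: "\<phi> \<in> hom G thompson_V"
    and inj: "inj_on \<phi> (carrier G)"
  shows "\<exists>(n :: nat) (H :: nat \<Rightarrow> 'a set). n \<ge> 1 \<and>
            (\<forall>i\<in>{1..n}. context_free_subgroup G (H i)) \<and>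
            (\<Inter>i\<in>{1..n}. subgroup_core G (H i)) = {\<one>\<^bsub>G\<^esub>}"
proof -
  have grp: "group G" using fg by (simp add: finitely_generated_group_def)
  obtain \<Sigma> :: "nat set" and bar \<rho>
    where sym: "symmetric_alphabet \<Sigma> bar" "symmetric_surjection G \<Sigma> bar \<rho>"
    by (rule symmetric_surjection_exists[OF fg])
  interpret thompson_action G \<phi> \<Sigma> bar \<rho>
    by (intro thompson_action.intro grp thompson_action_axioms.intro hom sym)
  obtain N where N: "\<forall>g\<in>carrier G.
     (\<forall>h\<in>carrier G. \<forall>\<alpha> c. length \<alpha> \<le> N \<longrightarrow>
        \<phi> g (\<phi> h (\<alpha> @- sconst c)) = \<phi> h (\<alpha> @- sconst c)) \<longrightarrow> \<phi> g = id"
    by (rule exE[OF finitely_many_orbits_detect_identity])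
  define Q where "Q = {\<alpha> :: bool list. length \<alpha> \<le> N} \<times> (UNIV :: bool set)"
  have "finite Q" unfolding Q_def by (simp add: finite_bool_words)
  moreover have "([], True) \<in> Q" by (simp add: Q_def)
  ultimately obtain e where e: "bij_betw e {1..card Q} Q" and "card Q \<ge> 1"
    using ex_bij_betw_nat_finite_1[of Q] by (metis card_0_eq empty_iff less_one not_le)
  define H where "H i = (case e i of (\<alpha>, c) \<Rightarrow> stabiliser (\<alpha> @- sconst c))" for i
  have range: "(\<exists>i\<in>{1..card Q}. H i = stabiliser (\<alpha> @- sconst c))" if "length \<alpha> \<le> N" for \<alpha> c
  proof -
    have "(\<alpha>, c) \<in> e ` {1..card Q}" using e that by (simp add: bij_betw_def Q_def)
    then show ?thesis by (force simp: H_def)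
  qed
  have "g = \<one>" if g: "g \<in> (\<Inter>i\<in>{1..card Q}. subgroup_core G (H i))" for g
  proof -
    have core: "g \<in> subgroup_core G (stabiliser (\<alpha> @- sconst c))" if "length \<alpha> \<le> N" for \<alpha> c
    proof -
      from range[OF that] obtain i where "i \<in> {1..card Q}" "H i = stabiliser (\<alpha> @- sconst c)" ..
      with INT_D[OF g] show ?thesis by metis
    qed
    have c: "g \<in> carrier G"
      using core[of "[]" True] mem_subgroup_core_iff[OF grp subgroup_stabiliser] by simp
    have "\<phi> g = id"
    proof (rule N[rule_format, OF c])
      fix h \<alpha> c assume h: "h \<in> carrier G" and "length (\<alpha> :: bool list) \<le> N"
      then have "h \<otimes> g \<otimes> inv h \<in> stabiliser (\<alpha> @- sconst c)"
        using core mem_subgroup_core_iff[OF grp subgroup_stabiliser] by blast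
      then have "\<phi> (inv h) (\<phi> g (\<phi> h (\<alpha> @- sconst c))) = \<alpha> @- sconst c"
        using h \<open>g \<in> carrier G\<close> by (simp add: stabiliser_def action_mult)
      then have "\<phi> h (\<alpha> @- sconst c) = \<phi> g (\<phi> h (\<alpha> @- sconst c))"
        using action_inv[of "inv h"] h by (metis inv_closed inv_inv)
      then show "\<phi> g (\<phi> h (\<alpha> @- sconst c)) = \<phi> h (\<alpha> @- sconst c)" by simp
    qed
    then show ?thesis
      using inj c hom_thompson_V_one[OF grp hom] by (metis inj_onD one_closed)
  qed
  moreover have "\<one> \<in> subgroup_core G (H i)" for i
  proof -
    have sub: "subgroup (H i) G" by (simp add: H_def subgroup_stabiliser split: prod.split)
    show ?thesis
      unfolding mem_subgroup_core_iff[OF grp sub] using subgroup.one_closed[OF sub] by simp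
  qed
  ultimately have "(\<Inter>i\<in>{1..card Q}. subgroup_core G (H i)) = {\<one>}"
    by blast
  moreover have "context_free_subgroup G (H i)" for i
    by (simp add: H_def context_free_subgroup_stabiliser split: prod.split)
  ultimately show ?thesis using \<open>card Q \<ge> 1\<close> by blast
qed

section \<open>Cone types of a context-free Schreier graph\<close>

text \<open>
  The orbit of \<open>base\<close> with its edges labelled by letters is the Schreier graph; the involution walks
  an edge backwards.
\<close>

locale symmetric_action =
  fixes A :: "'s set" and bar :: "'s \<Rightarrow> 's" and act :: "'s \<Rightarrow> 'x \<Rightarrow> 'x" and base :: 'x
  assumes finite_A: "finite A"
    and bar_in: "\<And>s. s \<in> A \<Longrightarrow> bar s \<in> A"
    and bar_bar: "\<And>s. s \<in> A \<Longrightarrow> bar (bar s) = s"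
    and act_bar: "\<And>s x. s \<in> A \<Longrightarrow> act (bar s) (act s x) = x"
begin

abbreviation go :: "'x \<Rightarrow> 's list \<Rightarrow> 'x" (infixl "\<cdot>" 70) where
  "x \<cdot> w \<equiv> run act x w"

abbreviation retrace :: "'s list \<Rightarrow> 's list" where
  "retrace \<equiv> bar_word bar"

lemma back_simps [simp]: "retrace [] = []" "retrace (s # w) = retrace w @ [bar s]" "length (retrace w) = length w"
  by (simp_all add: bar_word_def)

lemma back_in: "set w \<subseteq> A \<Longrightarrow> set (retrace w) \<subseteq> A"
  using bar_in by (auto simp: bar_word_def)

lemma go_back: "set w \<subseteq> A \<Longrightarrow> x \<cdot> w \<cdot> retrace w = x"
  by (induction w arbitrary: x) (auto simp: act_bar)

lemma back_go: "set w \<subseteq> A \<Longrightarrow> x \<cdot> retrace w \<cdot> w = x"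
proof (induction w arbitrary: x)
  case (Cons s w)
  then have "act s (act (bar s) y) = y" for y using act_bar[of "bar s"] bar_in bar_bar by simp
  with Cons show ?case by simp
qed simp

lemma go_cancel: "set w \<subseteq> A \<Longrightarrow> x \<cdot> w = y \<cdot> w \<Longrightarrow> x = y"
  by (metis go_back)

definition verts :: "'x set" where
  "verts = {base \<cdot> w |w. set w \<subseteq> A}"

lemma go_verts: "x \<in> verts \<Longrightarrow> set w \<subseteq> A \<Longrightarrow> x \<cdot> w \<in> verts"
proof -
  assume "x \<in> verts" "set w \<subseteq> A"
  then obtain u where "set u \<subseteq> A" "x = base \<cdot> u" unfolding verts_def by blast
  with \<open>set w \<subseteq> A\<close> have "set (u @ w) \<subseteq> A" "x \<cdot> w = base \<cdot> (u @ w)" by simp_all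
  then show ?thesis unfolding verts_def by blast
qed

text \<open>
  Distance from the base point.
\<close>

definition lev :: "'x \<Rightarrow> nat" where
  "lev x = (LEAST n. \<exists>w. set w \<subseteq> A \<and> length w = n \<and> base \<cdot> w = x)"

lemma geodesic:
  assumes "x \<in> verts"
  obtains p where "set p \<subseteq> A" "length p = lev x" "base \<cdot> p = x"
proof -
  have "\<exists>n w. set w \<subseteq> A \<and> length w = n \<and> base \<cdot> w = x"
    using assms unfolding verts_def by blast
  then have "\<exists>w. set w \<subseteq> A \<and> length w = lev x \<and> base \<cdot> w = x"
    unfolding lev_def by (rule LeastI_ex)
  then show thesis using that by blast
qed

lemma lev_base_go: "set w \<subseteq> A \<Longrightarrow> lev (base \<cdot> w) \<le> length w"
  unfolding lev_def by (rule Least_le) blast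

lemma lev_base: "lev base = 0"
  using lev_base_go[of "[]"] by simp

lemma base_verts: "base \<in> verts"
  unfolding verts_def by (auto intro: exI[of _ "[]"])

lemma lev_go_le:
  assumes "x \<in> verts" "set w \<subseteq> A"
  shows "lev (x \<cdot> w) \<le> lev x + length w"
proof -
  obtain p where p: "set p \<subseteq> A" "length p = lev x" "base \<cdot> p = x" by (rule geodesic[OF assms(1)])
  then show ?thesis using lev_base_go[of "p @ w"] assms(2) by simp
qed

lemma lev_le_go:
  assumes "x \<in> verts" "set w \<subseteq> A"
  shows "lev x \<le> lev (x \<cdot> w) + length w"
  using lev_go_le[OF go_verts[OF assms] back_in[OF assms(2)]] go_back[OF assms(2)] by simp

text \<open>
  The path from \<open>x\<close> labelled by the word never descends below level \<open>k\<close>. The words \<open>w\<close> with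
  \<open>high (lev x) x w\<close> trace out the cone above \<open>x\<close>.
\<close>

fun high :: "nat \<Rightarrow> 'x \<Rightarrow> 's list \<Rightarrow> bool" where
  "high k x [] \<longleftrightarrow> k \<le> lev x"
| "high k x (s # w) \<longleftrightarrow> k \<le> lev x \<and> s \<in> A \<and> high k (act s x) w"

lemma high_append: "high k x (u @ v) \<longleftrightarrow> high k x u \<and> high k (x \<cdot> u) v"
  by (induction u arbitrary: x) (cases v; auto)+

lemma high_letters: "high k x w \<Longrightarrow> set w \<subseteq> A"
  by (induction w arbitrary: x) auto

lemma high_ends: "high k x w \<Longrightarrow> k \<le> lev x" "high k x w \<Longrightarrow> k \<le> lev (x \<cdot> w)"
  by (induction w arbitrary: x) auto

lemma high_mono: "high k x w \<Longrightarrow> j \<le> k \<Longrightarrow> high j x w"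
  by (induction w arbitrary: x) auto

lemma high_back: "high k x w \<Longrightarrow> high k (x \<cdot> w) (retrace w)"
proof (induction w arbitrary: x)
  case (Cons s w)
  then show ?case using high_letters[of k "act s x" w]
    by (auto simp: high_append go_back act_bar bar_in intro: high_ends)
qed simp

text \<open>
  The final part of a geodesic from the base point.
\<close>

lemma descend:
  assumes "x \<in> verts" "k \<le> lev x"
  obtains z q where "z \<in> verts" "lev z = k" "length q = lev x - k" "z \<cdot> q = x" "high k z q"
proof -
  have "\<exists>z q. z \<in> verts \<and> lev z = k \<and> length q = lev x - k \<and> z \<cdot> q = x \<and> high k z q"
    using assms
  proof (induction "lev x - k" arbitrary: x)
    case 0
    then have "x \<in> verts \<and> lev x = k \<and> length [] = lev x - k \<and> x \<cdot> [] = x \<and> high k x []" by simp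
    then show ?case by blast
  next
    case (Suc m)
    obtain p where p: "set p \<subseteq> A" "length p = lev x" "base \<cdot> p = x" by (rule geodesic[OF Suc.prems(1)])
    have "p \<noteq> []" using p(2) Suc.hyps(2) by auto
    then obtain p' s where p': "p = p' @ [s]" by (cases p rule: rev_cases) auto
    define x' where "x' = base \<cdot> p'"
    have x': "x' \<in> verts" "x' \<cdot> [s] = x" "s \<in> A"
      using p p' by (auto simp: x'_def go_verts base_verts)
    have "lev x' \<le> length p'" using p p' lev_base_go[of p'] by (simp add: x'_def)
    moreover have "lev x \<le> lev x' + 1" using lev_go_le[OF x'(1), of "[s]"] x' by simp
    ultimately have l: "lev x = Suc (lev x')" using p(2) p' by simp
    then have "\<exists>z q. z \<in> verts \<and> lev z = k \<and> length q = lev x' - k \<and> z \<cdot> q = x' \<and> high k z q"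
      using Suc.hyps(1)[of x'] Suc.hyps(2) x'(1) by simp
    then obtain z q where z: "z \<in> verts" "lev z = k" "length q = lev x' - k" "z \<cdot> q = x'" "high k z q"
      by blast
    have "z \<cdot> (q @ [s]) = x" using z x' by simp
    moreover have "high k z (q @ [s])"
      unfolding high_append using z x' high_ends(2)[OF z(5)] l by simp
    moreover have "length (q @ [s]) = lev x - k" using z(3) l Suc.hyps(2) by simp
    ultimately show ?case using z(1,2) by blast
  qed
  then show thesis using that by blast
qed

definition near :: "nat \<Rightarrow> 'x \<Rightarrow> 'x \<Rightarrow> bool" where
  "near k x y \<longleftrightarrow> (\<exists>h. set h \<subseteq> A \<and> length h \<le> k \<and> x \<cdot> h = y)"

lemma near_go: "set h \<subseteq> A \<Longrightarrow> length h \<le> k \<Longrightarrow> near k x (x \<cdot> h)"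
  unfolding near_def by blast

lemma near_sym: "near k x y \<Longrightarrow> near k y x"
  unfolding near_def using back_in go_back by (metis back_simps(3))

lemma near_trans: "near k x y \<Longrightarrow> near l y z \<Longrightarrow> near (k + l) x z"
proof -
  assume "near k x y" "near l y z"
  then obtain g h where "set g \<subseteq> A" "length g \<le> k" "x \<cdot> g = y" "set h \<subseteq> A" "length h \<le> l" "y \<cdot> h = z"
    unfolding near_def by blast
  then have "set (g @ h) \<subseteq> A" "length (g @ h) \<le> k + l" "x \<cdot> (g @ h) = z" by simp_all
  then show ?thesis unfolding near_def by blast
qed

lemma near_mono: "near k x y \<Longrightarrow> k \<le> l \<Longrightarrow> near l x y"
  unfolding near_def by fastforce

lemma near_lev: "x \<in> verts \<Longrightarrow> near k x y \<Longrightarrow> lev y \<le> lev x + k"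
  unfolding near_def using lev_go_le by fastforce

text \<open>
  Label-preserving, relative-level-preserving isomorphism of the cones above \<open>x\<close> and \<open>y\<close> that
  sends \<open>x\<close> to \<open>y\<close>. Such an isomorphism is determined by the images of paths, so it is expressed by
  words alone.
\<close>

definition cone_iso :: "'x \<Rightarrow> 'x \<Rightarrow> bool" (infix "\<sim>" 50) where
  "x \<sim> y \<longleftrightarrow> x \<in> verts \<and> y \<in> verts \<and>
     (\<forall>w. high (lev x) x w \<longleftrightarrow> high (lev y) y w) \<and>
     (\<forall>w. high (lev x) x w \<longrightarrow> lev (x \<cdot> w) + lev y = lev (y \<cdot> w) + lev x) \<and>
     (\<forall>u v. high (lev x) x u \<longrightarrow> high (lev x) x v \<longrightarrow> (x \<cdot> u = x \<cdot> v \<longleftrightarrow> y \<cdot> u = y \<cdot> v))"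

end

locale context_free_action = symmetric_action A bar act base
  for A :: "'s set" and bar and act :: "'s \<Rightarrow> 'x \<Rightarrow> 'x" and base +
  fixes F :: "'s list set set"
  assumes splitting: "splitting_family F"
    and loops: "{w \<in> lists A. base \<cdot> w = base} \<in> F"
begin

text \<open>
  A grammar edge: all words of the language lead from \<open>x\<close> to the same vertex.
\<close>

definition valid :: "'s list set \<Rightarrow> 'x \<Rightarrow> 'x \<Rightarrow> bool" where
  "valid M x y \<longleftrightarrow> (\<forall>w\<in>M. set w \<subseteq> A \<and> x \<cdot> w = y)"

text \<open>
  Within a larger word whose end point is known, the parts lead to well-defined vertices because
  letters act injectively.
\<close>

lemma valid_split:
  assumes "valid M x y" "u \<in> M1" "v \<in> M2" "\<And>u' v'. u' \<in> M1 \<Longrightarrow> v' \<in> M2 \<Longrightarrow> u' @ v' \<in> M"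
  shows "valid M1 x (x \<cdot> u)" "valid M2 (x \<cdot> u) y"
proof -
  have *: "set u' \<subseteq> A \<and> set v' \<subseteq> A \<and> x \<cdot> u' \<cdot> v' = y" if "u' \<in> M1" "v' \<in> M2" for u' v'
    using assms(4)[OF that] assms(1) unfolding valid_def by fastforce
  show "valid M1 x (x \<cdot> u)"
    unfolding valid_def using *[OF _ assms(3)] *[OF assms(2,3)] go_cancel by metis
  show "valid M2 (x \<cdot> u) y"
    unfolding valid_def using *[OF assms(2)] by blast
qed

text \<open>
  Grammar edges join vertices at distance at most \<open>width\<close>.
\<close>

definition width :: nat where
  "width = (SOME k. \<forall>M\<in>F. M \<noteq> {} \<longrightarrow> (\<exists>w\<in>M. length w \<le> k))"

lemma width: "M \<in> F \<Longrightarrow> M \<noteq> {} \<Longrightarrow> \<exists>w\<in>M. length w \<le> width"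
proof -
  have "\<exists>k. \<forall>M\<in>F. M \<noteq> {} \<longrightarrow> (\<exists>w\<in>M. length w \<le> k)"
  proof -
    define l where "l M = length (SOME w. w \<in> M)" for M :: "'s list set"
    have "finite F" using splitting unfolding splitting_family_def by blast
    then have "\<forall>M\<in>F. M \<noteq> {} \<longrightarrow> (SOME w. w \<in> M) \<in> M \<and> length (SOME w. w \<in> M) \<le> Max (l ` F)"
      by (auto simp: l_def some_in_eq intro: Max_ge)
    then show ?thesis by blast
  qed
  then have "\<forall>M\<in>F. M \<noteq> {} \<longrightarrow> (\<exists>w\<in>M. length w \<le> width)"
    unfolding width_def by (rule someI_ex)
  then show "M \<in> F \<Longrightarrow> M \<noteq> {} \<Longrightarrow> \<exists>w\<in>M. length w \<le> width" by blast
qed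

lemma valid_near: "valid M x y \<Longrightarrow> M \<in> F \<Longrightarrow> w \<in> M \<Longrightarrow> near width x y"
  using width[of M] unfolding valid_def near_def by blast

text \<open>
  A word cut into grammar edges with all cutting points in \<open>Z\<close>.
\<close>

inductive chain :: "('x \<Rightarrow> bool) \<Rightarrow> 'x \<Rightarrow> 's list \<Rightarrow> 'x \<Rightarrow> bool" for Z where
  chain_Nil: "Z x \<Longrightarrow> chain Z x [] x"
| chain_step: "Z x \<Longrightarrow> M \<in> F \<Longrightarrow> valid M x y \<Longrightarrow> u \<in> M \<Longrightarrow> chain Z y v z \<Longrightarrow> chain Z x (u @ v) z"

lemma chain_append: "chain Z x u y \<Longrightarrow> chain Z y v z \<Longrightarrow> chain Z x (u @ v) z"
  by (induction rule: chain.induct) (auto intro: chain_step)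

lemma chain_single: "Z x \<Longrightarrow> Z y \<Longrightarrow> M \<in> F \<Longrightarrow> valid M x y \<Longrightarrow> w \<in> M \<Longrightarrow> chain Z x w y"
  using chain_step[of Z x M y w "[]" y] chain_Nil[of Z y] by simp

lemma chain_mono: "chain Z x w y \<Longrightarrow> (\<And>z. Z z \<Longrightarrow> Z' z) \<Longrightarrow> chain Z' x w y"
  by (induction rule: chain.induct) (auto intro: chain.intros)

lemma chain_ends: "chain Z x w y \<Longrightarrow> Z x" "chain Z x w y \<Longrightarrow> Z y"
  by (induction rule: chain.induct) auto

lemma chain_high: "chain Z x w y \<Longrightarrow> high k x w \<Longrightarrow> chain (\<lambda>z. Z z \<and> k \<le> lev z) x w y"
proof (induction rule: chain.induct)
  case (chain_Nil x)
  then show ?case by (auto intro: chain.chain_Nil)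
next
  case (chain_step x M y u v z)
  then have "x \<cdot> u = y" by (auto simp: valid_def)
  with chain_step show ?case
    by (intro chain.chain_step[of _ x M y u v z]) (auto simp: high_append dest: high_ends)
qed

definition left_near :: "'x \<Rightarrow> 's list \<Rightarrow> 'x \<Rightarrow> bool" where
  "left_near a p z \<longleftrightarrow> (\<exists>p1 p2. p = p1 @ p2 \<and> near width (a \<cdot> p1) z)"

definition right_near :: "'x \<Rightarrow> 's list \<Rightarrow> 'x \<Rightarrow> bool" where
  "right_near b q z \<longleftrightarrow> (\<exists>q1 q2. q = q1 @ q2 \<and> near width z (b \<cdot> q1))"

lemma near_refl: "near k x x"
  unfolding near_def by (auto intro: exI[of _ "[]"])

lemma left_near_end: "left_near a p (a \<cdot> p)"
  unfolding left_near_def using near_refl by blast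

lemma right_near_start: "right_near b q b"
  unfolding right_near_def using near_refl by (metis append_Nil foldl_Nil)

lemma left_near_tail: "left_near (a \<cdot> p1) p2 z \<Longrightarrow> left_near a (p1 @ p2) z"
  unfolding left_near_def by (metis append.assoc foldl_append)

lemma right_near_prefix: "right_near b q1 z \<Longrightarrow> right_near b (q1 @ q2) z"
  unfolding right_near_def by (metis append.assoc)

text \<open>
  In the parse tree of \<open>p w\<close>, take the maximal subtrees that lie within \<open>w\<close>. Each of them ends where
  some subtree starting at a vertex of \<open>p\<close> ends, which is a grammar edge from that vertex.
\<close>

lemma chain_left:
  assumes "p @ w \<in> M" "M \<in> F" "valid M a b"
  shows "chain (left_near a p) (a \<cdot> p) w b"
  using assms
proof (induction "length (p @ w)" arbitrary: p w M a b rule: less_induct)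
  case less
  have b: "left_near a p b"
    unfolding left_near_def using valid_near[OF less.prems(3,2,1)] by (metis append_Nil foldl_Nil)
  have ab: "a \<cdot> p \<cdot> w = b" using less.prems by (auto simp: valid_def)
  consider "p = []" | "w = []" | "p \<noteq> []" "w \<noteq> []" by blast
  then show ?case
  proof cases
    case 1
    then show ?thesis
      using less.prems b left_near_end[of a p] by (intro chain_single[of _ _ _ M]) auto
  next
    case 2
    then show ?thesis using ab left_near_end by (auto intro: chain_Nil)
  next
    case 3
    then have "2 \<le> length (p @ w)" by (cases p; cases w) auto
    from splitting_familyE[OF splitting less.prems(2,1) this]
    obtain M1 M2 u v where s: "M1 \<in> F" "M2 \<in> F" "u \<in> M1" "v \<in> M2" "p @ w = u @ v" "u \<noteq> []" "v \<noteq> []"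
        "\<And>u' v'. u' \<in> M1 \<Longrightarrow> v' \<in> M2 \<Longrightarrow> u' @ v' \<in> M" by metis
    note V = valid_split[OF less.prems(3) s(3,4,8)]
    from s(5) consider p2 where "p = u @ p2" "v = p2 @ w" | w1 where "u = p @ w1" "w = w1 @ v"
      by (auto simp: append_eq_append_conv2)
    then show ?thesis
    proof cases
      case 1
      then have "chain (left_near (a \<cdot> u) p2) (a \<cdot> u \<cdot> p2) w b"
        using less.hyps[of p2 w M2 "a \<cdot> u" b] s V by simp
      then show ?thesis using 1 left_near_tail by (auto elim: chain_mono)
    next
      case 2
      then have *: "chain (left_near a p) (a \<cdot> p) w1 (a \<cdot> u)"
        using less.hyps[of p w1 M1 a "a \<cdot> u"] s V by simp
      have "chain (left_near a p) (a \<cdot> u) v b"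
        by (rule chain_single[OF chain_ends(2)[OF *] b s(2) V(2) s(4)])
      with * show ?thesis using 2 chain_append by blast
    qed
  qed
qed

lemma chain_right:
  assumes "w @ q \<in> M" "M \<in> F" "valid M a b"
  shows "chain (right_near (a \<cdot> w) q) a w (a \<cdot> w)"
  using assms
proof (induction "length (w @ q)" arbitrary: q w M a b rule: less_induct)
  case less
  have ab: "a \<cdot> w \<cdot> q = b" using less.prems by (auto simp: valid_def)
  have a: "right_near (a \<cdot> w) q a"
    unfolding right_near_def using valid_near[OF less.prems(3,2,1)] ab by (metis append_Nil2)
  consider "q = []" | "w = []" | "q \<noteq> []" "w \<noteq> []" by blast
  then show ?case
  proof cases
    case 1
    then show ?thesis
      using less.prems a ab right_near_start[of b q] by (intro chain_single[of _ _ _ M]) auto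
  next
    case 2
    then show ?thesis using right_near_start by (auto intro: chain_Nil)
  next
    case 3
    then have "2 \<le> length (w @ q)" by (cases q; cases w) auto
    from splitting_familyE[OF splitting less.prems(2,1) this]
    obtain M1 M2 u v where s: "M1 \<in> F" "M2 \<in> F" "u \<in> M1" "v \<in> M2" "w @ q = u @ v" "u \<noteq> []" "v \<noteq> []"
        "\<And>u' v'. u' \<in> M1 \<Longrightarrow> v' \<in> M2 \<Longrightarrow> u' @ v' \<in> M" by metis
    note V = valid_split[OF less.prems(3) s(3,4,8)]
    from s(5) consider w2 where "w = u @ w2" "v = w2 @ q" | q1 where "u = w @ q1" "q = q1 @ v"
      by (auto simp: append_eq_append_conv2)
    then show ?thesis
    proof cases
      case 1
      then have *: "chain (right_near (a \<cdot> w) q) (a \<cdot> u) w2 (a \<cdot> w)"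
        using less.hyps[of w2 q M2 "a \<cdot> u" b] s V by simp
      have "chain (right_near (a \<cdot> w) q) a u (a \<cdot> u)"
        by (rule chain_single[OF a chain_ends(1)[OF *] s(1) V(1) s(3)])
      with * show ?thesis using 1 chain_append by blast
    next
      case 2
      then have "chain (right_near (a \<cdot> w) q1) a w (a \<cdot> w)"
        using less.hyps[of w q1 M1 a "a \<cdot> u"] s V by simp
      then show ?thesis using 2 right_near_prefix by (auto elim: chain_mono)
    qed
  qed
qed

text \<open>
  Descending in the parse tree, the middle word stays whole until a node cuts it or isolates it from
  one of its sides; then the one-sided versions apply.
\<close>

lemma chain_middle:
  assumes "p @ w @ q \<in> M" "M \<in> F" "valid M a b"
  shows "\<exists>w1 w2 c. w = w1 @ w2 \<and> chain (left_near a p) (a \<cdot> p) w1 c \<and>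
    chain (right_near (a \<cdot> p \<cdot> w) q) c w2 (a \<cdot> p \<cdot> w)"
  using assms
proof (induction "length (p @ w @ q)" arbitrary: p q M a b rule: less_induct)
  case less
  consider "p = []" | "q = []" | "p \<noteq> []" "q \<noteq> []" by blast
  then show ?case
  proof cases
    case 1
    then have "chain (right_near (a \<cdot> w) q) a w (a \<cdot> w)"
      using chain_right[of w q M a b] less.prems by simp
    moreover have "chain (left_near a p) (a \<cdot> p) [] (a \<cdot> p)" by (rule chain_Nil) (rule left_near_end)
    ultimately show ?thesis using 1 by force
  next
    case 2
    then have "chain (left_near a p) (a \<cdot> p) w b" "a \<cdot> p \<cdot> w = b"
      using chain_left[of p w M a b] less.prems by (auto simp: valid_def)
    moreover have "chain (right_near b q) b [] b" by (rule chain_Nil) (rule right_near_start)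
    ultimately show ?thesis by force
  next
    case 3
    then have "2 \<le> length (p @ w @ q)" by (cases p; cases q) auto
    from splitting_familyE[OF splitting less.prems(2,1) this]
    obtain M1 M2 u v where s: "M1 \<in> F" "M2 \<in> F" "u \<in> M1" "v \<in> M2" "p @ w @ q = u @ v" "u \<noteq> []" "v \<noteq> []"
        "\<And>u' v'. u' \<in> M1 \<Longrightarrow> v' \<in> M2 \<Longrightarrow> u' @ v' \<in> M" by metis
    note V = valid_split[OF less.prems(3) s(3,4,8)]
    from s(5) consider p2 where "p = u @ p2" "v = p2 @ w @ q"
      | w1 w2 where "u = p @ w1" "w = w1 @ w2" "v = w2 @ q"
      | q1 where "u = p @ w @ q1" "q = q1 @ v"
      by (auto simp: append_eq_append_conv2)
    then show ?thesis
    proof cases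
      case 1
      then have "\<exists>w1 w2 c. w = w1 @ w2 \<and> chain (left_near (a \<cdot> u) p2) (a \<cdot> u \<cdot> p2) w1 c \<and>
          chain (right_near (a \<cdot> u \<cdot> p2 \<cdot> w) q) c w2 (a \<cdot> u \<cdot> p2 \<cdot> w)"
        using less.hyps[of p2 q M2 "a \<cdot> u" b] s V by simp
      then obtain w1 w2 c where "w = w1 @ w2" "chain (left_near (a \<cdot> u) p2) (a \<cdot> p) w1 c"
          "chain (right_near (a \<cdot> p \<cdot> w) q) c w2 (a \<cdot> p \<cdot> w)" using 1 by auto
      moreover from this(2) have "chain (left_near a p) (a \<cdot> p) w1 c"
        using 1 left_near_tail by (auto elim: chain_mono)
      ultimately show ?thesis by blast
    next
      case 2
      have "chain (left_near a p) (a \<cdot> p) w1 (a \<cdot> u)"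
        using chain_left[of p w1 M1 a "a \<cdot> u"] s V 2 by simp
      moreover have "chain (right_near (a \<cdot> p \<cdot> w) q) (a \<cdot> u) w2 (a \<cdot> p \<cdot> w)"
        using chain_right[of w2 q M2 "a \<cdot> u" b] s V 2 by simp
      ultimately show ?thesis using 2 by blast
    next
      case 3
      then have "\<exists>w1 w2 c. w = w1 @ w2 \<and> chain (left_near a p) (a \<cdot> p) w1 c \<and>
          chain (right_near (a \<cdot> p \<cdot> w) q1) c w2 (a \<cdot> p \<cdot> w)"
        using less.hyps[of p q1 M1 a "a \<cdot> u"] s V by simp
      then obtain w1 w2 c where "w = w1 @ w2" "chain (left_near a p) (a \<cdot> p) w1 c"
          "chain (right_near (a \<cdot> p \<cdot> w) q1) c w2 (a \<cdot> p \<cdot> w)" by blast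
      moreover from this(3) have "chain (right_near (a \<cdot> p \<cdot> w) q) c w2 (a \<cdot> p \<cdot> w)"
        using 3 right_near_prefix by (auto elim: chain_mono)
      ultimately show ?thesis by blast
    qed
  qed
qed

text \<open>
  The path is closed by geodesics from and to the base point. Cutting points of the middle word are
  near one of the geodesics, but not below level \<open>lev x\<close>; as a geodesic descends at unit speed, they
  are within \<open>2 * width\<close> of its upper end. The vertex where the parts meet is near both
  geodesics, which bounds the distance of the two ends of the path by \<open>4 * width\<close>.
\<close>

lemma loop_chain:
  assumes x: "x \<in> verts" and w: "high (lev x) x w" and "lev (x \<cdot> w) = lev x"
  shows "chain (near (6 * width) x) x w (x \<cdot> w)"
proof -
  define y where "y = x \<cdot> w"
  have wA: "set w \<subseteq> A" using w by (rule high_letters)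
  have y: "y \<in> verts" "lev y = lev x" using go_verts[OF x wA] assms(3) by (simp_all add: y_def)
  obtain p where p: "set p \<subseteq> A" "length p = lev x" "base \<cdot> p = x" by (rule geodesic[OF x])
  obtain r where r: "set r \<subseteq> A" "length r = lev y" "base \<cdot> r = y" by (rule geodesic[OF y(1)])
  define q where "q = retrace r"
  have q: "set q \<subseteq> A" "length q = lev x" "y \<cdot> q = base"
    using back_in[OF r(1)] r y go_back[OF r(1), of base] by (auto simp: q_def)
  let ?L = "{w \<in> lists A. base \<cdot> w = base}"
  have "valid ?L base base" by (auto simp: valid_def)
  moreover have "p @ w @ q \<in> ?L" using p q wA by (auto simp: y_def[symmetric])
  ultimately obtain w1 w2 c where c: "w = w1 @ w2" "chain (left_near base p) x w1 c"
      "chain (right_near y q) c w2 y"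
    using chain_middle[OF _ loops, of p w q base base] p y_def by auto
  have c1: "x \<cdot> w1 = c"
  proof -
    have "chain Z x u y \<Longrightarrow> x \<cdot> u = y" for Z x u y
      by (induction rule: chain.induct) (auto simp: valid_def)
    then show ?thesis using c(2) .
  qed
  have hw: "high (lev x) x w1" "high (lev x) c w2"
    using w c(1) c1 by (auto simp: high_append)
  have left: "near (2 * width) x z" if "left_near base p z" "lev x \<le> lev z" for z
  proof -
    from that(1) obtain p1 p2 where *: "p = p1 @ p2" "near width (base \<cdot> p1) z"
      unfolding left_near_def by blast
    have "lev z \<le> lev (base \<cdot> p1) + width"
      using near_lev[OF _ *(2)] go_verts[OF base_verts] p(1) *(1) by simp
    also have "lev (base \<cdot> p1) \<le> length p1" using lev_base_go p(1) *(1) by simp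
    finally have "length p2 \<le> width" using that(2) p(2) *(1) by simp
    then have "near width (base \<cdot> p1) (base \<cdot> p1 \<cdot> p2)"
      using p(1) *(1) by (intro near_go) simp_all
    then have "near width x (base \<cdot> p1)" using near_sym p(3) *(1) by simp
    then show ?thesis using near_trans[OF _ *(2)] by (simp add: mult_2)
  qed
  have right: "near (2 * width) z y" if "right_near y q z" "lev x \<le> lev z" for z
  proof -
    from that(1) obtain q1 q2 where *: "q = q1 @ q2" "near width z (y \<cdot> q1)"
      unfolding right_near_def by blast
    have A: "set q1 \<subseteq> A" "set q2 \<subseteq> A" using q(1) *(1) by auto
    have "y \<cdot> q1 = base \<cdot> retrace q2"
      using q(3) *(1) go_back[OF A(2), of "y \<cdot> q1"] by simp
    then have "lev (y \<cdot> q1) \<le> length q2" using lev_base_go[OF back_in[OF A(2)]] by simp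
    moreover have "lev z \<le> lev (y \<cdot> q1) + width"
      using near_lev[OF go_verts[OF y(1) A(1)] near_sym[OF *(2)]] .
    ultimately have "length q1 \<le> width" using that(2) q(2) *(1) by simp
    then have "near width (y \<cdot> q1) y" using near_sym near_go A(1) by blast
    then show ?thesis using near_trans[OF *(2)] by (simp add: mult_2)
  qed
  have 1: "chain (\<lambda>z. left_near base p z \<and> lev x \<le> lev z) x w1 c"
    by (rule chain_high[OF c(2) hw(1)])
  have 2: "chain (\<lambda>z. right_near y q z \<and> lev x \<le> lev z) c w2 y"
    by (rule chain_high[OF c(3) hw(2)])
  have "near (2 * width) x c" using chain_ends(2)[OF 1] left by blast
  moreover have "near (2 * width) c y" using chain_ends(1)[OF 2] right by blast
  ultimately have xy: "near (2 * width + 2 * width) x y" by (rule near_trans)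
  have "chain (near (6 * width) x) x w1 c"
    using 1 left near_mono[of "2 * width" x _ "6 * width"] by (auto elim!: chain_mono)
  moreover have "near (6 * width) x z" if "right_near y q z \<and> lev x \<le> lev z" for z
  proof -
    have "near (2 * width) y z" using right that near_sym by blast
    from near_trans[OF xy this] show ?thesis by (rule near_mono) simp
  qed
  then have "chain (near (6 * width) x) c w2 y"
    using 2 by (auto elim!: chain_mono)
  ultimately show ?thesis using c(1) chain_append y_def by blast
qed

text \<open>
  One letter longer than the bound of \<open>loop_chain\<close>, in order to see whether an edge at the bottom
  of a cone leaves the cone.
\<close>

definition near_words :: "'s list set" where
  "near_words = {h. set h \<subseteq> A \<and> length h \<le> Suc (6 * width)}"

lemma finite_near_words: "finite near_words"
  unfolding near_words_def by (rule finite_lists_length_le[OF finite_A])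

lemma near_by_short_word: "near (6 * width) x z \<Longrightarrow> \<exists>h\<in>near_words. length h \<le> 6 * width \<and> x \<cdot> h = z"
  unfolding near_def near_words_def by fastforce

text \<open>
  Everything about a neighbourhood of \<open>x\<close> that the cone above \<open>x\<close> depends on: grammar edges,
  coincidences of vertices and relative levels. It takes finitely many values.
\<close>

definition local_data where
  "local_data x =
    ({(M, g, h). M \<in> F \<and> g \<in> near_words \<and> h \<in> near_words \<and> valid M (x \<cdot> g) (x \<cdot> h)},
     {(g, h). g \<in> near_words \<and> h \<in> near_words \<and> x \<cdot> g = x \<cdot> h},
     {(h, k). h \<in> near_words \<and> k = int (lev (x \<cdot> h)) - int (lev x)})"

lemma finite_local_data: "finite (local_data ` verts)"
proof (rule finite_subset)
  let ?K = "{- int (Suc (6 * width))..int (Suc (6 * width))}"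
  have "\<bar>int (lev (x \<cdot> h)) - int (lev x)\<bar> \<le> int (Suc (6 * width))" if "x \<in> verts" "h \<in> near_words" for x h
    using lev_go_le[of x h] lev_le_go[of x h] that by (auto simp: near_words_def)
  then show "local_data ` verts \<subseteq> Pow (F \<times> near_words \<times> near_words) \<times> Pow (near_words \<times> near_words) \<times> Pow (near_words \<times> ?K)"
    unfolding local_data_def by (fastforce simp: abs_le_iff)
  have "finite F" using splitting by (simp add: splitting_family_def)
  then show "finite (Pow (F \<times> near_words \<times> near_words) \<times> Pow (near_words \<times> near_words) \<times> Pow (near_words \<times> ?K))"
    by (simp add: finite_near_words)
qed

lemma local_dataD:
  assumes "local_data x = local_data y"
  shows "M \<in> F \<Longrightarrow> g \<in> near_words \<Longrightarrow> h \<in> near_words \<Longrightarrow> valid M (x \<cdot> g) (x \<cdot> h) \<longleftrightarrow> valid M (y \<cdot> g) (y \<cdot> h)"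
    and "g \<in> near_words \<Longrightarrow> h \<in> near_words \<Longrightarrow> x \<cdot> g = x \<cdot> h \<longleftrightarrow> y \<cdot> g = y \<cdot> h"
    and "h \<in> near_words \<Longrightarrow> int (lev (x \<cdot> h)) - int (lev x) = int (lev (y \<cdot> h)) - int (lev y)"
proof -
  from assms have
    e: "{(M, g, h). M \<in> F \<and> g \<in> near_words \<and> h \<in> near_words \<and> valid M (x \<cdot> g) (x \<cdot> h)} =
        {(M, g, h). M \<in> F \<and> g \<in> near_words \<and> h \<in> near_words \<and> valid M (y \<cdot> g) (y \<cdot> h)}"
       "{(g, h). g \<in> near_words \<and> h \<in> near_words \<and> x \<cdot> g = x \<cdot> h} = {(g, h). g \<in> near_words \<and> h \<in> near_words \<and> y \<cdot> g = y \<cdot> h}"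
       "{(h, k). h \<in> near_words \<and> k = int (lev (x \<cdot> h)) - int (lev x)} =
        {(h, k). h \<in> near_words \<and> k = int (lev (y \<cdot> h)) - int (lev y)}"
    unfolding local_data_def by (simp_all only: prod.inject)
  show "M \<in> F \<Longrightarrow> g \<in> near_words \<Longrightarrow> h \<in> near_words \<Longrightarrow> valid M (x \<cdot> g) (x \<cdot> h) \<longleftrightarrow> valid M (y \<cdot> g) (y \<cdot> h)"
    using eqset_imp_iff[OF e(1), of "(M, g, h)"] by simp
  show "g \<in> near_words \<Longrightarrow> h \<in> near_words \<Longrightarrow> x \<cdot> g = x \<cdot> h \<longleftrightarrow> y \<cdot> g = y \<cdot> h"
    using eqset_imp_iff[OF e(2), of "(g, h)"] by simp
  show "h \<in> near_words \<Longrightarrow> int (lev (x \<cdot> h)) - int (lev x) = int (lev (y \<cdot> h)) - int (lev y)"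
    using eqset_imp_iff[OF e(3), of "(h, int (lev (x \<cdot> h)) - int (lev x))"] by simp
qed

lemma chain_transfer:
  assumes eq: "local_data x = local_data y"
    and "chain (near (6 * width) x) z w z'" "h \<in> near_words" "x \<cdot> h = z" "h' \<in> near_words" "x \<cdot> h' = z'"
  shows "y \<cdot> h \<cdot> w = y \<cdot> h'"
  using assms(2-)
proof (induction arbitrary: h rule: chain.induct)
  case (chain_Nil z)
  then show ?case using local_dataD(2)[OF eq, of h h'] by simp
next
  case (chain_step z M z1 u v z')
  obtain h1 where h1: "h1 \<in> near_words" "x \<cdot> h1 = z1"
    using near_by_short_word chain_ends(1)[OF chain_step.hyps(5)] by blast
  then have "valid M (y \<cdot> h) (y \<cdot> h1)"
    using local_dataD(1)[OF eq chain_step.hyps(2), of h h1] chain_step by simp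
  then have "y \<cdot> h \<cdot> u = y \<cdot> h1" using chain_step.hyps(4) by (auto simp: valid_def)
  moreover have "y \<cdot> h1 \<cdot> v = y \<cdot> h'" using chain_step.IH h1 chain_step.prems by simp
  ultimately show ?case by simp
qed

text \<open>
  Returning to the starting level happens in the same way for vertices with equal data.
\<close>

lemma loop_transfer:
  assumes eq: "local_data x = local_data y" and x: "x \<in> verts"
    and w: "high (lev x) x w" "lev (x \<cdot> w) = lev x"
  obtains h where "h \<in> near_words" "length h \<le> 6 * width" "x \<cdot> w = x \<cdot> h" "y \<cdot> w = y \<cdot> h"
proof -
  note c = loop_chain[OF x w]
  obtain h where h: "h \<in> near_words" "length h \<le> 6 * width" "x \<cdot> h = x \<cdot> w"
    using near_by_short_word chain_ends(2)[OF c] by blast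
  moreover have "y \<cdot> [] \<cdot> w = y \<cdot> h"
    by (rule chain_transfer[OF eq c]) (use h in \<open>auto simp: near_words_def\<close>)
  ultimately show thesis by (intro that) simp_all
qed

text \<open>
  Every vertex of a cone descends within the cone to the bottom level along a geodesic, so that
  statements about arbitrary words reduce to returning ones.
\<close>

lemma return_to_level:
  assumes x: "x \<in> verts" and w: "high (lev x) x w"
  obtains q where "set q \<subseteq> A" "high (lev x) x (w @ retrace q)" "lev (x \<cdot> (w @ retrace q)) = lev x"
    "length q = lev (x \<cdot> w) - lev x"
proof -
  have "x \<cdot> w \<in> verts" using go_verts[OF x high_letters[OF w]] .
  then obtain z q where q: "z \<in> verts" "lev z = lev x" "length q = lev (x \<cdot> w) - lev x"
      "z \<cdot> q = x \<cdot> w" "high (lev x) z q"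
    using descend[of "x \<cdot> w" "lev x"] high_ends(2)[OF w] by metis
  have qA: "set q \<subseteq> A" using q(5) by (rule high_letters)
  have "high (lev x) (x \<cdot> w) (retrace q)" using high_back[OF q(5)] q(4) by simp
  then have "high (lev x) x (w @ retrace q)" using w by (simp add: high_append)
  moreover have "x \<cdot> (w @ retrace q) = z" using q(4) go_back[OF qA, of z] by simp
  ultimately show thesis using that qA q(2,3) by simp
qed

lemma lev_transfer_le:
  assumes eq: "local_data x = local_data y" and xy: "x \<in> verts" "y \<in> verts"
    and w: "high (lev x) x w"
  shows "lev (y \<cdot> w) + lev x \<le> lev (x \<cdot> w) + lev y"
proof -
  obtain q where q: "set q \<subseteq> A" "high (lev x) x (w @ retrace q)" "lev (x \<cdot> (w @ retrace q)) = lev x"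
    "length q = lev (x \<cdot> w) - lev x" by (rule return_to_level[OF xy(1) w])
  obtain h where h: "h \<in> near_words" "x \<cdot> (w @ retrace q) = x \<cdot> h" "y \<cdot> (w @ retrace q) = y \<cdot> h"
    by (rule loop_transfer[OF eq xy(1) q(2,3)])
  have "lev (y \<cdot> h) = lev y"
    using local_dataD(3)[OF eq h(1)] q(3) h(2) by simp
  moreover have "y \<cdot> h \<cdot> q = y \<cdot> w" using h(3) back_go[OF q(1), of "y \<cdot> w"] by simp
  moreover have "y \<cdot> h \<in> verts" using go_verts[OF xy(2)] h(1) by (simp add: near_words_def)
  ultimately have "lev (y \<cdot> w) \<le> lev y + length q"
    using lev_go_le[of "y \<cdot> h" q] q(1) by simp
  then show ?thesis using q(4) high_ends(2)[OF w] by simp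
qed

lemma high_transfer:
  assumes eq: "local_data x = local_data y" and xy: "x \<in> verts" "y \<in> verts"
    and w: "high (lev x) x w"
  shows "high (lev y) y w"
  using w
proof (induction w rule: rev_induct)
  case Nil
  then show ?case by simp
next
  case (snoc s w)
  then have x: "high (lev x) x w" "s \<in> A" "lev x \<le> lev (x \<cdot> (w @ [s]))"
    by (auto simp: high_append)
  then have y: "high (lev y) y w" using snoc.IH by blast
  have l: "lev (y \<cdot> w) + lev x = lev (x \<cdot> w) + lev y"
    using lev_transfer_le[OF eq xy x(1)] lev_transfer_le[OF eq[symmetric] xy(2,1) y] by simp
  have "lev y \<le> lev (y \<cdot> (w @ [s]))"
  proof (cases "lev (x \<cdot> w) = lev x")
    case True
    obtain h where h: "h \<in> near_words" "length h \<le> 6 * width" "x \<cdot> w = x \<cdot> h" "y \<cdot> w = y \<cdot> h"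
      by (rule loop_transfer[OF eq xy(1) x(1) True])
    then have "h @ [s] \<in> near_words" using x(2) by (simp add: near_words_def)
    from local_dataD(3)[OF eq this] show ?thesis using h x(3) by simp
  next
    case False
    then have "lev y < lev (y \<cdot> w)" using l high_ends(2)[OF x(1)] by simp
    moreover have "lev (y \<cdot> w) \<le> lev (y \<cdot> w \<cdot> [s]) + 1"
      using lev_le_go[of "y \<cdot> w" "[s]"] go_verts[OF xy(2) high_letters[OF y]] x(2) by simp
    ultimately show ?thesis by simp
  qed
  then show ?case using y x(2) by (simp add: high_append high_ends)
qed

lemma go_eq_transfer:
  assumes eq: "local_data x = local_data y" and xy: "x \<in> verts" "y \<in> verts"
    and u: "high (lev x) x u" and v: "high (lev x) x v" and "x \<cdot> u = x \<cdot> v"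
  shows "y \<cdot> u = y \<cdot> v"
proof -
  obtain q where q: "set q \<subseteq> A" "high (lev x) x (u @ retrace q)" "lev (x \<cdot> (u @ retrace q)) = lev x"
    "length q = lev (x \<cdot> u) - lev x" by (rule return_to_level[OF xy(1) u])
  have v': "high (lev x) x (v @ retrace q)" "lev (x \<cdot> (v @ retrace q)) = lev x"
    using q(2,3) v assms(6) by (simp_all add: high_append)
  obtain h where h: "h \<in> near_words" "x \<cdot> (u @ retrace q) = x \<cdot> h" "y \<cdot> (u @ retrace q) = y \<cdot> h"
    by (rule loop_transfer[OF eq xy(1) q(2,3)])
  obtain h' where h': "h' \<in> near_words" "x \<cdot> (v @ retrace q) = x \<cdot> h'" "y \<cdot> (v @ retrace q) = y \<cdot> h'"
    by (rule loop_transfer[OF eq xy(1) v'])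
  have "y \<cdot> h = y \<cdot> h'"
    using local_dataD(2)[OF eq h(1) h'(1)] h(2) h'(2) assms(6) by simp
  then have "y \<cdot> u \<cdot> retrace q = y \<cdot> v \<cdot> retrace q" using h(3) h'(3) by simp
  then show ?thesis using go_cancel[OF back_in[OF q(1)]] by blast
qed

lemma local_data_cone_iso:
  assumes eq: "local_data x = local_data y" and xy: "x \<in> verts" "y \<in> verts"
  shows "x \<sim> y"
proof -
  note eq' = eq[symmetric] and yx = xy(2,1)
  have high: "high (lev x) x w \<longleftrightarrow> high (lev y) y w" for w
    using high_transfer[OF eq xy] high_transfer[OF eq' yx] by blast
  moreover have "lev (x \<cdot> w) + lev y = lev (y \<cdot> w) + lev x" if "high (lev x) x w" for w
    using lev_transfer_le[OF eq xy that] lev_transfer_le[OF eq' yx] that high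
    by (metis le_antisym)
  moreover have "x \<cdot> u = x \<cdot> v \<longleftrightarrow> y \<cdot> u = y \<cdot> v" if "high (lev x) x u" "high (lev x) x v" for u v
    using go_eq_transfer[OF eq xy that] go_eq_transfer[OF eq' yx] that high by blast
  ultimately show ?thesis unfolding cone_iso_def using xy by blast
qed

theorem finitely_many_cone_types:
  "\<exists>rep. finite (rep ` verts) \<and> (\<forall>x\<in>verts. rep x \<sim> x)"
proof -
  define pick where "pick d = (SOME x. x \<in> verts \<and> local_data x = d)" for d
  define rep where "rep x = pick (local_data x)" for x
  have rep: "rep x \<in> verts \<and> local_data (rep x) = local_data x" if "x \<in> verts" for x
    unfolding rep_def pick_def by (rule someI[of _ x]) (simp add: that)
  have "rep ` verts = pick ` (local_data ` verts)" by (auto simp: rep_def)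
  then have "finite (rep ` verts)" using finite_local_data by simp
  moreover have "rep x \<sim> x" if "x \<in> verts" for x
    using rep[OF that] that by (intro local_data_cone_iso) auto
  ultimately show ?thesis by blast
qed

end

section \<open>Finite addresses for the vertices of a graph with finitely many cone types\<close>

text \<open>
  The words \<open>U\<close> and \<open>V\<close> have the same continuations to codewords, and \<open>f\<close> is the replacement of
  \<open>U\<close> by \<open>V\<close>. Equality of the continuations will allow bits without information to be dropped
  consistently.
\<close>

definition replaces_in_code ::
    "('x \<Rightarrow> 'l list) \<Rightarrow> 'x set \<Rightarrow> ('x \<Rightarrow> 'x) \<Rightarrow> 'l list \<Rightarrow> 'l list \<Rightarrow> bool" where
  "replaces_in_code code S f U V \<longleftrightarrow>
     (\<forall>\<beta>. U @ \<beta> \<in> code ` S \<longleftrightarrow> V @ \<beta> \<in> code ` S) \<and>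
     (\<forall>z\<in>S. \<forall>\<beta>. code z = U @ \<beta> \<longrightarrow> code (f z) = V @ \<beta>)"

locale finite_cone_types = symmetric_action A bar act base
  for A :: "'s set" and bar and act :: "'s \<Rightarrow> 'x \<Rightarrow> 'x" and base +
  fixes rep :: "'x \<Rightarrow> 'x"
  assumes finite_rep: "finite (rep ` verts)"
    and rep: "\<And>x. x \<in> verts \<Longrightarrow> rep x \<sim> x"
begin

lemma iso_verts: "x \<sim> y \<Longrightarrow> x \<in> verts" "x \<sim> y \<Longrightarrow> y \<in> verts"
  by (simp_all add: cone_iso_def)

lemma iso_high: "x \<sim> y \<Longrightarrow> high (lev x) x w \<longleftrightarrow> high (lev y) y w"
  by (simp add: cone_iso_def)

lemma iso_lev: "x \<sim> y \<Longrightarrow> high (lev x) x w \<Longrightarrow> lev (x \<cdot> w) + lev y = lev (y \<cdot> w) + lev x"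
  by (simp add: cone_iso_def)

lemma iso_eq:
  "x \<sim> y \<Longrightarrow> high (lev x) x u \<Longrightarrow> high (lev x) x v \<Longrightarrow> x \<cdot> u = x \<cdot> v \<longleftrightarrow> y \<cdot> u = y \<cdot> v"
  by (simp add: cone_iso_def)

lemma iso_refl: "x \<in> verts \<Longrightarrow> x \<sim> x"
  by (simp add: cone_iso_def)

lemma iso_sym: "x \<sim> y \<Longrightarrow> y \<sim> x"
  unfolding cone_iso_def by metis

lemma iso_trans: "x \<sim> y \<Longrightarrow> y \<sim> z \<Longrightarrow> x \<sim> z"
proof -
  assume xy: "x \<sim> y" and yz: "y \<sim> z"
  have "lev (x \<cdot> w) + lev z = lev (z \<cdot> w) + lev x" if "high (lev x) x w" for w
    using iso_lev[OF xy that] iso_lev[OF yz] iso_high[OF xy] that by (smt (verit) add.assoc add.commute add_right_cancel)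
  then show "x \<sim> z"
    using iso_verts[OF xy] iso_verts[OF yz] iso_high[OF xy] iso_high[OF yz] iso_eq[OF xy] iso_eq[OF yz]
    unfolding cone_iso_def by metis
qed

text \<open>
  An isomorphism of cones restricts to the smaller cones inside.
\<close>

lemma iso_shift:
  assumes iso: "x \<sim> y" and w: "high (lev x) x w"
  shows "x \<cdot> w \<sim> y \<cdot> w"
proof -
  have w': "high (lev y) y w" using iso_high[OF iso] w by simp
  have l: "lev (x \<cdot> w) + lev y = lev (y \<cdot> w) + lev x" by (rule iso_lev[OF iso w])
  have ext: "high (lev x) x (w @ v)" if "high (lev (x \<cdot> w)) (x \<cdot> w) v" for v
    using w high_mono[OF that high_ends(2)[OF w]] by (simp add: high_append)
  have lv: "lev (x \<cdot> w \<cdot> v) + lev (y \<cdot> w) = lev (y \<cdot> w \<cdot> v) + lev (x \<cdot> w)"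
    if "high (lev (x \<cdot> w)) (x \<cdot> w) v" for v
    using iso_lev[OF iso ext[OF that]] l by simp
  have one: "high (lev (y \<cdot> w)) (y \<cdot> w) v"
    if "x \<sim> y" "high (lev x) x w" "high (lev (x \<cdot> w)) (x \<cdot> w) v" for x y v
    using that(3)
  proof (induction v rule: rev_induct)
    case Nil
    then show ?case by simp
  next
    case (snoc s v)
    have "high (lev x) x (w @ v @ [s])"
      using that(2) high_mono[OF snoc.prems high_ends(2)[OF that(2)]] by (simp add: high_append)
    from iso_lev[OF that(1) this] iso_lev[OF that(1,2)]
    have "lev (y \<cdot> w) \<le> lev (y \<cdot> w \<cdot> (v @ [s]))" using high_ends(2)[OF snoc.prems] by simp
    then show ?case using snoc by (simp add: high_append high_ends)
  qed
  have "high (lev (x \<cdot> w)) (x \<cdot> w) v \<longleftrightarrow> high (lev (y \<cdot> w)) (y \<cdot> w) v" for v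
    using one[OF iso w] one[OF iso_sym[OF iso] w'] by blast
  moreover have "x \<cdot> w \<cdot> u = x \<cdot> w \<cdot> v \<longleftrightarrow> y \<cdot> w \<cdot> u = y \<cdot> w \<cdot> v"
    if "high (lev (x \<cdot> w)) (x \<cdot> w) u" "high (lev (x \<cdot> w)) (x \<cdot> w) v" for u v
    using iso_eq[OF iso ext[OF that(1)] ext[OF that(2)]] by simp
  moreover have "x \<cdot> w \<in> verts" "y \<cdot> w \<in> verts"
    using go_verts iso_verts[OF iso] high_letters[OF w] by blast+
  ultimately show ?thesis unfolding cone_iso_def using lv by blast
qed

definition conn :: "nat \<Rightarrow> 'x \<Rightarrow> 'x \<Rightarrow> bool" where
  "conn k x y \<longleftrightarrow> (\<exists>u. high k x u \<and> x \<cdot> u = y)"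

lemma conn_sym: "conn k x y \<Longrightarrow> conn k y x"
proof -
  assume "conn k x y"
  then obtain u where u: "high k x u" "x \<cdot> u = y" unfolding conn_def by blast
  have "high k y (retrace u)" using high_back[OF u(1)] u(2) by simp
  moreover have "y \<cdot> retrace u = x" using go_back[OF high_letters[OF u(1)], of x] u(2) by simp
  ultimately show "conn k y x" unfolding conn_def by blast
qed

lemma conn_trans: "conn k x y \<Longrightarrow> conn k y z \<Longrightarrow> conn k x z"
proof -
  assume "conn k x y" "conn k y z"
  then obtain u v where "high k x u" "x \<cdot> u = y" "high k y v" "y \<cdot> v = z" unfolding conn_def by blast
  then have "high k x (u @ v)" "x \<cdot> (u @ v) = z" by (simp_all add: high_append)
  then show "conn k x z" unfolding conn_def by blast
qed

lemma conn_mono: "conn k x y \<Longrightarrow> j \<le> k \<Longrightarrow> conn j x y"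
  unfolding conn_def using high_mono by blast

text \<open>
  A canonical bottom vertex of the connected component of \<open>y\<close> in the part of the graph at level
  \<open>k\<close> and above. It depends only on the component.
\<close>

definition root :: "nat \<Rightarrow> 'x \<Rightarrow> 'x" where
  "root k y = (SOME b. b \<in> verts \<and> lev b = k \<and> conn k b y)"

lemma root: 
  assumes "y \<in> verts" "k \<le> lev y"
  shows "root k y \<in> verts" "lev (root k y) = k" "conn k (root k y) y"
proof -
  obtain z q where "z \<in> verts" "lev z = k" "z \<cdot> q = y" "high k z q"
    using descend[OF assms] by metis
  then have "\<exists>b. b \<in> verts \<and> lev b = k \<and> conn k b y" unfolding conn_def by blast
  then have "root k y \<in> verts \<and> lev (root k y) = k \<and> conn k (root k y) y"
    unfolding root_def by (rule someI_ex)
  then show "root k y \<in> verts" "lev (root k y) = k" "conn k (root k y) y" by auto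
qed

lemma root_cong:
  assumes "conn k y z"
  shows "root k y = root k z"
proof -
  have "conn k b y \<longleftrightarrow> conn k b z" for b
    using assms conn_sym conn_trans by blast
  then show ?thesis unfolding root_def by simp
qed

text \<open>
  The components of the cone above \<open>r\<close> with its bottom level removed, named by their roots.
\<close>

definition child :: "'x \<Rightarrow> 'x \<Rightarrow> bool" where
  "child r b \<longleftrightarrow> (\<exists>y. conn (lev r) r y \<and> y \<in> verts \<and> lev r < lev y \<and> b = root (Suc (lev r)) y)"

lemma child:
  assumes "child r b"
  shows "b \<in> verts" "lev b = Suc (lev r)" "conn (lev r) r b"
    "conn (Suc (lev r)) b z \<Longrightarrow> b = root (Suc (lev r)) z"
proof -
  from assms obtain y where y: "conn (lev r) r y" "y \<in> verts" "lev r < lev y" "b = root (Suc (lev r)) y"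
    unfolding child_def by blast
  from y(3) have le: "Suc (lev r) \<le> lev y" by simp
  note b = root[OF y(2) le, folded y(4)]
  show "b \<in> verts" "lev b = Suc (lev r)" using b by auto
  have "conn (lev r) b y" using b(3) by (rule conn_mono) simp
  then show "conn (lev r) r b" using y(1) conn_sym conn_trans by blast
  show "b = root (Suc (lev r)) z" if "conn (Suc (lev r)) b z"
    using root_cong[OF conn_trans[OF conn_sym[OF that] b(3)]] y(4) by simp
qed

text \<open>
  A stack describes a descending sequence of cones, the innermost first. In \<open>stack \<beta> r t\<close> the vertex
  \<open>t\<close> anchors the innermost cone, and \<open>r\<close> is the representative of its type, through which the cone is
  identified with the one above \<open>t\<close>. A letter consists of the type of the parent cone and of a child
  of the representative of that type. Building each identification from the preceding ones makes
  them coherent. At the root \<open>base\<close> stands for itself.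
\<close>

inductive stack :: "('x \<times> 'x) list \<Rightarrow> 'x \<Rightarrow> 'x \<Rightarrow> bool" where
  stack_Nil: "stack [] base base"
| stack_Cons: "stack \<beta> r t \<Longrightarrow> child r b \<Longrightarrow> high (lev r) r w \<Longrightarrow> r \<cdot> w = b \<Longrightarrow>
    stack ((r, b) # \<beta>) (rep b) (t \<cdot> w)"

lemma stack_iso: "stack \<beta> r t \<Longrightarrow> r \<sim> t"
proof (induction rule: stack.induct)
  case stack_Nil
  show ?case by (rule iso_refl[OF base_verts])
next
  case (stack_Cons \<beta> r t b w)
  then show ?case using iso_trans[OF rep[OF child(1)] iso_shift[of r t w]] by blast
qed

lemma stack_unique: "stack \<beta> r t \<Longrightarrow> stack \<beta> r' t' \<Longrightarrow> r = r' \<and> t = t'"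
proof (induction arbitrary: r' t' rule: stack.induct)
  case stack_Nil
  then show ?case by (auto elim: stack.cases)
next
  case (stack_Cons \<beta> r t b w)
  from stack_Cons.prems obtain t0 w' where "stack \<beta> r t0" "r \<cdot> w' = b" "high (lev r) r w'"
      "r' = rep b" "t' = t0 \<cdot> w'"
    by (auto elim: stack.cases)
  moreover from this(1) have "t0 = t" using stack_Cons.IH by blast
  ultimately show ?case
    using stack_Cons iso_eq[OF stack_iso[OF stack_Cons.hyps(1)]] by metis
qed

lemma stack_lev: "stack \<beta> r t \<Longrightarrow> lev t = length \<beta>"
proof (induction rule: stack.induct)
  case stack_Nil
  show ?case by (simp add: lev_base)
next
  case (stack_Cons \<beta> r t b w)
  then show ?case
    using iso_lev[OF stack_iso[OF stack_Cons.hyps(1)], of w] child(2)[OF stack_Cons.hyps(2)] by simp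
qed

lemma stack_type: "stack \<beta> r t \<Longrightarrow> r \<in> insert base (rep ` verts)"
  by (induction rule: stack.induct) (auto dest: child(1))

text \<open>
  The sequence of cones around a vertex is determined by the vertex and its length: at each level the
  child is the root of the component in which the transported vertex lies.
\<close>

lemma stack_determined:
  assumes "stack \<beta> r t" "stack \<beta>' r' t'" "length \<beta> = length \<beta>'"
    "conn (lev t) t y" "conn (lev t') t' y"
  shows "\<beta> = \<beta>'"
  using assms
proof (induction arbitrary: \<beta>' r' t' rule: stack.induct)
  case stack_Nil
  then show ?case by simp
next
  case (stack_Cons \<beta> r t b w)
  from stack_Cons.prems(1,2) obtain \<beta>0 r0 t0 b' w' where s: "\<beta>' = (r0, b') # \<beta>0" "t' = t0 \<cdot> w'"
      "stack \<beta>0 r0 t0" "child r0 b'" "high (lev r0) r0 w'" "r0 \<cdot> w' = b'"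
    by (cases rule: stack.cases) auto
  have below: "conn (lev t) t y"
    if "r \<sim> t" "high (lev r) r w" "conn (lev (t \<cdot> w)) (t \<cdot> w) y" for r t w
  proof -
    have w: "high (lev t) t w" using that iso_high by blast
    then have "conn (lev t) t (t \<cdot> w)" unfolding conn_def by blast
    then show ?thesis using conn_trans conn_mono[OF that(3) high_ends(2)[OF w]] by blast
  qed
  note iso = stack_iso[OF stack_Cons.hyps(1)]
  have "\<beta> = \<beta>0"
    using stack_Cons.IH[OF s(3)] stack_Cons.prems(2-4) s
      below[OF iso stack_Cons.hyps(3)] below[OF stack_iso[OF s(3)] s(5)] by simp
  with stack_unique[OF stack_Cons.hyps(1)] s(3) have rt: "r0 = r" "t0 = t" by auto
  have lift: "\<exists>v. high (lev r) r (w @ v) \<and> t \<cdot> (w @ v) = y \<and> conn (Suc (lev r)) b (r \<cdot> (w @ v))"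
    if h: "child r b" "high (lev r) r w" "r \<cdot> w = b" "conn (lev (t \<cdot> w)) (t \<cdot> w) y" for b w
  proof -
    obtain v where v: "high (lev (t \<cdot> w)) (t \<cdot> w) v" "t \<cdot> w \<cdot> v = y"
      using h(4) unfolding conn_def by blast
    then have v': "high (lev b) b v" using iso_high[OF iso_shift[OF iso h(2)]] h(3) by simp
    then have "high (lev r) b v" using child(2)[OF h(1)] by (auto elim: high_mono)
    then show ?thesis
      using h(2,3) v(2) v' child(2)[OF h(1)]
      by (intro exI[of _ v]) (auto simp: high_append conn_def)
  qed
  obtain v where v: "high (lev r) r (w @ v)" "t \<cdot> (w @ v) = y" "conn (Suc (lev r)) b (r \<cdot> (w @ v))"
    using lift[OF stack_Cons.hyps(2-4) stack_Cons.prems(3)] by blast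
  obtain v' where v': "high (lev r) r (w' @ v')" "t \<cdot> (w' @ v') = y"
      "conn (Suc (lev r)) b' (r \<cdot> (w' @ v'))"
    using lift[OF s(4-6)[unfolded rt]] stack_Cons.prems(4) s(2) rt by blast
  have "r \<cdot> (w @ v) = r \<cdot> (w' @ v')" using iso_eq[OF iso v(1) v'(1)] v(2) v'(2) by simp
  then have "b = b'"
    using child(4)[OF stack_Cons.hyps(2) v(3)] child(4)[OF s(4)[unfolded rt] v'(3)] by simp
  then show ?case using s(1) rt \<open>\<beta> = \<beta>0\<close> by simp
qed

lemma high_zero: "set w \<subseteq> A \<Longrightarrow> high 0 x w"
  by (induction w arbitrary: x) auto

lemma stack_exists:
  assumes "y \<in> verts" "k \<le> lev y"
  shows "\<exists>\<beta> r t. stack \<beta> r t \<and> length \<beta> = k \<and> conn (lev t) t y"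
  using assms(2)
proof (induction k)
  case 0
  obtain p where "set p \<subseteq> A" "base \<cdot> p = y" using geodesic[OF assms(1)] by metis
  then have "conn (lev base) base y" unfolding conn_def lev_base using high_zero by blast
  then show ?case using stack_Nil by force
next
  case (Suc k)
  then obtain \<beta> r t where s: "stack \<beta> r t" "length \<beta> = k" "conn (lev t) t y" by auto
  note iso = stack_iso[OF s(1)]
  obtain w where w: "high (lev t) t w" "t \<cdot> w = y" using s(3) unfolding conn_def by blast
  have rw: "high (lev r) r w" using w(1) iso_high[OF iso] by simp
  define z where "z = r \<cdot> w"
  have z: "z \<in> verts" using go_verts iso_verts(1)[OF iso] high_letters[OF rw] by (simp add: z_def)
  have lz: "lev r < lev z"
    using iso_lev[OF iso rw] w(2) stack_lev[OF s(1)] s(2) Suc.prems by (simp add: z_def)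
  then have le: "Suc (lev r) \<le> lev z" by simp
  define b where "b = root (Suc (lev r)) z"
  have "conn (lev r) r z" using rw unfolding conn_def z_def by blast
  then have b: "child r b" unfolding child_def using z lz b_def by blast
  obtain v where v: "high (Suc (lev r)) b v" "b \<cdot> v = z"
    using root(3)[OF z le] unfolding conn_def b_def by blast
  obtain u where u: "high (lev r) r u" "r \<cdot> u = b" using child(3)[OF b] unfolding conn_def by blast
  have uv: "high (lev r) r (u @ v)" "r \<cdot> (u @ v) = r \<cdot> w"
    using u v high_mono[OF v(1), of "lev r"] by (simp_all add: high_append z_def)
  have "t \<cdot> (u @ v) = t \<cdot> w" using iso_eq[OF iso uv(1) rw] uv(2) by simp
  moreover have "high (lev (t \<cdot> u)) (t \<cdot> u) v"
    using v(1) u(2) child(2)[OF b] iso_high[OF iso_shift[OF iso u(1)]] by simp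
  ultimately have "conn (lev (t \<cdot> u)) (t \<cdot> u) y" unfolding conn_def using w(2) by auto
  then show ?case using stack_Cons[OF s(1) b u] s(2) by force
qed

text \<open>
  The top letter gives the type of the innermost cone and the position of the vertex in its bottom
  level.
\<close>

definition address :: "'x \<Rightarrow> ('x \<times> 'x) list \<Rightarrow> bool" where
  "address y a \<longleftrightarrow> (\<exists>\<beta> r t w. stack \<beta> r t \<and> high (lev r) r w \<and> lev (r \<cdot> w) = lev r \<and>
     t \<cdot> w = y \<and> a = (r, r \<cdot> w) # \<beta>)"

lemma addressI:
  "stack \<beta> r t \<Longrightarrow> high (lev r) r w \<Longrightarrow> lev (r \<cdot> w) = lev r \<Longrightarrow> address (t \<cdot> w) ((r, r \<cdot> w) # \<beta>)"
  unfolding address_def by blast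

lemma address_exists:
  assumes "y \<in> verts"
  shows "\<exists>a. address y a"
proof -
  obtain \<beta> r t where s: "stack \<beta> r t" "length \<beta> = lev y" "conn (lev t) t y"
    using stack_exists[OF assms order.refl] by blast
  obtain w where w: "high (lev t) t w" "t \<cdot> w = y" using s(3) unfolding conn_def by blast
  have rw: "high (lev r) r w" using w(1) iso_high[OF stack_iso[OF s(1)]] by simp
  have "lev (r \<cdot> w) = lev r"
    using iso_lev[OF stack_iso[OF s(1)] rw] stack_lev[OF s(1)] s(2) w(2) by simp
  then show ?thesis using addressI[OF s(1) rw] w(2) by blast
qed

lemma address_verts: "address y a \<Longrightarrow> y \<in> verts"
proof -
  assume "address y a"
  then obtain \<beta> r t w where *: "stack \<beta> r t" "high (lev r) r w" "t \<cdot> w = y"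
    unfolding address_def by blast
  show "y \<in> verts"
    using go_verts[OF iso_verts(2)[OF stack_iso[OF *(1)]] high_letters[OF *(2)]] *(3) by simp
qed

lemma address_unique:
  assumes "address y a" "address y a'"
  shows "a = a'"
proof -
  from assms(1) obtain \<beta> r t w where 1: "stack \<beta> r t" "high (lev r) r w" "lev (r \<cdot> w) = lev r"
      "t \<cdot> w = y" "a = (r, r \<cdot> w) # \<beta>" unfolding address_def by blast
  from assms(2) obtain \<beta>' r' t' w' where 2: "stack \<beta>' r' t'" "high (lev r') r' w'"
      "lev (r' \<cdot> w') = lev r'" "t' \<cdot> w' = y" "a' = (r', r' \<cdot> w') # \<beta>'" unfolding address_def by blast
  have conn: "conn (lev t) t y \<and> length \<beta> = lev y"
    if "stack \<beta> r t" "high (lev r) r w" "lev (r \<cdot> w) = lev r" "t \<cdot> w = y" for \<beta> r t w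
    unfolding conn_def
    using that iso_high[OF stack_iso[OF that(1)]] iso_lev[OF stack_iso[OF that(1)] that(2)]
      stack_lev[OF that(1)] by auto
  have "\<beta> = \<beta>'"
    using stack_determined[OF 1(1) 2(1), of y] conn[OF 1(1-4)] conn[OF 2(1-4)] by simp
  moreover from this have "r = r'" "t = t'" using stack_unique 1(1) 2(1) by blast+
  moreover from this have "r \<cdot> w = r' \<cdot> w'"
    using iso_eq[OF stack_iso[OF 1(1)] 1(2)] 2(2) 1(4) 2(4) by simp
  ultimately show ?thesis using 1(5) 2(5) by simp
qed

lemma address_inj:
  assumes "address y a" "address y' a"
  shows "y = y'"
proof -
  from assms(1) obtain \<beta> r t w where 1: "stack \<beta> r t" "high (lev r) r w" "lev (r \<cdot> w) = lev r"
      "t \<cdot> w = y" "a = (r, r \<cdot> w) # \<beta>" unfolding address_def by blast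
  from assms(2) 1(5) obtain t' w' where 2: "stack \<beta> r t'" "high (lev r) r w'"
      "t' \<cdot> w' = y'" "r \<cdot> w = r \<cdot> w'" unfolding address_def by auto
  have "t = t'" using stack_unique[OF 1(1) 2(1)] by simp
  then show ?thesis using iso_eq[OF stack_iso[OF 1(1)] 1(2) 2(2)] 2(3,4) 1(4) by simp
qed

definition addr :: "'x \<Rightarrow> ('x \<times> 'x) list" where
  "addr y = (THE a. address y a)"

lemma addr_eq_iff: "y \<in> verts \<Longrightarrow> addr y = a \<longleftrightarrow> address y a"
proof -
  assume "y \<in> verts"
  then obtain a0 where a0: "address y a0" using address_exists by blast
  then have "addr y = a0"
    unfolding addr_def using address_unique by blast
  then show ?thesis using a0 address_unique by blast
qed

lemma inj_on_addr: "inj_on addr verts"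
proof (rule inj_onI)
  fix y z assume "y \<in> verts" "z \<in> verts" "addr y = addr z"
  then have "address y (addr z)" "address z (addr z)" using addr_eq_iff by auto
  then show "y = z" by (rule address_inj)
qed

lemma mem_addr_iff: "a \<in> addr ` verts \<longleftrightarrow> (\<exists>y. address y a)"
proof
  assume "a \<in> addr ` verts"
  then obtain y where "y \<in> verts" "addr y = a" by blast
  then show "\<exists>y. address y a" using addr_eq_iff by blast
next
  assume "\<exists>y. address y a"
  then obtain y where y: "address y a" by blast
  then have "addr y = a" using addr_eq_iff[OF address_verts[OF y]] by simp
  then show "a \<in> addr ` verts" using address_verts[OF y] by blast
qed

lemma mem_addr_top:
  assumes "high (lev r) r w" "lev (r \<cdot> w) = lev r"
  shows "(r, r \<cdot> w) # \<beta> \<in> addr ` verts \<longleftrightarrow> (\<exists>t. stack \<beta> r t)"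
proof
  assume "(r, r \<cdot> w) # \<beta> \<in> addr ` verts"
  then show "\<exists>t. stack \<beta> r t" unfolding mem_addr_iff address_def by blast
next
  assume "\<exists>t. stack \<beta> r t"
  then show "(r, r \<cdot> w) # \<beta> \<in> addr ` verts"
    unfolding mem_addr_iff using addressI[OF _ assms] by blast
qed

lemma stack_Cons_iff:
  assumes "child r b"
  shows "(\<exists>t. stack ((r, b) # \<beta>) (rep b) t) \<longleftrightarrow> (\<exists>t. stack \<beta> r t)"
proof
  assume "\<exists>t. stack \<beta> r t"
  moreover obtain u where "high (lev r) r u" "r \<cdot> u = b" using child(3)[OF assms] unfolding conn_def by blast
  ultimately show "\<exists>t. stack ((r, b) # \<beta>) (rep b) t" using stack_Cons assms by blast
qed (auto elim: stack.cases)

definition letters :: "('x \<times> 'x) set" where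
  "letters = insert base (rep ` verts) \<times>
     {y \<in> verts. lev y \<le> Suc (Max (lev ` insert base (rep ` verts)))}"

lemma finite_letters: "finite letters"
proof -
  let ?k = "Suc (Max (lev ` insert base (rep ` verts)))"
  have "{y \<in> verts. lev y \<le> ?k} \<subseteq> (\<lambda>w. base \<cdot> w) ` {w. set w \<subseteq> A \<and> length w \<le> ?k}"
  proof
    fix y assume "y \<in> {y \<in> verts. lev y \<le> ?k}"
    then show "y \<in> (\<lambda>w. base \<cdot> w) ` {w. set w \<subseteq> A \<and> length w \<le> ?k}"
      using geodesic[of y] by (metis (mono_tags, lifting) image_eqI mem_Collect_eq)
  qed
  then have "finite {y \<in> verts. lev y \<le> ?k}"
    by (rule finite_subset) (intro finite_imageI finite_lists_length_le finite_A)
  then show ?thesis unfolding letters_def using finite_rep by simp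
qed

lemma letterI:
  assumes "r \<in> insert base (rep ` verts)" "y \<in> verts" "lev y \<le> Suc (lev r)"
  shows "(r, y) \<in> letters"
proof -
  have "lev r \<le> Max (lev ` insert base (rep ` verts))"
    using assms(1) finite_rep by (intro Max_ge) auto
  then show ?thesis unfolding letters_def using assms by simp
qed

lemma stack_letters: "stack \<beta> r t \<Longrightarrow> set \<beta> \<subseteq> letters"
proof (induction rule: stack.induct)
  case (stack_Cons \<beta> r t b w)
  then show ?case
    using letterI[OF stack_type[OF stack_Cons.hyps(1)] child(1)[OF stack_Cons.hyps(2)]]
      child(2)[OF stack_Cons.hyps(2)] by simp
qed simp

lemma address_letters:
  assumes "address y a"
  shows "set a \<subseteq> letters"
proof -
  from assms obtain \<beta> r t w where 1: "stack \<beta> r t" "high (lev r) r w" "lev (r \<cdot> w) = lev r"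
      "a = (r, r \<cdot> w) # \<beta>" unfolding address_def by blast
  have "r \<cdot> w \<in> verts" using go_verts iso_verts(1)[OF stack_iso[OF 1(1)]] high_letters[OF 1(2)] by blast
  then have "(r, r \<cdot> w) \<in> letters" using letterI[OF stack_type[OF 1(1)]] 1(3) by simp
  then show ?thesis using stack_letters[OF 1(1)] 1(4) by simp
qed

lemma addr_letters: "addr ` verts \<subseteq> lists letters"
proof
  fix a assume "a \<in> addr ` verts"
  then obtain y where "address y a" using mem_addr_iff by blast
  then show "a \<in> lists letters" using address_letters by blast
qed

text \<open>
  Which words can stand below a top part depends only on the type \<open>r\<close> at which the top part ends.
\<close>

lemma replaces_in_codeI:
  assumes "\<And>\<beta>. U @ \<beta> \<in> addr ` verts \<longleftrightarrow> (\<exists>t. stack \<beta> r t)"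
    and "\<And>\<beta>. V @ \<beta> \<in> addr ` verts \<longleftrightarrow> (\<exists>t. stack \<beta> r t)"
    and "\<And>\<beta> t. stack \<beta> r t \<Longrightarrow> \<exists>y. address y (U @ \<beta>) \<and> address (act s y) (V @ \<beta>)"
  shows "replaces_in_code addr verts (act s) U V"
  unfolding replaces_in_code_def
proof (intro conjI allI ballI impI)
  show "U @ \<beta> \<in> addr ` verts \<longleftrightarrow> V @ \<beta> \<in> addr ` verts" for \<beta>
    using assms(1)[of \<beta>] assms(2)[of \<beta>] by blast
next
  fix z \<beta> assume z: "z \<in> verts" "addr z = U @ \<beta>"
  then have "U @ \<beta> \<in> addr ` verts" by (metis image_eqI)
  then obtain t where "stack \<beta> r t" using assms(1)[of \<beta>] by blast
  then obtain y where y: "address y (U @ \<beta>)" "address (act s y) (V @ \<beta>)"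
    using assms(3) by blast
  moreover have "address z (U @ \<beta>)" using z addr_eq_iff by simp
  ultimately have "y = z" using address_inj by blast
  then show "addr (act s z) = V @ \<beta>" using y(2) addr_eq_iff address_verts by blast
qed

text \<open>
  Three cases: the edge stays in the bottom level of the innermost cone, enters a child cone (a letter
  is pushed), or leaves the cone (a letter is popped; the new top letter is found in the parent cone).
\<close>

lemma act_replaces_prefix:
  assumes s: "s \<in> A" and y: "y \<in> verts"
  shows "\<exists>U V \<beta>. length U \<le> 2 \<and> addr y = U @ \<beta> \<and> replaces_in_code addr verts (act s) U V"
proof -
  obtain \<beta> r t w where a: "stack \<beta> r t" "high (lev r) r w" "lev (r \<cdot> w) = lev r"
      "t \<cdot> w = y" "address y ((r, r \<cdot> w) # \<beta>)"
    using address_exists[OF y] unfolding address_def by blast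
  define z where "z = act s (r \<cdot> w)"
  have r: "r \<in> verts" using iso_verts(1)[OF stack_iso[OF a(1)]] .
  have rw: "r \<cdot> w \<in> verts" using go_verts[OF r high_letters[OF a(2)]] .
  have z: "z \<in> verts" "lev z \<le> Suc (lev r)"
    using go_verts[OF rw, of "[s]"] lev_go_le[OF rw, of "[s]"] s a(3) by (simp_all add: z_def)
  consider "lev z = lev r" | "lev z = Suc (lev r)" | "lev z < lev r" using z(2) by linarith
  then show ?thesis
  proof cases
    case 1
    have ws: "high (lev r) r (w @ [s])" "r \<cdot> (w @ [s]) = z" "lev (r \<cdot> (w @ [s])) = lev r"
      using a(2,3) s 1 by (auto simp: high_append z_def)
    have "replaces_in_code addr verts (act s) [(r, r \<cdot> w)] [(r, z)]"
    proof (rule replaces_in_codeI[where r = r])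
      show "[(r, r \<cdot> w)] @ \<beta> \<in> addr ` verts \<longleftrightarrow> (\<exists>t. stack \<beta> r t)" for \<beta>
        using mem_addr_top[OF a(2,3)] by simp
      show "[(r, z)] @ \<beta> \<in> addr ` verts \<longleftrightarrow> (\<exists>t. stack \<beta> r t)" for \<beta>
        using mem_addr_top[OF ws(1,3)] ws(2) by simp
      show "\<exists>y. address y ([(r, r \<cdot> w)] @ \<beta>) \<and> address (act s y) ([(r, z)] @ \<beta>)"
        if "stack \<beta> r t" for \<beta> t
        using addressI[OF that a(2,3)] addressI[OF that ws(1,3)] ws(2) by auto
    qed
    then show ?thesis using a(5) addr_eq_iff[OF y]
      by (intro exI[of _ "[(r, r \<cdot> w)]"] exI[of _ "[(r, z)]"] exI[of _ \<beta>]) simp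
  next
    case 2
    define b where "b = root (Suc (lev r)) z"
    have "high (lev r) r (w @ [s])" using a(2,3) s 2 by (auto simp: high_append z_def)
    moreover have rws: "r \<cdot> (w @ [s]) = z" by (simp add: z_def)
    ultimately have "conn (lev r) r z" unfolding conn_def by blast
    then have b: "child r b" unfolding child_def b_def using z(1) 2 by auto
    obtain u where u: "high (lev r) r u" "r \<cdot> u = b" using child(3)[OF b] unfolding conn_def by blast
    obtain v where v: "high (lev b) b v" "b \<cdot> v = z"
      using root(3)[OF z(1), of "Suc (lev r)"] 2 child(2)[OF b] unfolding conn_def b_def by auto
    note iso = iso_sym[OF rep[OF child(1)[OF b]]]
    have v': "high (lev (rep b)) (rep b) v" "lev (rep b \<cdot> v) = lev (rep b)"
      using iso_high[OF iso] iso_lev[OF iso v(1)] v 2 child(2)[OF b] by simp_all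
    have "high (lev r) b v" using v(1) child(2)[OF b] by (auto elim: high_mono)
    then have uv: "high (lev r) r (u @ v)" "r \<cdot> (u @ v) = r \<cdot> (w @ [s])"
      using u v rws by (simp_all add: high_append)
    let ?V = "[(rep b, rep b \<cdot> v), (r, b)]"
    have "replaces_in_code addr verts (act s) [(r, r \<cdot> w)] ?V"
    proof (rule replaces_in_codeI[where r = r])
      show "[(r, r \<cdot> w)] @ \<beta> \<in> addr ` verts \<longleftrightarrow> (\<exists>t. stack \<beta> r t)" for \<beta>
        using mem_addr_top[OF a(2,3)] by simp
      show "?V @ \<beta> \<in> addr ` verts \<longleftrightarrow> (\<exists>t. stack \<beta> r t)" for \<beta>
        using mem_addr_top[OF v'] stack_Cons_iff[OF b] by simp
      show "\<exists>y. address y ([(r, r \<cdot> w)] @ \<beta>) \<and> address (act s y) (?V @ \<beta>)"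
        if t: "stack \<beta> r t" for \<beta> t
      proof -
        have "address (t \<cdot> u \<cdot> v) (?V @ \<beta>)"
          using addressI[OF stack_Cons[OF t b u] v'] by simp
        moreover have "t \<cdot> u \<cdot> v = act s (t \<cdot> w)"
          using iso_eq[OF stack_iso[OF t] uv(1) \<open>high (lev r) r (w @ [s])\<close>] uv(2) by simp
        ultimately show ?thesis using addressI[OF t a(2,3)] by auto
      qed
    qed
    then show ?thesis using a(5) addr_eq_iff[OF y]
      by (intro exI[of _ "[(r, r \<cdot> w)]"] exI[of _ ?V] exI[of _ \<beta>]) simp
  next
    case 3
    from a(1) obtain r1 b \<beta>1 where s1: "\<beta> = (r1, b) # \<beta>1" "r = rep b" "child r1 b"
    proof cases
      case stack_Nil
      then show ?thesis using 3 by (simp add: lev_base)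
    qed auto
    note iso = rep[OF child(1)[OF s1(3)], folded s1(2)]
    have bw: "high (lev b) b w" "lev (b \<cdot> w) = lev b"
      using iso_high[OF iso] iso_lev[OF iso a(2)] a(2,3) by simp_all
    have "\<not> high (lev r) r (w @ [s])" using 3 by (simp add: high_append z_def)
    then have "\<not> high (lev b) b (w @ [s])" using iso_high[OF iso] by simp
    then have "lev (b \<cdot> w \<cdot> [s]) < lev b"
      using bw s by (auto simp: high_append high_ends)
    moreover have "lev (b \<cdot> w) \<le> lev (b \<cdot> w \<cdot> [s]) + 1"
      using lev_le_go[OF go_verts[OF child(1)[OF s1(3)] high_letters[OF bw(1)]], of "[s]"] s by simp
    ultimately have l: "lev (b \<cdot> w \<cdot> [s]) = lev r1" using bw(2) child(2)[OF s1(3)] by simp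
    obtain u where u: "high (lev r1) r1 u" "r1 \<cdot> u = b" using child(3)[OF s1(3)] unfolding conn_def by blast
    have "high (lev r1) b w" using bw(1) child(2)[OF s1(3)] by (auto elim: high_mono)
    then have uws: "high (lev r1) r1 (u @ w @ [s])" "lev (r1 \<cdot> (u @ w @ [s])) = lev r1"
      using u s l child(2)[OF s1(3)] bw(2) by (simp_all add: high_append)
    let ?U = "[(r, r \<cdot> w), (r1, b)]" and ?V = "[(r1, r1 \<cdot> (u @ w @ [s]))]"
    have "replaces_in_code addr verts (act s) ?U ?V"
    proof (rule replaces_in_codeI[where r = r1])
      show "?U @ \<beta> \<in> addr ` verts \<longleftrightarrow> (\<exists>t. stack \<beta> r1 t)" for \<beta>
        using mem_addr_top[OF a(2,3)] stack_Cons_iff[OF s1(3)] s1(2) by simp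
      show "?V @ \<beta> \<in> addr ` verts \<longleftrightarrow> (\<exists>t. stack \<beta> r1 t)" for \<beta>
        using mem_addr_top[OF uws] by simp
      show "\<exists>y. address y (?U @ \<beta>) \<and> address (act s y) (?V @ \<beta>)"
        if t: "stack \<beta> r1 t" for \<beta> t
      proof -
        have "address (t \<cdot> u \<cdot> w) (?U @ \<beta>)"
          using addressI[OF stack_Cons[OF t s1(3) u, folded s1(2)] a(2,3)] by simp
        moreover have "address (act s (t \<cdot> u \<cdot> w)) (?V @ \<beta>)"
          using addressI[OF t uws] by simp
        ultimately show ?thesis by blast
      qed
    qed
    then show ?thesis using a(5) addr_eq_iff[OF y] s1(1)
      by (intro exI[of _ ?U] exI[of _ ?V] exI[of _ \<beta>1]) simp
  qed
qed

end

section \<open>From prefix replacement on a code to Thompson's group\<close>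

definition continuations :: "'l list set \<Rightarrow> 'l list \<Rightarrow> 'l list set" where
  "continuations R u = {w. u @ w \<in> R}"

lemma continuations_append: "continuations R (u @ v) = continuations (continuations R u) v"
  by (simp add: continuations_def)

text \<open>
  The word \<open>w\<close> is read as a path in the binary tree of prefixes of \<open>R\<close>; only the bits at branching
  nodes are kept.
\<close>

primrec squeeze :: "bool list \<Rightarrow> bool list set \<Rightarrow> bool list" where
  "squeeze [] R = []"
| "squeeze (b # w) R =
     (if continuations R [True] \<noteq> {} \<and> continuations R [False] \<noteq> {} then [b] else []) @
     squeeze w (continuations R [b])"

lemma squeeze_append: "squeeze (u @ v) R = squeeze u R @ squeeze v (continuations R u)"
proof (induction u arbitrary: R)
  case Nil
  then show ?case by (simp add: continuations_def)
next
  case (Cons b u)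
  then show ?case using continuations_append[of R "[b]" u] by simp
qed

lemma length_squeeze: "length (squeeze w R) \<le> length w"
proof (induction w arbitrary: R)
  case (Cons b w)
  from Cons[of "continuations R [b]"] show ?case by simp
qed simp

lemma squeeze_comparable:
  assumes "continuations R u \<noteq> {}" "continuations R v \<noteq> {}" "squeeze u R @- \<eta> = squeeze v R @- \<theta>"
  shows "\<exists>w. v = u @ w \<or> u = v @ w"
  using assms
proof (induction u arbitrary: v R)
  case Nil
  have "v = [] @ v" by simp
  then show ?case by blast
next
  case (Cons b u)
  show ?case
  proof (cases v)
    case Nil
    then show ?thesis by simp
  next
    case (Cons c v')
    have ne: "continuations (continuations R [b]) u \<noteq> {}" "continuations (continuations R [c]) v' \<noteq> {}"
      using Cons.prems(1,2) continuations_append[of R "[b]" u] continuations_append[of R "[c]" v'] Cons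
      by simp_all
    then have "continuations R [b] \<noteq> {}" "continuations R [c] \<noteq> {}"
      by (auto simp: continuations_def)
    then have "b = c"
      using Cons.prems(3) Cons by (cases b; cases c) auto
    moreover from this have "squeeze u (continuations R [b]) @- \<eta> = squeeze v' (continuations R [b]) @- \<theta>"
      using Cons.prems(3) Cons by (auto split: if_splits)
    ultimately show ?thesis using Cons.IH[OF ne(1)] ne(2) Cons by auto
  qed
qed

text \<open>
  Forced bits cost no letter of \<open>t\<close>, and following a given element of \<open>R\<close> through them ends after
  finitely many steps; at a branching node the letter of \<open>t\<close> is obeyed.
\<close>

lemma squeeze_dense:
  assumes "w0 \<in> R"
  shows "\<exists>w\<in>R. \<exists>r. squeeze w R @ r = t \<or> squeeze w R = t @ r"
  using assms
proof (induction t arbitrary: R w0)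
  case Nil
  then show ?case by auto
next
  case (Cons c t)
  from Cons.prems show ?case
  proof (induction w0 arbitrary: R)
    case Nil
    then have "[] \<in> R \<and> squeeze [] R @ (c # t) = c # t" by simp
    then show ?case by blast
  next
    case (Cons b w0)
    let ?branch = "continuations R [True] \<noteq> {} \<and> continuations R [False] \<noteq> {}"
    show ?case
    proof (cases ?branch)
      case True
      then obtain w1 where "w1 \<in> continuations R [c]" by (cases c) auto
      from \<open>\<And>R w0. w0 \<in> R \<Longrightarrow> \<exists>w\<in>R. \<exists>r. squeeze w R @ r = t \<or> squeeze w R = t @ r\<close>[OF this]
      obtain w r where "w \<in> continuations R [c]" "squeeze w (continuations R [c]) @ r = t \<or>
          squeeze w (continuations R [c]) = t @ r" by blast
      then have "c # w \<in> R \<and> (squeeze (c # w) R @ r = c # t \<or> squeeze (c # w) R = (c # t) @ r)"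
        using True by (auto simp: continuations_def)
      then show ?thesis by blast
    next
      case False
      have "w0 \<in> continuations R [b]" using Cons.prems by (simp add: continuations_def)
      from Cons.IH[OF this] obtain w r where "w \<in> continuations R [b]"
          "squeeze w (continuations R [b]) @ r = c # t \<or> squeeze w (continuations R [b]) = (c # t) @ r"
        by blast
      then have "b # w \<in> R \<and> (squeeze (b # w) R @ r = c # t \<or> squeeze (b # w) R = (c # t) @ r)"
        using False by (auto simp: continuations_def)
      then show ?thesis by blast
    qed
  qed
qed

text \<open>
  The codewords are not assumed dense in the Cantor set; squeezing makes them so.
\<close>

locale binary_code =
  fixes S :: "'x set" and code :: "'x \<Rightarrow> bool list"
  assumes nonempty: "S \<noteq> {}"
    and inj: "inj_on code S"
    and prefix_free: "\<And>u w. u \<in> code ` S \<Longrightarrow> u @ w \<in> code ` S \<Longrightarrow> w = []"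
begin

definition dense_code :: "'x \<Rightarrow> bool list" where
  "dense_code x = squeeze (code x) (code ` S)"

lemma dense_code_separates:
  assumes "x \<in> S" "y \<in> S" "dense_code x @- \<eta> = dense_code y @- \<theta>"
  shows "x = y"
proof -
  have "[] \<in> continuations (code ` S) (code z)" if "z \<in> S" for z
    using that by (simp add: continuations_def)
  then obtain w where "code y = code x @ w \<or> code x = code y @ w"
    using squeeze_comparable assms unfolding dense_code_def by (metis empty_iff)
  then have "code x = code y"
    using prefix_free assms(1,2) by (metis append_Nil2 image_eqI)
  then show ?thesis using inj assms(1,2) by (simp add: inj_on_eq_iff)
qed

lemma dense_code_dense:
  obtains x r where "x \<in> S" "dense_code x @ r = t \<or> dense_code x = t @ r"
proof -
  obtain x0 where "code x0 \<in> code ` S" using nonempty by blast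
  from squeeze_dense[OF this, of t] show thesis using that unfolding dense_code_def by blast
qed

definition represents :: "('x \<Rightarrow> 'x) \<Rightarrow> (bool stream \<Rightarrow> bool stream) \<Rightarrow> bool" where
  "represents f \<psi> \<longleftrightarrow> (\<exists>n. replaces_prefixes n \<psi>) \<and>
     (\<forall>x\<in>S. \<forall>\<eta>. \<psi> (dense_code x @- \<eta>) = dense_code (f x) @- \<eta>)"

text \<open>
  Density of the codes and continuity: two maps replacing prefixes that agree on the cones of the
  codes agree everywhere.
\<close>

lemma represents_unique:
  assumes "represents f \<phi>" "represents f \<psi>"
  shows "\<phi> = \<psi>"
proof
  fix \<xi> :: "bool stream"
  from assms obtain n m where "replaces_prefixes n \<phi>" "replaces_prefixes m \<psi>"
    unfolding represents_def by blast
  then have r: "replaces_prefixes (max n m) \<phi>" "replaces_prefixes (max n m) \<psi>"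
    by (auto elim: replaces_prefixes_mono)
  define \<alpha> where "\<alpha> = stake (max n m) \<xi>"
  have \<xi>: "\<xi> = \<alpha> @- sdrop (max n m) \<xi>" unfolding \<alpha>_def by (simp add: stake_sdrop)
  have len: "max n m \<le> length \<alpha>" by (simp add: \<alpha>_def)
  obtain \<beta> where \<beta>: "\<And>\<eta>. \<phi> (\<alpha> @- \<eta>) = \<beta> @- \<eta>" using replaces_prefixesE[OF r(1) len] by metis
  obtain \<gamma> where \<gamma>: "\<And>\<eta>. \<psi> (\<alpha> @- \<eta>) = \<gamma> @- \<eta>" using replaces_prefixesE[OF r(2) len] by metis
  have agree: "\<phi> (dense_code x @- \<eta>) = \<psi> (dense_code x @- \<eta>)" if "x \<in> S" for x \<eta>
    using assms that unfolding represents_def by simp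
  obtain x w where x: "x \<in> S" "dense_code x @ w = \<alpha> \<or> dense_code x = \<alpha> @ w"
    by (rule dense_code_dense)
  show "\<phi> \<xi> = \<psi> \<xi>"
  proof (cases "dense_code x @ w = \<alpha>")
    case True
    then have "\<xi> = dense_code x @- (w @- sdrop (max n m) \<xi>)" using \<xi> by (metis shift_append)
    then show ?thesis using agree[OF x(1)] by metis
  next
    case False
    then have "dense_code x = \<alpha> @ w" using x(2) by blast
    then have "(\<beta> @ w) @- \<eta> = (\<gamma> @ w) @- \<eta>" for \<eta>
      using agree[OF x(1), of \<eta>] \<beta> \<gamma> by simp
    then have "\<beta> @ w = \<gamma> @ w" by (rule shift_sconst_eqD)
    then show ?thesis using \<beta> \<gamma> \<xi> by (metis append_same_eq)
  qed
qed

lemma represents_id: "(\<And>x. x \<in> S \<Longrightarrow> f x = x) \<Longrightarrow> represents f id"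
  unfolding represents_def replaces_prefixes_def id_apply by simp blast

lemma represents_comp:
  assumes "represents f \<phi>" "represents g \<psi>" "\<And>x. x \<in> S \<Longrightarrow> f x \<in> S"
  shows "represents (g \<circ> f) (\<psi> \<circ> \<phi>)"
proof -
  from assms(1,2) obtain n m where "replaces_prefixes n \<phi>" "replaces_prefixes m \<psi>"
    unfolding represents_def by blast
  then have "replaces_prefixes (n + m) (\<psi> \<circ> \<phi>)" by (rule replaces_prefixes_comp)
  moreover have "(\<psi> \<circ> \<phi>) (dense_code x @- \<eta>) = dense_code ((g \<circ> f) x) @- \<eta>" if "x \<in> S" for x \<eta>
    using assms that unfolding represents_def by simp
  ultimately show ?thesis unfolding represents_def by blast
qed

lemma represents_cong: "represents f \<phi> \<Longrightarrow> (\<And>x. x \<in> S \<Longrightarrow> f x = g x) \<Longrightarrow> represents g \<phi>"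
  unfolding represents_def by simp

lemma represents_id_iff:
  assumes "represents f id" "x \<in> S" "f x \<in> S"
  shows "f x = x"
proof -
  have "dense_code (f x) @- \<eta> = dense_code x @- \<eta>" for \<eta>
    using assms(1,2) unfolding represents_def by simp
  then show ?thesis using dense_code_separates[OF assms(3,2)] by blast
qed

text \<open>
  By density, every word of length \<open>N\<close> begins with the squeezed form of a word \<open>U\<close> that \<open>f\<close>
  replaces by some \<open>V\<close>. Since \<open>U\<close> and \<open>V\<close> have the same continuations, the squeezed forms of \<open>U @ \<gamma>\<close>
  and \<open>V @ \<gamma>\<close> end in the same word.
\<close>

lemma representation_exists:
  assumes closed: "\<And>x. x \<in> S \<Longrightarrow> f x \<in> S"
    and rep: "\<And>x. x \<in> S \<Longrightarrow> \<exists>U V \<beta>. length U \<le> N \<and> code x = U @ \<beta> \<and> replaces_in_code code S f U V"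
  shows "\<exists>\<psi>. represents f \<psi>"
proof -
  let ?R = "code ` S"
  have "\<exists>U V r \<beta>. \<alpha> = squeeze U ?R @ r \<and> U @ \<beta> \<in> ?R \<and> replaces_in_code code S f U V"
    if "length \<alpha> = N" for \<alpha>
  proof -
    obtain x w where x: "x \<in> S" "dense_code x @ w = \<alpha> \<or> dense_code x = \<alpha> @ w"
      by (rule dense_code_dense)
    obtain U V \<beta> where U: "length U \<le> N" "code x = U @ \<beta>" "replaces_in_code code S f U V"
      using rep[OF x(1)] by blast
    have "dense_code x = squeeze U ?R @ squeeze \<beta> (continuations ?R U)"
      unfolding dense_code_def U(2) by (rule squeeze_append)
    moreover have "length (squeeze U ?R) \<le> length \<alpha>"
      using length_squeeze[of U ?R] U(1) that by simp
    ultimately have "\<exists>r. \<alpha> = squeeze U ?R @ r"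
      using x(2) by (auto simp: append_eq_append_conv2 append_eq_append_conv_if)
    moreover have "U @ \<beta> \<in> ?R" using x(1) U(2) by (metis image_eqI)
    ultimately show ?thesis using U(3) by blast
  qed
  then obtain U V r \<beta> where U: "\<And>\<alpha>. length \<alpha> = N \<Longrightarrow> \<alpha> = squeeze (U \<alpha>) ?R @ r \<alpha> \<and>
      U \<alpha> @ \<beta> \<alpha> \<in> ?R \<and> replaces_in_code code S f (U \<alpha>) (V \<alpha>)"
    by metis
  \<comment> \<open>On codewords the value does not depend on the choice of U and V, by the common continuations.\<close>
  define \<psi> where "\<psi> \<xi> = (squeeze (V (stake N \<xi>)) ?R @ r (stake N \<xi>)) @- sdrop N \<xi>" for \<xi>
  have "replaces_prefixes N \<psi>"
    unfolding replaces_prefixes_def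
  proof (intro allI impI)
    fix \<alpha> :: "bool list" assume "length \<alpha> = N"
    then have "\<psi> (\<alpha> @- \<eta>) = (squeeze (V \<alpha>) ?R @ r \<alpha>) @- \<eta>" for \<eta>
      unfolding \<psi>_def by (simp add: stake_shift sdrop_shift)
    then show "\<exists>\<beta>. \<forall>\<eta>. \<psi> (\<alpha> @- \<eta>) = \<beta> @- \<eta>" by blast
  qed
  moreover have "\<psi> (dense_code x @- \<eta>) = dense_code (f x) @- \<eta>" if x: "x \<in> S" for x \<eta>
  proof -
    define \<xi> \<alpha> where "\<xi> = dense_code x @- \<eta>" and "\<alpha> = stake N \<xi>"
    define \<theta> where "\<theta> = r \<alpha> @- sdrop N \<xi>"
    have "length \<alpha> = N" by (simp add: \<alpha>_def)
    note U = U[OF this]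
    have "\<xi> = \<alpha> @- sdrop N \<xi>" unfolding \<alpha>_def by (simp add: stake_sdrop)
    also have "\<dots> = squeeze (U \<alpha>) ?R @- \<theta>"
      using U unfolding \<theta>_def by (metis shift_append)
    finally have eq: "squeeze (code x) ?R @- \<eta> = squeeze (U \<alpha>) ?R @- \<theta>"
      unfolding \<xi>_def dense_code_def .
    have "\<beta> \<alpha> \<in> continuations ?R (U \<alpha>)" "[] \<in> continuations ?R (code x)"
      using U x by (simp_all add: continuations_def)
    then obtain w where w: "U \<alpha> = code x @ w \<or> code x = U \<alpha> @ w"
      using squeeze_comparable[OF _ _ eq] by blast
    have "\<exists>w. code x = U \<alpha> @ w"
    proof (cases "U \<alpha> = code x @ w")
      case True
      then have "code x @ w @ \<beta> \<alpha> \<in> ?R" using U by (metis append.assoc)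
      then have "w = []" using prefix_free[of "code x" "w @ \<beta> \<alpha>"] x by simp
      then show ?thesis using True by simp
    qed (use w in blast)
    then obtain \<gamma> where \<gamma>: "code x = U \<alpha> @ \<gamma>" ..
    have "replaces_in_code code S f (U \<alpha>) (V \<alpha>)" using U by blast
    then have f: "code (f x) = V \<alpha> @ \<gamma>" and cont: "continuations ?R (U \<alpha>) = continuations ?R (V \<alpha>)"
      using x \<gamma> unfolding replaces_in_code_def continuations_def by auto
    have "squeeze (U \<alpha>) ?R @- (squeeze \<gamma> (continuations ?R (U \<alpha>)) @- \<eta>) = squeeze (U \<alpha>) ?R @- \<theta>"
      using eq unfolding \<gamma> squeeze_append by simp
    then have \<theta>: "\<theta> = squeeze \<gamma> (continuations ?R (V \<alpha>)) @- \<eta>"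
      unfolding cont by (simp add: shift_left_inj)
    have "\<psi> \<xi> = squeeze (V \<alpha>) ?R @- \<theta>"
      unfolding \<psi>_def \<alpha>_def[symmetric] \<theta>_def by simp
    also have "\<dots> = dense_code (f x) @- \<eta>"
      unfolding \<theta> dense_code_def f squeeze_append by simp
    finally show ?thesis unfolding \<xi>_def .
  qed
  ultimately show ?thesis unfolding represents_def by blast
qed

end

text \<open>
  Products of representing maps represent products, so every group element is represented; the
  representative is bijective because that of the inverse is its inverse.
\<close>

lemma binary_code_action_hom:
  assumes "group G" and S: "binary_code S code" and sym: "symmetric_surjection G \<Sigma> bar \<rho>"
    and closed: "\<And>g x. g \<in> carrier G \<Longrightarrow> x \<in> S \<Longrightarrow> f g x \<in> S"
    and one: "\<And>x. x \<in> S \<Longrightarrow> f \<one>\<^bsub>G\<^esub> x = x"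
    and mult: "\<And>g h x. g \<in> carrier G \<Longrightarrow> h \<in> carrier G \<Longrightarrow> x \<in> S \<Longrightarrow> f (g \<otimes>\<^bsub>G\<^esub> h) x = f h (f g x)"
    and rep: "\<And>s x. s \<in> \<Sigma> \<Longrightarrow> x \<in> S \<Longrightarrow>
      \<exists>U V \<beta>. length U \<le> N \<and> code x = U @ \<beta> \<and> replaces_in_code code S (f (\<rho> [s])) U V"
  shows "\<exists>\<phi> \<in> hom G thompson_V. \<forall>g\<in>carrier G. \<phi> g = id \<longrightarrow> (\<forall>x\<in>S. f g x = x)"
proof -
  interpret group G by fact
  interpret binary_code S code by fact
  note \<rho>_closed = symmetric_surjection_closed[OF sym]
  have rmult: "represents (f (g \<otimes>\<^bsub>G\<^esub> h)) (\<psi> \<circ> \<phi>)"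
    if "g \<in> carrier G" "h \<in> carrier G" "represents (f g) \<phi>" "represents (f h) \<psi>" for g h \<phi> \<psi>
    using represents_cong[OF represents_comp[OF that(3,4)]] closed that(1,2) mult by simp
  have "\<exists>\<psi>. represents (f (\<rho> w)) \<psi>" if "w \<in> lists \<Sigma>" for w
    using that
  proof (induction w rule: rev_induct)
    case Nil
    have "\<rho> [] = \<one>\<^bsub>G\<^esub>" using sym by (simp add: symmetric_surjection_def)
    then show ?case using represents_id one by metis
  next
    case (snoc s w)
    then have *: "w \<in> lists \<Sigma>" "[s] \<in> lists \<Sigma>" "s \<in> \<Sigma>" by auto
    obtain \<phi> where "represents (f (\<rho> w)) \<phi>" using snoc.IH *(1) by blast
    moreover obtain \<psi> where "represents (f (\<rho> [s])) \<psi>"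
      using representation_exists[of "f (\<rho> [s])" N] closed[OF \<rho>_closed[OF *(2)]] rep[OF *(3)] by blast
    ultimately have "represents (f (\<rho> w \<otimes>\<^bsub>G\<^esub> \<rho> [s])) (\<psi> \<circ> \<phi>)"
      using rmult \<rho>_closed * by blast
    then show ?case using symmetric_surjection_append[OF sym *(1,2)] by auto
  qed
  then have "\<exists>\<psi>. represents (f g) \<psi>" if "g \<in> carrier G" for g
    using symmetric_surjectionE[OF sym that] by metis
  then obtain \<phi> where \<phi>: "\<And>g. g \<in> carrier G \<Longrightarrow> represents (f g) (\<phi> g)" by metis
  have \<phi>_mult: "\<phi> (g \<otimes>\<^bsub>G\<^esub> h) = \<phi> h \<circ> \<phi> g" if "g \<in> carrier G" "h \<in> carrier G" for g h
    using represents_unique[OF \<phi> rmult] that \<phi> by simp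
  have \<phi>_one: "\<phi> \<one>\<^bsub>G\<^esub> = id"
    using represents_unique[OF \<phi> represents_id] one by simp
  have "\<phi> g \<in> carrier thompson_V" if g: "g \<in> carrier G" for g
  proof -
    have "\<phi> g \<circ> \<phi> (inv\<^bsub>G\<^esub> g) = id" "\<phi> (inv\<^bsub>G\<^esub> g) \<circ> \<phi> g = id"
      using \<phi>_mult[of "inv\<^bsub>G\<^esub> g" g] \<phi>_mult[of g "inv\<^bsub>G\<^esub> g"] g \<phi>_one by simp_all
    then have "bij (\<phi> g)" by (metis o_bij)
    then show ?thesis using \<phi>[OF g] unfolding carrier_thompson_V_iff represents_def by blast
  qed
  then have "\<phi> \<in> hom G thompson_V" using \<phi>_mult by (simp add: hom_def)
  moreover have "f g x = x" if "g \<in> carrier G" "\<phi> g = id" "x \<in> S" for g x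
    using represents_id_iff[of "f g" x] \<phi>[OF that(1)] that closed by simp
  ultimately show ?thesis by blast
qed

primrec unary :: "nat \<Rightarrow> bool list" where
  "unary 0 = [True, False]"
| "unary (Suc n) = True # unary n"

lemma unary_Cons: "\<exists>w. unary n = True # w"
  by (cases n) simp_all

lemma unary_append_eqD: "unary m @ u = unary n @ v \<Longrightarrow> m = n \<and> u = v"
proof (induction m arbitrary: n)
  case 0
  show ?case
  proof (cases n)
    case (Suc k)
    with 0 unary_Cons[of k] show ?thesis by auto
  qed (use 0 in simp)
next
  case (Suc m)
  show ?case
  proof (cases n)
    case 0
    with Suc.prems unary_Cons[of m] show ?thesis by auto
  qed (use Suc in simp)
qed

text \<open>
  Unary codewords are self-delimiting, and start with \<open>True\<close>; a final \<open>False\<close> therefore marks the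
  end and makes the code prefix-free.
\<close>

definition bits :: "('l \<Rightarrow> nat) \<Rightarrow> 'l list \<Rightarrow> bool list" where
  "bits idx a = concat (map (\<lambda>l. unary (idx l)) a)"

lemma bits_append: "bits idx (a @ b) = bits idx a @ bits idx b"
  by (simp add: bits_def)

lemma bits_False: "[False] @ w = bits idx \<beta> @ [False] \<Longrightarrow> \<beta> = []"
proof (cases \<beta>)
  case (Cons l \<beta>')
  assume "[False] @ w = bits idx \<beta> @ [False]"
  with Cons unary_Cons[of "idx l"] show ?thesis by (auto simp: bits_def)
qed

lemma bits_prefixD:
  assumes "inj_on idx Y" "a \<in> lists Y" "b \<in> lists Y" "bits idx a @ [False] = bits idx b @ r"
  shows "\<exists>a'. a = b @ a' \<and> r = bits idx a' @ [False]"
  using assms(2-)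
proof (induction b arbitrary: a)
  case Nil
  then show ?case by (auto simp: bits_def)
next
  case (Cons l b)
  show ?case
  proof (cases a)
    case Nil
    then show ?thesis using Cons.prems(3) unary_Cons[of "idx l"] by (auto simp: bits_def)
  next
    case a: (Cons k a0)
    have "unary (idx k) @ (bits idx a0 @ [False]) = unary (idx l) @ (bits idx b @ r)"
      using Cons.prems(3) a by (simp add: bits_def)
    then have *: "idx k = idx l" "bits idx a0 @ [False] = bits idx b @ r"
      using unary_append_eqD by blast+
    have "k = l" using *(1) Cons.prems(1,2) a assms(1) by (simp add: inj_on_eq_iff)
    moreover have "\<exists>a'. a0 = b @ a' \<and> r = bits idx a' @ [False]"
      using Cons.IH[of a0] *(2) Cons.prems(1,2) a by simp
    ultimately show ?thesis using a by simp
  qed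
qed

lemma binary_code_exists:
  fixes code :: "'x \<Rightarrow> 'l list"
  assumes "S \<noteq> {}" "inj_on code S" and Y: "finite Y" "code ` S \<subseteq> lists Y"
  shows "\<exists>code' N. binary_code S code' \<and>
    (\<forall>f x U V \<beta>. x \<in> S \<and> length U \<le> k \<and> code x = U @ \<beta> \<and> replaces_in_code code S f U V \<longrightarrow>
       (\<exists>U' V' \<beta>'. length U' \<le> N \<and> code' x = U' @ \<beta>' \<and> replaces_in_code code' S f U' V'))"
proof -
  obtain idx :: "'l \<Rightarrow> nat" where idx: "inj_on idx Y"
    using finite_imp_inj_to_nat_seg[OF Y(1)] by blast
  define code' where "code' x = bits idx (code x) @ [False]" for x
  define N where "N = Max ((\<lambda>U. length (bits idx U)) ` {U. set U \<subseteq> Y \<and> length U \<le> k})"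
  have inY: "code x \<in> lists Y" if "x \<in> S" for x using Y(2) that by blast
  have decode: "\<exists>\<beta>. code x = U @ \<beta> \<and> r = bits idx \<beta> @ [False]"
    if "x \<in> S" "U \<in> lists Y" "code' x = bits idx U @ r" for x U r
    using bits_prefixD[OF idx inY[OF that(1)] that(2)] that(3) unfolding code'_def by blast
  have "binary_code S code'"
  proof
    show "S \<noteq> {}" by fact
    show "inj_on code' S"
    proof (rule inj_onI)
      fix x y assume xy: "x \<in> S" "y \<in> S" "code' x = code' y"
      then obtain \<beta> where "code x = code y @ \<beta>" "[False] = bits idx \<beta> @ [False]"
        using decode[OF xy(1) inY[OF xy(2)], of "[False]"] by (auto simp: code'_def)
      moreover from this(2) have "\<beta> = []" using bits_False[of "[]" idx \<beta>] by simp
      ultimately show "x = y" using assms(2) xy by (simp add: inj_on_eq_iff)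
    qed
    fix u w assume "u \<in> code' ` S" "u @ w \<in> code' ` S"
    then obtain x y where xy: "x \<in> S" "y \<in> S" "code' y = code' x @ w" by auto
    then have "code' y = bits idx (code x) @ ([False] @ w)" by (simp add: code'_def)
    then obtain \<beta> where "[False] @ w = bits idx \<beta> @ [False]"
      using decode[OF xy(2) inY[OF xy(1)]] by blast
    then show "w = []" using bits_False[of w idx \<beta>] by (auto simp: bits_def)
  qed
  moreover have "\<exists>U' V' \<beta>'. length U' \<le> N \<and> code' x = U' @ \<beta>' \<and> replaces_in_code code' S f U' V'"
    if x: "x \<in> S" and U: "length U \<le> k" "code x = U @ \<beta>" and rep: "replaces_in_code code S f U V"
    for f x U V \<beta>
  proof -
    have iff: "U @ \<beta> \<in> code ` S \<longleftrightarrow> V @ \<beta> \<in> code ` S" for \<beta>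
      using rep unfolding replaces_in_code_def by blast
    have act: "code (f z) = V @ \<beta>" if "z \<in> S" "code z = U @ \<beta>" for z \<beta>
      using rep that unfolding replaces_in_code_def by blast
    have "U @ \<beta> \<in> code ` S" using x U(2) by (metis image_eqI)
    moreover from this have "V @ \<beta> \<in> code ` S" using iff by blast
    ultimately have "U @ \<beta> \<in> lists Y" "V @ \<beta> \<in> lists Y" using Y(2) by blast+
    then have UV: "U \<in> lists Y" "V \<in> lists Y" by auto
    have one: "bits idx V' @ r \<in> code' ` S"
      if h: "bits idx U' @ r \<in> code' ` S" "U' \<in> lists Y" "\<And>\<beta>. U' @ \<beta> \<in> code ` S \<Longrightarrow> V' @ \<beta> \<in> code ` S"
      for U' V' r
    proof -
      from h(1) obtain z where z: "z \<in> S" "code' z = bits idx U' @ r" by auto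
      then obtain \<beta> where \<beta>: "code z = U' @ \<beta>" "r = bits idx \<beta> @ [False]"
        using decode[OF z(1) h(2) z(2)] by blast
      then have "V' @ \<beta> \<in> code ` S" using h(3) z(1) by (metis image_eqI)
      then obtain z' where "z' \<in> S" "code z' = V' @ \<beta>" by auto
      then have "code' z' = bits idx V' @ r" by (simp add: code'_def bits_append \<beta>(2))
      then show ?thesis using \<open>z' \<in> S\<close> by (metis image_eqI)
    qed
    have "replaces_in_code code' S f (bits idx U) (bits idx V)"
      unfolding replaces_in_code_def
    proof (intro conjI allI ballI impI)
      show "bits idx U @ r \<in> code' ` S \<longleftrightarrow> bits idx V @ r \<in> code' ` S" for r
        using one[of U r V] one[of V r U] UV iff by blast
    next
      fix z r assume z: "z \<in> S" "code' z = bits idx U @ r"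
      then obtain \<beta> where \<beta>: "code z = U @ \<beta>" "r = bits idx \<beta> @ [False]"
        using decode[OF z(1) UV(1) z(2)] by blast
      then show "code' (f z) = bits idx V @ r"
        using act[OF z(1)] by (simp add: code'_def bits_append)
    qed
    moreover have "length (bits idx U) \<le> N"
      unfolding N_def using UV(1) U(1) finite_lists_length_le[OF Y(1), of k]
      by (intro Max_ge) auto
    moreover have "code' x = bits idx U @ (bits idx \<beta> @ [False])"
      by (simp add: code'_def U(2) bits_append)
    ultimately show ?thesis by blast
  qed
  ultimately show ?thesis by blast
qed

text \<open>
  If \<open>g\<close> is in the kernel, it fixes all cosets \<open>K #> h\<close>, which says that all conjugates of \<open>g\<close> lie
  in \<open>K\<close>.
\<close>

theorem context_free_subgroup_hom:
  fixes G (structure)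
  assumes grp: "group G" and cf: "context_free_subgroup G K"
  shows "\<exists>\<phi> \<in> hom G thompson_V. \<forall>g\<in>carrier G. \<phi> g = id \<longrightarrow> g \<in> subgroup_core G K"
proof -
  interpret group G by fact
  from cf obtain \<Sigma> :: "nat set" and bar \<rho> where K: "subgroup K G"
    and sym: "symmetric_alphabet \<Sigma> bar" "symmetric_surjection G \<Sigma> bar \<rho>"
    and cfl: "context_free_language (membership_problem \<Sigma> \<rho> K)"
    unfolding context_free_subgroup_def by blast
  obtain F where F: "splitting_family F" "membership_problem \<Sigma> \<rho> K \<in> F"
    by (rule context_free_language_splitting_family[OF cfl])
  note \<rho>_closed = symmetric_surjection_closed[OF sym(2)]
  define S where "S = rcosets K"
  have KG: "K \<subseteq> carrier G" using K by (rule subgroup.subset)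
  have S: "x #> g \<in> S" "x \<subseteq> carrier G" if "x \<in> S" "g \<in> carrier G" for x g
  proof -
    from that(1) obtain h where h: "h \<in> carrier G" "x = K #> h" unfolding S_def RCOSETS_def by blast
    then show "x \<subseteq> carrier G" using r_coset_subset_G[OF KG] by simp
    have "x #> g = K #> (h \<otimes> g)" using h that(2) coset_mult_assoc[OF KG] by simp
    then show "x #> g \<in> S" using h(1) that(2) unfolding S_def RCOSETS_def by blast
  qed
  have assoc: "x #> g #> h = x #> (g \<otimes> h)" if "x \<in> S" "g \<in> carrier G" "h \<in> carrier G" for x g h
    using coset_mult_assoc[OF S(2)[OF that(1,2)] that(2,3)] .
  have one: "x #> \<one> = x" if "x \<in> S" for x using coset_mult_one S(2)[OF that one_closed] by blast
  have KS: "K \<in> S" unfolding S_def by (rule subgroup.subgroup_in_rcosets[OF K grp])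
  \<comment> \<open>Made the identity outside the cosets, so that letters are invertible on the whole type.\<close>
  define act where "act s x = (if x \<in> S then x #> \<rho> [s] else x)" for s x
  have sing: "\<rho> [s] \<in> carrier G" if "s \<in> \<Sigma>" for s using \<rho>_closed that by simp
  have bar: "bar s \<in> \<Sigma>" "bar (bar s) = s" "\<rho> [bar s] = inv (\<rho> [s])" if "s \<in> \<Sigma>" for s
  proof -
    show "bar s \<in> \<Sigma>" "bar (bar s) = s" using sym(1) that unfolding symmetric_alphabet_def by auto
    have "\<rho> (bar_word bar [s]) = inv (\<rho> [s])"
      using sym(2) that unfolding symmetric_surjection_def by (metis Cons_in_lists_iff lists.Nil)
    then show "\<rho> [bar s] = inv (\<rho> [s])" by (simp add: bar_word_def)
  qed
  interpret symmetric_action \<Sigma> bar act K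
  proof
    show "finite \<Sigma>" using sym(1) by (simp add: symmetric_alphabet_def)
    fix s assume s: "s \<in> \<Sigma>"
    show "bar s \<in> \<Sigma>" "bar (bar s) = s" using bar[OF s] by auto
    show "act (bar s) (act s x) = x" for x
      using S(1)[OF _ sing[OF s]] assoc[OF _ sing[OF s] inv_closed[OF sing[OF s]]] one bar(3)[OF s]
        sing[OF s] by (auto simp: act_def)
  qed
  have run: "run act x w = x #> \<rho> w" if "x \<in> S" "w \<in> lists \<Sigma>" for x w
    using that
  proof (induction w rule: rev_induct)
    case Nil
    have "\<rho> [] = \<one>" using sym(2) by (simp add: symmetric_surjection_def)
    then show ?case using one Nil by simp
  next
    case (snoc s w)
    then have *: "w \<in> lists \<Sigma>" "[s] \<in> lists \<Sigma>" by auto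
    have "run act x (w @ [s]) = x #> \<rho> w #> \<rho> [s]"
      using snoc * S(1)[OF snoc.prems(1) \<rho>_closed[OF *(1)]] by (simp add: act_def)
    also have "\<dots> = x #> \<rho> (w @ [s])"
      using assoc[OF snoc.prems(1)] \<rho>_closed * symmetric_surjection_append[OF sym(2) *] by simp
    finally show ?case .
  qed
  have verts: "verts = S"
  proof
    show "verts \<subseteq> S"
    proof
      fix x assume "x \<in> verts"
      then obtain w where "set w \<subseteq> \<Sigma>" "x = run act K w" unfolding verts_def by blast
      then have "w \<in> lists \<Sigma>" "x = K #> \<rho> w" using run[OF KS, of w] by auto
      then show "x \<in> S" using S(1)[OF KS] \<rho>_closed by blast
    qed
    show "S \<subseteq> verts"
    proof
      fix x assume "x \<in> S"
      then obtain g where g: "g \<in> carrier G" "x = K #> g" unfolding S_def RCOSETS_def by blast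
      obtain w where w: "w \<in> lists \<Sigma>" "\<rho> w = g" by (rule symmetric_surjectionE[OF sym(2) g(1)])
      then have "x = run act K w" using run[OF KS w(1)] g(2) by simp
      then show "x \<in> verts" unfolding verts_def using w(1) by auto
    qed
  qed
  have "{w \<in> lists \<Sigma>. run act K w = K} = membership_problem \<Sigma> \<rho> K"
    unfolding membership_problem_def
  proof (rule Collect_cong)
    fix w
    show "w \<in> lists \<Sigma> \<and> run act K w = K \<longleftrightarrow> w \<in> lists \<Sigma> \<and> \<rho> w \<in> K"
      using run[OF KS, of w] \<rho>_closed[of w] coset_join1[OF _ _ K, of "\<rho> w"] coset_join2[OF _ K, of "\<rho> w"]
      by metis
  qed
  then interpret context_free_action \<Sigma> bar act K F
    using F by unfold_locales simp_all
  obtain rep where rep: "finite (rep ` verts)" "\<And>x. x \<in> verts \<Longrightarrow> cone_iso (rep x) x"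
    using finitely_many_cone_types by blast
  interpret finite_cone_types \<Sigma> bar act K rep
    using rep by unfold_locales
  have "S \<noteq> {}" "inj_on addr S" "finite letters" "addr ` S \<subseteq> lists letters"
    using KS inj_on_addr finite_letters addr_letters verts by auto
  from binary_code_exists[OF this, of 2] obtain code N where code: "binary_code S code"
    "\<And>f x U V \<beta>. x \<in> S \<Longrightarrow> length U \<le> 2 \<Longrightarrow> addr x = U @ \<beta> \<Longrightarrow> replaces_in_code addr S f U V \<Longrightarrow>
       \<exists>U' V' \<beta>'. length U' \<le> N \<and> code x = U' @ \<beta>' \<and> replaces_in_code code S f U' V'"
    by blast
  have cong: "replaces_in_code code S f U V \<Longrightarrow> (\<And>x. x \<in> S \<Longrightarrow> f x = g x) \<Longrightarrow> replaces_in_code code S g U V"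
    for f g U V
    unfolding replaces_in_code_def by metis
  have "\<exists>\<phi> \<in> hom G thompson_V. \<forall>g\<in>carrier G. \<phi> g = id \<longrightarrow> (\<forall>x\<in>S. x #> g = x)"
  proof (rule binary_code_action_hom[OF grp code(1) sym(2), where N = N and f = "\<lambda>g x. x #> g"])
    fix s x assume s: "s \<in> \<Sigma>" and x: "x \<in> S"
    obtain U V \<beta> where U: "length U \<le> 2" "addr x = U @ \<beta>" "replaces_in_code addr S (act s) U V"
      using act_replaces_prefix[OF s] x verts by metis
    from code(2)[OF x U] obtain U' V' \<beta>' where "length U' \<le> N" "code x = U' @ \<beta>'"
        "replaces_in_code code S (act s) U' V'" by blast
    moreover from this(3) have "replaces_in_code code S (\<lambda>x. x #> \<rho> [s]) U' V'"
      by (rule cong) (simp add: act_def)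
    ultimately show "\<exists>U V \<beta>. length U \<le> N \<and> code x = U @ \<beta> \<and>
        replaces_in_code code S (\<lambda>x. x #> \<rho> [s]) U V" by blast
  qed (use S(1) one assoc in simp_all)
  then obtain \<phi> where \<phi>: "\<phi> \<in> hom G thompson_V"
      "\<And>g x. g \<in> carrier G \<Longrightarrow> \<phi> g = id \<Longrightarrow> x \<in> S \<Longrightarrow> x #> g = x" by blast
  have "g \<in> subgroup_core G K" if g: "g \<in> carrier G" "\<phi> g = id" for g
    unfolding mem_subgroup_core_iff[OF grp K]
  proof (intro conjI ballI)
    show "g \<in> carrier G" by fact
    fix h assume h: "h \<in> carrier G"
    have "K #> (h \<otimes> g \<otimes> inv h) = K #> h #> g #> inv h"
      using h g(1) coset_mult_assoc[OF KG] r_coset_subset_G[OF KG] by (simp add: m_assoc)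
    also have "\<dots> = K #> h #> inv h" using \<phi>(2)[OF g S(1)[OF KS h]] by simp
    also have "\<dots> = K" using h coset_mult_assoc[OF KG] coset_mult_one[OF KG] by simp
    finally show "h \<otimes> g \<otimes> inv h \<in> K" using coset_join1[OF _ _ K] h g(1) by simp
  qed
  then show ?thesis using \<phi>(1) by blast
qed

theorem context_free_subgroups_give_embedding:
  fixes G :: "('a, 'b) monoid_scheme" (structure) and H :: "nat \<Rightarrow> 'a set"
  assumes grp: "group G" and H: "\<And>i. i \<in> {1..n} \<Longrightarrow> context_free_subgroup G (H i)"
    and core: "(\<Inter>i\<in>{1..n}. subgroup_core G (H i)) = {\<one>}"
  shows "\<exists>\<phi>. \<phi> \<in> hom G thompson_V \<and> inj_on \<phi> (carrier G)"
proof -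
  interpret group G by fact
  have "\<exists>\<phi>\<in>hom G thompson_V. \<forall>g\<in>carrier G. \<phi> g = id \<longrightarrow> (\<forall>i\<in>{1..m}. g \<in> subgroup_core G (H i))"
    if "m \<le> n" for m
    using that
  proof (induction m)
    case 0
    have "(\<lambda>_. id) \<in> hom G thompson_V" using id_in_thompson_V by (simp add: hom_def)
    then show ?case by (intro bexI[of _ "\<lambda>_. id"]) simp_all
  next
    case (Suc m)
    then have "m \<le> n" by simp
    from Suc.IH[OF this] obtain \<phi> where \<phi>: "\<phi> \<in> hom G thompson_V"
        "\<And>g. g \<in> carrier G \<Longrightarrow> \<phi> g = id \<Longrightarrow> \<forall>i\<in>{1..m}. g \<in> subgroup_core G (H i)" by blast
    have "context_free_subgroup G (H (Suc m))" using H Suc.prems by simp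
    from context_free_subgroup_hom[OF grp this] obtain \<psi> where \<psi>: "\<psi> \<in> hom G thompson_V"
        "\<And>g. g \<in> carrier G \<Longrightarrow> \<psi> g = id \<Longrightarrow> g \<in> subgroup_core G (H (Suc m))" by blast
    define \<theta> where "\<theta> g = glue (\<phi> g) (\<psi> g)" for g
    have "\<theta> \<in> hom G thompson_V"
      using \<phi>(1) \<psi>(1) glue_in_thompson_V by (auto simp: hom_def \<theta>_def glue_comp Pi_iff)
    moreover have "\<forall>i\<in>{1..Suc m}. g \<in> subgroup_core G (H i)" if "g \<in> carrier G" "\<theta> g = id" for g
      using \<phi>(2)[OF that(1)] \<psi>(2)[OF that(1)] glue_eq_idD[of "\<phi> g" "\<psi> g"] that(2)
      by (auto simp: \<theta>_def le_Suc_eq)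
    ultimately show ?case by blast
  qed
  from this[OF order.refl] obtain \<phi> where \<phi>: "\<phi> \<in> hom G thompson_V"
      "\<And>g. g \<in> carrier G \<Longrightarrow> \<phi> g = id \<Longrightarrow> \<forall>i\<in>{1..n}. g \<in> subgroup_core G (H i)" by blast
  have "inj_on \<phi> (carrier G)"
  proof (rule inj_onI)
    fix g h assume gh: "g \<in> carrier G" "h \<in> carrier G" "\<phi> g = \<phi> h"
    have "\<phi> (g \<otimes> inv h) = \<phi> (h \<otimes> inv h)"
      using hom_mult[OF \<phi>(1) gh(1) inv_closed[OF gh(2)]]
        hom_mult[OF \<phi>(1) gh(2) inv_closed[OF gh(2)]] gh(3) by (simp only: thompson_V_simps)
    then have "\<phi> (g \<otimes> inv h) = id" using gh hom_thompson_V_one[OF grp \<phi>(1)] by simp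
    then have "g \<otimes> inv h \<in> (\<Inter>i\<in>{1..n}. subgroup_core G (H i))"
      using \<phi>(2)[of "g \<otimes> inv h"] gh by simp
    then have "g \<otimes> inv h = \<one>" using core by blast
    then show "g = h" using gh by (metis inv_closed inv_equality inv_inv)
  qed
  then show ?thesis using \<phi>(1) by blast
qed

theorem theorem3:
  fixes G :: "('a, 'b) monoid_scheme"
  assumes "finitely_generated_group G"
  shows "(\<exists>(n :: nat) (H :: nat \<Rightarrow> 'a set). n \<ge> 1 \<and>
            (\<forall>i\<in>{1..n}. context_free_subgroup G (H i)) \<and>
            (\<Inter>i\<in>{1..n}. subgroup_core G (H i)) = {\<one>\<^bsub>G\<^esub>})
         \<longleftrightarrow> (\<exists>\<phi>. \<phi> \<in> hom G thompson_V \<and> inj_on \<phi> (carrier G))"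
proof
  have "group G" using assms by (simp add: finitely_generated_group_def)
  moreover assume "\<exists>(n :: nat) (H :: nat \<Rightarrow> 'a set). n \<ge> 1 \<and>
            (\<forall>i\<in>{1..n}. context_free_subgroup G (H i)) \<and>
            (\<Inter>i\<in>{1..n}. subgroup_core G (H i)) = {\<one>\<^bsub>G\<^esub>}"
  ultimately show "\<exists>\<phi>. \<phi> \<in> hom G thompson_V \<and> inj_on \<phi> (carrier G)"
    using context_free_subgroups_give_embedding by blast
next
  assume "\<exists>\<phi>. \<phi> \<in> hom G thompson_V \<and> inj_on \<phi> (carrier G)"
  then show "\<exists>(n :: nat) (H :: nat \<Rightarrow> 'a set). n \<ge> 1 \<and>
            (\<forall>i\<in>{1..n}. context_free_subgroup G (H i)) \<and>
            (\<Inter>i\<in>{1..n}. subgroup_core G (H i)) = {\<one>\<^bsub>G\<^esub>}"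
    using embedding_gives_context_free_subgroups[OF assms] by blast
qed

end
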